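(* Let $k,n\in\mathbb N$ with $k>n$ and let $\mathbb E=\mathbb R$ or $\mathbb E=\mathbb C$. Then: (i) $N^{\mathbb E}_{k,n}$ is a nonempty, regular, real analytic submanifold of $M_k(\mathbb E)$ with $$\dim(N^{\mathbb E}_{k,n})=\begin{cases}(k-n-1)(n-1),&\mathbb E=\mathbb R,\\ 2n(k-n)-k+1,&\mathbb E=\mathbb C.\end{cases}$$ Let $d=\gcd(k,n)$ and let $k'=k/d$, $n'=n/d$. Let $\mathcal P(k,k')$ be the set of all partitions of the set $\{1,\dots,k\}$ into subsets whose cardinalities are multiples of $k'$. Then: (ii) $$\mathcal G^{\mathbb E}_{k,n}=\bigcup_{\sigma\in\mathcal P(k,k')}N^{\mathbb E}_{k,n}(\sigma)$$ and the sets $(N^{\mathbb E}_{k,n}(\sigma))_{\sigma\in\mathcal P(k,k')}$ are pairwise disjoint; (iii) if $\sigma=\{A_1,\dots,A_\ell\}\in\mathcal P(k,k')$ with $|A_i|=m_ik'$, then $N^{\mathbb E}_{k,n}(\sigma)$ is a nonempty, regular, real analytic submanifold of $M_k(\mathbb E)$ and is real-analytically diffeomorphic to the Cartesian product $\prod_{i=1}^\ell N^{\mathbb E}_{m_ik',m_in'}$.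
   Context: "Regular submanifold" means embedded submanifold; dimensions are real and $M_k(\mathbb C)$ is regarded as a real vector space. $\mathcal G^{\mathbb E}_{k,n}=\{\frac kn P\mid P\in M_k(\mathbb E)$ a projection (self-adjoint idempotent) of rank $n$, $P_{ii}=\frac nk$ for $1\le i\le k\}$. For $A\subseteq\{1,\dots,k\}$, $Q_A\in M_k(\mathbb E)$ is the projection onto the span of the standard basis vectors $\xi_i$, $i\in A$. For $T\in M_k(\mathbb E)$, $\sigma_T$ is the set of all minimal nonempty subsets $A$ of $\{1,\dots,k\}$ satisfying $Q_AT=TQ_A$; it is a partition of $\{1,\dots,k\}$. For a partition $\sigma$ of $\{1,\dots,k\}$, $N^{\mathbb E}_{k,n}(\sigma)=\{R\in\mathcal G^{\mathbb E}_{k,n}\mid\sigma_R=\sigma\}$, and $N^{\mathbb E}_{k,n}$ denotes $N^{\mathbb E}_{k,n}(\mathbf 1_k)$, where $\mathbf 1_k$ is the trivial partition of $\{1,\dots,k\}$ into one subset. *)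

theory Defs
  imports
    "HOL-Analysis.Analysis"
    "HOL-Library.Disjoint_Sets"
    "Jordan_Normal_Form.Schur_Decomposition"
    "Jordan_Normal_Form.DL_Rank"
begin

section \<open>Real analytic maps and embedded submanifolds of \<open>\<real>\<^sup>I\<close>\<close>

text \<open>
  For a finite index set \<open>I\<close>, the space \<open>\<real>\<^sup>I\<close> is the topological space
  \<^term>\<open>powertop_real I\<close>, whose points are the functions in \<^term>\<open>I \<rightarrow>\<^sub>E (UNIV :: real set)\<close>.
  The explicit index set lets the dimension vary inside a formula.
\<close>

abbreviation Rpow :: "'i set \<Rightarrow> ('i \<Rightarrow> real) set" where
  "Rpow I \<equiv> I \<rightarrow>\<^sub>E UNIV"

text \<open>
  The function \<open>f\<close> is the sum of an (unconditionally, hence absolutely) convergent power series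
  centred at \<open>x\<close> on some open cube around \<open>x\<close>. The summation index \<open>\<alpha>\<close> ranges over the
  multi-indices in \<open>\<nat>\<^sup>I\<close>.
\<close>

definition real_analytic_at :: "'i set \<Rightarrow> (('i \<Rightarrow> real) \<Rightarrow> real) \<Rightarrow> ('i \<Rightarrow> real) \<Rightarrow> bool" where
  "real_analytic_at I f x \<longleftrightarrow>
     (\<exists>(c :: ('i \<Rightarrow> nat) \<Rightarrow> real) r. r > 0 \<and>
        (\<forall>y\<in>Rpow I. (\<forall>i\<in>I. \<bar>y i - x i\<bar> < r) \<longrightarrow>
           ((\<lambda>\<alpha>. c \<alpha> * (\<Prod>i\<in>I. (y i - x i) ^ \<alpha> i)) has_sum f y) (I \<rightarrow>\<^sub>E UNIV)))"

definition real_analytic_map ::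
  "'i set \<Rightarrow> 'j set \<Rightarrow> ('i \<Rightarrow> real) set \<Rightarrow> (('i \<Rightarrow> real) \<Rightarrow> 'j \<Rightarrow> real) \<Rightarrow> bool" where
  "real_analytic_map I J U f \<longleftrightarrow>
     openin (powertop_real I) U \<and> f \<in> U \<rightarrow> Rpow J \<and>
     (\<forall>x\<in>U. \<forall>j\<in>J. real_analytic_at I (\<lambda>y. f y j) x)"

text \<open>
  Regular (embedded) real analytic submanifold of \<open>\<real>\<^sup>I\<close> of dimension \<open>d\<close>: around every point
  of \<open>S\<close> there is a real analytic chart \<open>\<phi>\<close> of the ambient space which flattens \<open>S\<close> to a
  coordinate subspace of dimension \<open>d\<close>. The chart takes values in \<open>\<real>\<^sup>I\<close> again, and \<open>J\<close> is the
  set of those coordinates which remain free on \<open>S\<close>.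
\<close>

definition real_analytic_submanifold :: "'i set \<Rightarrow> nat \<Rightarrow> ('i \<Rightarrow> real) set \<Rightarrow> bool" where
  "real_analytic_submanifold I d S \<longleftrightarrow>
     S \<subseteq> Rpow I \<and>
     (\<forall>p\<in>S. \<exists>U W \<phi> \<psi> J.
        p \<in> U \<and>
        real_analytic_map I I U \<phi> \<and> real_analytic_map I I W \<psi> \<and>
        \<phi> ` U = W \<and> \<psi> ` W = U \<and> (\<forall>x\<in>U. \<psi> (\<phi> x) = x) \<and> (\<forall>y\<in>W. \<phi> (\<psi> y) = y) \<and>
        J \<subseteq> I \<and> card J = d \<and>
        \<phi> ` (U \<inter> S) = {y\<in>W. \<forall>i\<in>I - J. y i = 0})"

text \<open>
  A map defined on a subset \<open>S\<close> of \<open>\<real>\<^sup>I\<close> is real analytic if locally it is the restriction of a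
  real analytic map defined on an open subset of \<open>\<real>\<^sup>I\<close>. On an embedded submanifold this is
  real analyticity with respect to the induced analytic structure.
\<close>

definition real_analytic_map_on ::
  "'i set \<Rightarrow> 'j set \<Rightarrow> ('i \<Rightarrow> real) set \<Rightarrow> (('i \<Rightarrow> real) \<Rightarrow> 'j \<Rightarrow> real) \<Rightarrow> bool" where
  "real_analytic_map_on I J S f \<longleftrightarrow>
     (\<forall>p\<in>S. \<exists>U F. p \<in> U \<and> real_analytic_map I J U F \<and> (\<forall>x\<in>U \<inter> S. F x = f x))"

definition real_analytic_diffeomorphic ::
  "'i set \<Rightarrow> ('i \<Rightarrow> real) set \<Rightarrow> 'j set \<Rightarrow> ('j \<Rightarrow> real) set \<Rightarrow> bool" where
  "real_analytic_diffeomorphic I S J T \<longleftrightarrow>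
     (\<exists>f g. real_analytic_map_on I J S f \<and> real_analytic_map_on J I T g \<and>
        f ` S = T \<and> g ` T = S \<and> (\<forall>x\<in>S. g (f x) = x) \<and> (\<forall>y\<in>T. f (g y) = y))"

section \<open>Matrix spaces as real vector spaces\<close>

text \<open>
  The real coordinates of a \<open>k \<times> k\<close> matrix over \<open>\<real>\<close> or \<open>\<complex>\<close> are the coordinates of its entries
  with respect to the standard real basis \<^const>\<open>Basis\<close> of the scalars, which is \<open>{1}\<close> for
  \<^typ>\<open>real\<close> and \<open>{1, \<i>}\<close> for \<^typ>\<open>complex\<close>.
\<close>

definition mat_idx :: "nat \<Rightarrow> (nat \<times> nat \<times> 'e :: euclidean_space) set" where
  "mat_idx k = {..<k} \<times> {..<k} \<times> Basis"

definition mat_coords :: "nat \<Rightarrow> 'e :: euclidean_space mat \<Rightarrow> nat \<times> nat \<times> 'e \<Rightarrow> real" where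
  "mat_coords k T = (\<lambda>(i, j, b)\<in>mat_idx k. inner (T $$ (i, j)) b)"

lemma bij_betw_mat_coords:
  "bij_betw (mat_coords k) (carrier_mat k k :: 'e :: euclidean_space mat set) (Rpow (mat_idx k))"
proof (rule bij_betw_imageI)
  show "inj_on (mat_coords k) (carrier_mat k k :: 'e mat set)"
  proof (rule inj_onI)
    fix S T :: "'e mat"
    assume S: "S \<in> carrier_mat k k" and T: "T \<in> carrier_mat k k"
      and eq: "mat_coords k S = mat_coords k T"
    have "S $$ (i, j) = T $$ (i, j)" if "i < k" "j < k" for i j
    proof (rule euclidean_eqI)
      fix b :: 'e assume "b \<in> Basis"
      with that fun_cong[OF eq, of "(i, j, b)"]
      show "inner (S $$ (i, j)) b = inner (T $$ (i, j)) b"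
        by (simp add: mat_coords_def mat_idx_def)
    qed
    with S T show "S = T" by (intro eq_matI) auto
  qed
  show "mat_coords k ` (carrier_mat k k :: 'e mat set) = Rpow (mat_idx k)"
  proof
    show "mat_coords k ` (carrier_mat k k :: 'e mat set) \<subseteq> Rpow (mat_idx k)"
      by (auto simp: mat_coords_def)
    show "Rpow (mat_idx k) \<subseteq> mat_coords k ` (carrier_mat k k :: 'e mat set)"
    proof
      fix x :: "nat \<times> nat \<times> 'e \<Rightarrow> real" assume x: "x \<in> Rpow (mat_idx k)"
      define T where "T = mat k k (\<lambda>(i, j). \<Sum>b\<in>Basis. x (i, j, b) *\<^sub>R b)"
      have "mat_coords k T = x"
      proof
        fix t :: "nat \<times> nat \<times> 'e"
        obtain i j b where t: "t = (i, j, b)" by (cases t)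
        show "mat_coords k T t = x t"
        proof (cases "t \<in> mat_idx k")
          case True
          then have "i < k" "j < k" and b: "b \<in> Basis" by (auto simp: t mat_idx_def)
          then have "mat_coords k T t = inner (\<Sum>b\<in>Basis. x (i, j, b) *\<^sub>R b) b"
            using True by (simp add: mat_coords_def T_def t)
          also have "\<dots> = x t"
            using b by (simp add: inner_sum_left_Basis t)
          finally show ?thesis .
        next
          case False
          then show ?thesis using PiE_arb[OF x False] by (simp add: mat_coords_def)
        qed
      qed
      moreover have "T \<in> carrier_mat k k" by (simp add: T_def)
      ultimately show "x \<in> mat_coords k ` carrier_mat k k" by blast
    qed
  qed
qed

definition mat_submanifold :: "nat \<Rightarrow> nat \<Rightarrow> 'e :: euclidean_space mat set \<Rightarrow> bool" where
  "mat_submanifold k d S \<longleftrightarrow>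
     S \<subseteq> carrier_mat k k \<and> real_analytic_submanifold (mat_idx k) d (mat_coords k ` S)"

text \<open>
  An element of the product of the spaces of \<open>s i \<times> s i\<close> matrices, \<open>i < l\<close>, is an extensional
  function \<open>M\<close> on \<^term>\<open>{..<l}\<close>; its coordinates are indexed by the disjoint union of the index
  sets of the factors.
\<close>

definition prod_idx :: "nat \<Rightarrow> (nat \<Rightarrow> nat) \<Rightarrow> (nat \<times> nat \<times> nat \<times> 'e :: euclidean_space) set" where
  "prod_idx l s = (SIGMA i:{..<l}. mat_idx (s i))"

definition prod_coords ::
  "nat \<Rightarrow> (nat \<Rightarrow> nat) \<Rightarrow> (nat \<Rightarrow> 'e :: euclidean_space mat) \<Rightarrow> nat \<times> nat \<times> nat \<times> 'e \<Rightarrow> real" where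
  "prod_coords l s M = (\<lambda>(i, t)\<in>prod_idx l s. mat_coords (s i) (M i) t)"

section \<open>The sets \<open>\<G>\<^sub>k\<^sub>,\<^sub>n\<close> and \<open>N\<^sub>k\<^sub>,\<^sub>n(\<sigma>)\<close>\<close>

text \<open>Rows and columns of matrices are indexed by \<open>{0, \<dots>, k - 1}\<close> instead of \<open>{1, \<dots>, k}\<close>.\<close>

definition projection :: "nat \<Rightarrow> 'e :: conjugatable_field mat \<Rightarrow> bool" where
  "projection k P \<longleftrightarrow> P \<in> carrier_mat k k \<and> mat_adjoint P = P \<and> P * P = P"

definition GG :: "nat \<Rightarrow> nat \<Rightarrow> 'e :: conjugatable_field mat set" where
  "GG k n = {(of_nat k / of_nat n) \<cdot>\<^sub>m P | P.
     projection k P \<and> vec_space.rank k P = n \<and> (\<forall>i<k. P $$ (i, i) = of_nat n / of_nat k)}"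

text \<open>Projection onto the span of the standard basis vectors with index in \<open>A\<close>.\<close>

definition coord_proj :: "nat \<Rightarrow> nat set \<Rightarrow> 'e :: field mat" where
  "coord_proj k A = mat k k (\<lambda>(i, j). if i = j \<and> i \<in> A then 1 else 0)"

lemma projection_coord_proj: "projection k (coord_proj k A)"
proof -
  have "coord_proj k A * coord_proj k A = (coord_proj k A :: 'a mat)"
  proof (rule eq_matI)
    fix i j assume "i < dim_row (coord_proj k A)" "j < dim_col (coord_proj k A)"
    then have ij: "i < k" "j < k" by (simp_all add: coord_proj_def)
    have "(coord_proj k A * coord_proj k A :: 'a mat) $$ (i, j)
        = (\<Sum>l\<in>{0..<k}. (if i = l \<and> i \<in> A then 1 else 0) * (if l = j \<and> l \<in> A then 1 else 0))"
      using ij by (simp add: coord_proj_def scalar_prod_def)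
    also have "\<dots> = (\<Sum>l\<in>{0..<k}. (if i = l then (if i = j \<and> i \<in> A then 1 else 0) else 0))"
      by (rule sum.cong) auto
    finally show "(coord_proj k A * coord_proj k A :: 'a mat) $$ (i, j) = coord_proj k A $$ (i, j)"
      using ij by (simp add: coord_proj_def)
  qed (simp_all add: coord_proj_def)
  moreover have "conjugate (1 :: 'a) = 1"
  proof -
    have "conjugate (1 :: 'a) * conjugate 1 = conjugate 1"
      by (metis conjugate_dist_mul mult_1)
    moreover have "conjugate (1 :: 'a) \<noteq> 0" by simp
    ultimately show ?thesis by simp
  qed
  then have "mat_adjoint (coord_proj k A) = (coord_proj k A :: 'a mat)"
    by (intro eq_matI) (auto simp: coord_proj_def mat_adjoint_def mat_of_rows_def)
  ultimately show ?thesis by (simp add: projection_def coord_proj_def)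
qed

lemma coord_proj_mult_vec:
  assumes "v \<in> carrier_vec k"
  shows "coord_proj k A *\<^sub>v v = vec k (\<lambda>i. if i \<in> A then vec_index v i else 0)"
proof (rule eq_vecI)
  fix i assume "i < dim_vec (vec k (\<lambda>i. if i \<in> A then vec_index v i else 0))"
  then have i: "i < k" by simp
  have "vec_index (coord_proj k A *\<^sub>v v) i
      = (\<Sum>j\<in>{0..<k}. (if i = j \<and> i \<in> A then 1 else 0) * vec_index v j)"
    using assms i by (simp add: coord_proj_def scalar_prod_def)
  also have "\<dots> = (\<Sum>j\<in>{0..<k}. (if i = j then (if i \<in> A then vec_index v i else 0) else 0))"
    by (rule sum.cong) auto
  finally show "vec_index (coord_proj k A *\<^sub>v v) i
      = vec_index (vec k (\<lambda>i. if i \<in> A then vec_index v i else 0)) i"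
    using i by simp
qed (simp add: coord_proj_def)

definition sigma :: "nat \<Rightarrow> 'e :: field mat \<Rightarrow> nat set set" where
  "sigma k T = {A. A \<noteq> {} \<and> A \<subseteq> {..<k} \<and> coord_proj k A * T = T * coord_proj k A \<and>
     (\<forall>B. B \<noteq> {} \<and> B \<subset> A \<longrightarrow> coord_proj k B * T \<noteq> T * coord_proj k B)}"

definition Npart :: "nat \<Rightarrow> nat \<Rightarrow> nat set set \<Rightarrow> 'e :: conjugatable_field mat set" where
  "Npart k n \<sigma> = {R \<in> GG k n. sigma k R = \<sigma>}"

definition NN :: "nat \<Rightarrow> nat \<Rightarrow> 'e :: conjugatable_field mat set" where
  "NN k n = Npart k n {{..<k}}"

definition partitions_mult :: "nat \<Rightarrow> nat \<Rightarrow> nat set set set" where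
  "partitions_mult k k' = {\<sigma>. partition_on {..<k} \<sigma> \<and> (\<forall>A\<in>\<sigma>. k' dvd card A)}"

end

theory Submission
  imports Defs "HOL-Library.Function_Algebras"
begin

text \<open>
  Let \<open>P\<close> be a projection with constant diagonal and \<open>Q = 1 - P\<close>. For Hermitian \<open>Y\<close> near \<open>0\<close>, the
  matrix \<open>P + Y\<close> is a projection if and only if \<open>Y + P Y\<^sup>2 P - Q Y\<^sup>2 Q\<close> is off-diagonal with respect to
  \<open>P, Q\<close>. Since \<open>P\<close> is irreducible on each part of its partition, the diagonal of off-diagonal
  Hermitian matrices can be prescribed freely up to the traces over the parts (a weighted graph
  Laplacian is invertible), and these traces are locally constant because projections have integral
  trace. Subtracting a suitable lift of the diagonal gives a polynomial chart \<open>Y + b(Y, Y)\<close> which maps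
  the given set onto a linear space \<open>K\<close>. Its inverse is analytic: the Picard iteration for a
  quadratic fixed point equation converges as a power series. The dimension of \<open>K\<close> is the trace of a
  linear idempotent onto \<open>K\<close>.

  The divisibility condition on the parts is the integrality of the traces over the parts; for the
  existence of irreducible elements one projects onto \<open>n\<close> consecutive Fourier modes.
\<close>

section \<open>Real analytic functions and power series\<close>

text \<open>Idempotency of \<open>P + Y\<close> means \<open>Y = P Y + Y P + Y\<^sup>2\<close>. Its
  diagonal corners read \<open>P Y P = - P Y\<^sup>2 P\<close> and
  \<open>Q Y Q = Q Y\<^sup>2 Q\<close>, whence the quadratic correction; the off-diagonal corner
  then holds automatically for small \<open>Y\<close>, because the defect commutes with
  \<open>P + Y\<close>. The obstacle is the diagonal: its \<open>k\<close> equations are dependent,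
  since an off-diagonal Hermitian matrix has trace zero over every part. The derivative of the
  diagonal is thus not surjective, and integrality has to supply the missing equations. Having a
  given partition splits into a linear condition (no entries between different parts), which is
  built into the chart, and an open one (the nonzero entries connect each part), which survives
  small perturbations. Maps \<open>z + b(z, z)\<close> keep this form under linear changes of
  coordinates and, up to the linear part, under recentring, so one solver for quadratic fixed point
  equations replaces an inverse function theorem. Real and complex matrices are treated together;
  they differ only in \<open>DIM('e)\<close> and in the real trace of conjugate-linear
  terms.\<close>

abbreviation mindex :: "'i set \<Rightarrow> ('i \<Rightarrow> nat) set" where
  "mindex I \<equiv> I \<rightarrow>\<^sub>E UNIV"

definition monom_at :: "'i set \<Rightarrow> ('i \<Rightarrow> real) \<Rightarrow> ('i \<Rightarrow> nat) \<Rightarrow> real" where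
  "monom_at I z \<alpha> = (\<Prod>i\<in>I. z i ^ \<alpha> i)"

definition madd :: "'i set \<Rightarrow> ('i \<Rightarrow> nat) \<Rightarrow> ('i \<Rightarrow> nat) \<Rightarrow> 'i \<Rightarrow> nat" where
  "madd I \<alpha> \<beta> = (\<lambda>i\<in>I. \<alpha> i + \<beta> i)"

definition munit :: "'i set \<Rightarrow> 'i \<Rightarrow> 'i \<Rightarrow> nat" where
  "munit I j = (\<lambda>i\<in>I. if i = j then 1 else 0)"

definition mdeg :: "'i set \<Rightarrow> ('i \<Rightarrow> nat) \<Rightarrow> nat" where
  "mdeg I \<alpha> = (\<Sum>i\<in>I. \<alpha> i)"

definition splits :: "'i set \<Rightarrow> ('i \<Rightarrow> nat) \<Rightarrow> (('i \<Rightarrow> nat) \<times> ('i \<Rightarrow> nat)) set" where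
  "splits I \<alpha> = {(\<beta>, \<gamma>). \<beta> \<in> mindex I \<and> \<gamma> \<in> mindex I \<and> madd I \<beta> \<gamma> = \<alpha>}"

lemma madd_in [simp]: "madd I \<alpha> \<beta> \<in> mindex I"
  by (simp add: madd_def)

lemma munit_in [simp]: "munit I j \<in> mindex I"
  by (simp add: munit_def)

lemma finite_splits: assumes "finite I" shows "finite (splits I \<alpha>)"
proof (rule finite_subset)
  show "splits I \<alpha> \<subseteq> (PiE I (\<lambda>i. {..\<alpha> i})) \<times> (PiE I (\<lambda>i. {..\<alpha> i}))"
    by (auto simp: splits_def madd_def PiE_iff extensional_def)
  show "finite ((PiE I (\<lambda>i. {..\<alpha> i})) \<times> (PiE I (\<lambda>i. {..\<alpha> i})))"
    using assms by (intro finite_cartesian_product finite_PiE) auto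
qed

lemma monom_at_madd: "monom_at I z (madd I \<alpha> \<beta>) = monom_at I z \<alpha> * monom_at I z \<beta>"
  by (simp add: monom_at_def madd_def power_add prod.distrib)

lemma mdeg_madd: "mdeg I (madd I \<alpha> \<beta>) = mdeg I \<alpha> + mdeg I \<beta>"
  by (simp add: mdeg_def madd_def sum.distrib)

lemma mdeg_munit: "finite I \<Longrightarrow> j \<in> I \<Longrightarrow> mdeg I (munit I j) = 1"
  by (simp add: mdeg_def munit_def)

lemma monom_at_munit:
  assumes "finite I" "j \<in> I" shows "monom_at I z (munit I j) = z j"
proof -
  have "monom_at I z (munit I j) = (\<Prod>i\<in>I. if i = j then z i else 1)"
    unfolding monom_at_def munit_def by (rule prod.cong) auto
  also have "\<dots> = z j" using assms by simp
  finally show ?thesis .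
qed

text \<open>Unconditional summability over the reals is absolute, so the products form a summable
  family over all pairs of multi-indices. The Cauchy product regroups the pairs by their pointwise
  sum, and the fibres \<open>splits I \<alpha>\<close> are finite.\<close>

lemma has_sum_mindex_mult:
  fixes f g :: "('i \<Rightarrow> nat) \<Rightarrow> real"
  assumes I: "finite I" and f: "(f has_sum A) (mindex I)" and g: "(g has_sum B) (mindex I)"
  shows "((\<lambda>\<alpha>. \<Sum>(\<beta>, \<gamma>)\<in>splits I \<alpha>. f \<beta> * g \<gamma>) has_sum A * B) (mindex I)"
proof -
  let ?M = "mindex I :: ('i \<Rightarrow> nat) set"
  let ?h = "\<lambda>p. f (fst p) * g (snd p)"
  have fa: "(\<lambda>\<alpha>. norm (f \<alpha>)) summable_on ?M" and ga: "(\<lambda>\<alpha>. norm (g \<alpha>)) summable_on ?M"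
    using has_sum_imp_summable[OF f] has_sum_imp_summable[OF g]
    by (blast dest: summable_on_iff_abs_summable_on_real[THEN iffD1])+
  have "(\<lambda>p. norm (?h p)) summable_on ?M \<times> ?M"
  proof (subst Infinite_Sum.abs_summable_on_Sigma_iff, intro conjI ballI)
    show "(\<lambda>\<gamma>. norm (?h (\<beta>, \<gamma>))) summable_on ?M" for \<beta>
      using summable_on_cmult_right[OF ga, of "norm (f \<beta>)"] by (simp add: abs_mult)
    show "(\<lambda>\<beta>. norm (infsum (\<lambda>\<gamma>. norm (?h (\<beta>, \<gamma>))) ?M)) summable_on ?M"
      using summable_on_cmult_left[OF fa, of "infsum (\<lambda>\<gamma>. norm (g \<gamma>)) ?M"]
      by (simp add: abs_mult infsum_cmult_right' infsum_nonneg)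
  qed
  then have "?h summable_on ?M \<times> ?M"
    by (rule abs_summable_summable)
  moreover have "((\<lambda>\<beta>. f \<beta> * B) has_sum A * B) ?M"
    by (rule has_sum_cmult_left[OF f])
  moreover have "((\<lambda>\<gamma>. f \<beta> * g \<gamma>) has_sum f \<beta> * B) ?M" for \<beta>
    by (rule has_sum_cmult_right[OF g])
  ultimately have "(?h has_sum A * B) (?M \<times> ?M)"
    by (intro has_sum_SigmaI[where g = "\<lambda>\<beta>. f \<beta> * B"]) auto
  moreover have "bij_betw (\<lambda>q. snd q) (Sigma ?M (splits I)) (?M \<times> ?M)"
    by (rule bij_betwI[where g = "\<lambda>p. (madd I (fst p) (snd p), p)"]) (auto simp: splits_def madd_def)
  ultimately have "((\<lambda>q. ?h (snd q)) has_sum A * B) (Sigma ?M (splits I))"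
    by (subst has_sum_reindex_bij_betw)
  then show ?thesis
    by (rule has_sum_SigmaD) (auto intro!: has_sum_finiteI finite_splits I simp: case_prod_beta)
qed

lemma real_analytic_atI:
  assumes "r > 0"
    and "\<And>y. y \<in> Rpow I \<Longrightarrow> (\<And>i. i \<in> I \<Longrightarrow> \<bar>y i - x i\<bar> < r) \<Longrightarrow>
      ((\<lambda>\<alpha>. c \<alpha> * monom_at I (\<lambda>i. y i - x i) \<alpha>) has_sum f y) (mindex I)"
  shows "real_analytic_at I f x"
  unfolding real_analytic_at_def
  using assms by (intro exI[of _ c] exI[of _ r]) (auto simp: monom_at_def)

definition power_series_on ::
  "'i set \<Rightarrow> (('i \<Rightarrow> nat) \<Rightarrow> real) \<Rightarrow> real \<Rightarrow> (('i \<Rightarrow> real) \<Rightarrow> real) \<Rightarrow> ('i \<Rightarrow> real) \<Rightarrow> bool" where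
  "power_series_on I c r f x \<longleftrightarrow> r > 0 \<and>
     (\<forall>y\<in>Rpow I. (\<forall>i\<in>I. \<bar>y i - x i\<bar> < r) \<longrightarrow>
       ((\<lambda>\<alpha>. c \<alpha> * monom_at I (\<lambda>i. y i - x i) \<alpha>) has_sum f y) (mindex I))"

lemma real_analytic_at_iff: "real_analytic_at I f x \<longleftrightarrow> (\<exists>c r. power_series_on I c r f x)"
  by (simp add: real_analytic_at_def power_series_on_def monom_at_def)

lemma power_series_onD:
  assumes "power_series_on I c r f x" "y \<in> Rpow I" "\<And>i. i \<in> I \<Longrightarrow> \<bar>y i - x i\<bar> < r"
  shows "((\<lambda>\<alpha>. c \<alpha> * monom_at I (\<lambda>i. y i - x i) \<alpha>) has_sum f y) (mindex I)"
  using assms by (simp add: power_series_on_def)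

lemma real_analytic_at_cong:
  assumes "real_analytic_at I f x" "\<And>y. y \<in> Rpow I \<Longrightarrow> f y = g y"
  shows "real_analytic_at I g x"
  using assms unfolding real_analytic_at_def by auto

lemma real_analytic_at_cong_local:
  assumes "real_analytic_at I f x" "e > 0"
    and "\<And>y. y \<in> Rpow I \<Longrightarrow> (\<And>i. i \<in> I \<Longrightarrow> \<bar>y i - x i\<bar> < e) \<Longrightarrow> f y = g y"
  shows "real_analytic_at I g x"
proof -
  from assms(1) obtain c r where p0: "power_series_on I c r f x"
    unfolding real_analytic_at_iff by blast
  then have "r > 0" by (simp add: power_series_on_def)
  note * = power_series_onD[OF p0]
  show ?thesis
  proof (rule real_analytic_atI[of "min r e"])
    fix y assume y: "y \<in> Rpow I" "\<And>i. i \<in> I \<Longrightarrow> \<bar>y i - x i\<bar> < min r e"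
    then have "f y = g y" by (intro assms(3)) auto
    moreover have "((\<lambda>\<alpha>. c \<alpha> * monom_at I (\<lambda>i. y i - x i) \<alpha>) has_sum f y) (mindex I)"
      by (rule *) (use y in auto)
    ultimately show "((\<lambda>\<alpha>. c \<alpha> * monom_at I (\<lambda>i. y i - x i) \<alpha>) has_sum g y) (mindex I)"
      by simp
  qed (use \<open>r > 0\<close> \<open>e > 0\<close> in auto)
qed

lemma real_analytic_at_const: "real_analytic_at I (\<lambda>y. a) x"
proof (rule real_analytic_atI[of 1])
  fix y :: "'a \<Rightarrow> real"
  show "((\<lambda>\<alpha>. (if \<alpha> = (\<lambda>i\<in>I. 0) then a else 0) * monom_at I (\<lambda>i. y i - x i) \<alpha>) has_sum a) (mindex I)"
    by (rule has_sum_finite_neutralI[of "{\<lambda>i\<in>I. 0}"]) (auto simp: monom_at_def)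
qed simp

lemma real_analytic_at_add:
  assumes "real_analytic_at I f x" "real_analytic_at I g x"
  shows "real_analytic_at I (\<lambda>y. f y + g y) x"
proof -
  from assms(1) obtain c r where f0: "power_series_on I c r f x"
    unfolding real_analytic_at_iff by blast
  then have "r > 0" by (simp add: power_series_on_def)
  note f = power_series_onD[OF f0]
  from assms(2) obtain d s where g0: "power_series_on I d s g x"
    unfolding real_analytic_at_iff by blast
  then have "s > 0" by (simp add: power_series_on_def)
  note g = power_series_onD[OF g0]
  show ?thesis
  proof (rule real_analytic_atI[of "min r s"])
    fix y assume y: "y \<in> Rpow I" "\<And>i. i \<in> I \<Longrightarrow> \<bar>y i - x i\<bar> < min r s"
    let ?m = "monom_at I (\<lambda>i. y i - x i)"
    have "((\<lambda>\<alpha>. c \<alpha> * ?m \<alpha>) has_sum f y) (mindex I)"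
      by (rule f) (use y in auto)
    moreover have "((\<lambda>\<alpha>. d \<alpha> * ?m \<alpha>) has_sum g y) (mindex I)"
      by (rule g) (use y in auto)
    ultimately have "((\<lambda>\<alpha>. c \<alpha> * ?m \<alpha> + d \<alpha> * ?m \<alpha>) has_sum f y + g y) (mindex I)"
      by (rule has_sum_add)
    then show "((\<lambda>\<alpha>. (c \<alpha> + d \<alpha>) * ?m \<alpha>) has_sum f y + g y) (mindex I)"
      by (simp only: distrib_right)
  qed (use \<open>r > 0\<close> \<open>s > 0\<close> in auto)
qed

lemma real_analytic_at_mult:
  assumes "finite I" "real_analytic_at I f x" "real_analytic_at I g x"
  shows "real_analytic_at I (\<lambda>y. f y * g y) x"
proof -
  from assms(2) obtain c r where f0: "power_series_on I c r f x"
    unfolding real_analytic_at_iff by blast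
  then have "r > 0" by (simp add: power_series_on_def)
  note f = power_series_onD[OF f0]
  from assms(3) obtain d s where g0: "power_series_on I d s g x"
    unfolding real_analytic_at_iff by blast
  then have "s > 0" by (simp add: power_series_on_def)
  note g = power_series_onD[OF g0]
  show ?thesis
  proof (rule real_analytic_atI[of "min r s"])
    fix y assume y: "y \<in> Rpow I" "\<And>i. i \<in> I \<Longrightarrow> \<bar>y i - x i\<bar> < min r s"
    let ?m = "monom_at I (\<lambda>i. y i - x i)"
    have "((\<lambda>\<alpha>. \<Sum>(\<beta>, \<gamma>)\<in>splits I \<alpha>. (c \<beta> * ?m \<beta>) * (d \<gamma> * ?m \<gamma>)) has_sum f y * g y) (mindex I)"
    proof (rule has_sum_mindex_mult[OF assms(1)])
      show "((\<lambda>\<alpha>. c \<alpha> * ?m \<alpha>) has_sum f y) (mindex I)"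
        by (rule f) (use y in auto)
      show "((\<lambda>\<alpha>. d \<alpha> * ?m \<alpha>) has_sum g y) (mindex I)"
        by (rule g) (use y in auto)
    qed
    moreover have "(\<Sum>(\<beta>, \<gamma>)\<in>splits I \<alpha>. (c \<beta> * ?m \<beta>) * (d \<gamma> * ?m \<gamma>))
        = (\<Sum>(\<beta>, \<gamma>)\<in>splits I \<alpha>. c \<beta> * d \<gamma>) * ?m \<alpha>" for \<alpha>
      unfolding sum_distrib_right
      by (rule sum.cong) (auto simp: splits_def monom_at_madd)
    ultimately show "((\<lambda>\<alpha>. (\<Sum>(\<beta>, \<gamma>)\<in>splits I \<alpha>. c \<beta> * d \<gamma>) * ?m \<alpha>) has_sum f y * g y) (mindex I)"
      by simp
  qed (use \<open>r > 0\<close> \<open>s > 0\<close> in auto)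
qed

lemma real_analytic_at_diff_coord:
  assumes "finite I" "j \<in> I"
  shows "real_analytic_at I (\<lambda>y. y j - x j) x"
proof (rule real_analytic_atI[of 1])
  fix y :: "'a \<Rightarrow> real"
  show "((\<lambda>\<alpha>. (if \<alpha> = munit I j then 1 else 0) * monom_at I (\<lambda>i. y i - x i) \<alpha>)
      has_sum y j - x j) (mindex I)"
    by (rule has_sum_finite_neutralI[of "{munit I j}"]) (auto simp: monom_at_munit assms)
qed simp

lemma real_analytic_at_coord:
  assumes "finite I" "j \<in> I"
  shows "real_analytic_at I (\<lambda>y. y j) x"
  using real_analytic_at_add[OF real_analytic_at_diff_coord[OF assms, of x] real_analytic_at_const[of I "x j" x]]
  by simp

lemma real_analytic_at_sum:
  assumes "\<And>a. a \<in> A \<Longrightarrow> real_analytic_at I (f a) x"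
  shows "real_analytic_at I (\<lambda>y. \<Sum>a\<in>A. f a y) x"
  using assms
  by (induction A rule: infinite_finite_induct) (auto intro: real_analytic_at_const real_analytic_at_add)

section \<open>Power series solution of a quadratic fixed point equation\<close>

text \<open>
  Coefficients of the \<open>n\<close>-th Picard iterate for the fixed point equation \<open>y = a w + b(y, y)\<close>,
  as power series in \<open>w\<close>; those of degree at most \<open>n\<close> are final.
\<close>

primrec picard :: "'i set \<Rightarrow> ('i \<Rightarrow> 'i \<Rightarrow> real) \<Rightarrow> ('i \<Rightarrow> 'i \<Rightarrow> 'i \<Rightarrow> real) \<Rightarrow> nat \<Rightarrow> 'i \<Rightarrow> ('i \<Rightarrow> nat) \<Rightarrow> real"
where
  "picard I a b 0 = (\<lambda>i \<alpha>. 0)"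
| "picard I a b (Suc n) = (\<lambda>i \<alpha>. (\<Sum>j\<in>I. if \<alpha> = munit I j then a i j else 0)
     + (\<Sum>j\<in>I. \<Sum>l\<in>I. b i j l *
          (\<Sum>(\<beta>, \<gamma>)\<in>splits I \<alpha>. picard I a b n j \<beta> * picard I a b n l \<gamma>)))"

text \<open>A constant term can arise neither from the linear part, which has degree 1, nor from a
  product of two series without constant term. This is what makes the recursion for the coefficients
  well-founded in the degree.\<close>

lemma picard_deg0:
  assumes "finite I" "mdeg I \<alpha> = 0"
  shows "picard I a b n i \<alpha> = 0"
  using assms(2)
proof (induction n arbitrary: i \<alpha>)
  case (Suc n)
  have "\<alpha> \<noteq> munit I j" if "j \<in> I" for j
    using mdeg_munit[OF assms(1) that] Suc.prems by auto
  moreover have "picard I a b n j \<beta> * picard I a b n l \<gamma> = 0" if "(\<beta>, \<gamma>) \<in> splits I \<alpha>" for j l \<beta> \<gamma>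
    using that Suc by (auto simp: splits_def mdeg_madd)
  then have "(\<Sum>(\<beta>, \<gamma>)\<in>splits I \<alpha>. picard I a b n j \<beta> * picard I a b n l \<gamma>) = 0" for j l
    by (intro sum.neutral ballI) (auto simp: case_prod_beta)
  ultimately show ?case by (simp cong: sum.cong)
qed simp

text \<open>In a product contributing to degree \<open>Suc n\<close>, either both factors have
  degree at most \<open>n\<close>, or one of them has degree 0 and its coefficient vanishes. Each
  iteration therefore settles one more degree.\<close>

lemma picard_Suc_eq:
  assumes "finite I" "mdeg I \<alpha> \<le> n"
  shows "picard I a b (Suc n) i \<alpha> = picard I a b n i \<alpha>"
  using assms(2)
proof (induction n arbitrary: i \<alpha>)
  case 0
  then have "picard I a b m i \<alpha> = 0" for m
    using picard_deg0[OF assms(1)] by simp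
  then show ?case by metis
next
  case (Suc n)
  have "picard I a b (Suc n) j \<beta> * picard I a b (Suc n) l \<gamma> = picard I a b n j \<beta> * picard I a b n l \<gamma>"
    if "(\<beta>, \<gamma>) \<in> splits I \<alpha>" for j l \<beta> \<gamma>
  proof -
    have d: "mdeg I \<beta> + mdeg I \<gamma> \<le> Suc n"
      using that Suc.prems by (auto simp: splits_def mdeg_madd)
    consider "mdeg I \<beta> = 0" | "mdeg I \<gamma> = 0" | "mdeg I \<beta> \<le> n" "mdeg I \<gamma> \<le> n"
      using d by linarith
    then show ?thesis
    proof cases
      case 1
      then have "picard I a b m q \<beta> = 0" for m q using picard_deg0[OF assms(1)] by blast
      then show ?thesis by (simp del: picard.simps)
    next
      case 2
      then have "picard I a b m q \<gamma> = 0" for m q using picard_deg0[OF assms(1)] by blast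
      then show ?thesis by (simp del: picard.simps)
    next
      case 3 then show ?thesis using Suc.IH by metis
    qed
  qed
  then have "(\<Sum>(\<beta>, \<gamma>)\<in>splits I \<alpha>. picard I a b (Suc n) j \<beta> * picard I a b (Suc n) l \<gamma>)
     = (\<Sum>(\<beta>, \<gamma>)\<in>splits I \<alpha>. picard I a b n j \<beta> * picard I a b n l \<gamma>)" for j l
    by (intro sum.cong refl) (auto simp del: picard.simps)
  then show ?case
    by (simp only: picard.simps(2)[of I a b "Suc n"] picard.simps(2)[of I a b n])
qed

lemma picard_stable:
  assumes "finite I" "mdeg I \<alpha> \<le> n"
  shows "picard I a b n i \<alpha> = picard I a b (mdeg I \<alpha>) i \<alpha>"
  using assms(2)
proof (induction n rule: dec_induct)
  case (step m)
  then show ?case using picard_Suc_eq[OF assms(1), of \<alpha> m a b i] by simp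
qed simp

text \<open>Method of majorants: the coefficient norm with weights
  \<open>r ^ mdeg I \<alpha>\<close> is submultiplicative, and \<open>bd\<close> says that the
  iteration maps its \<open>\<delta>\<close>-ball into itself. Finite sets \<open>F\<close> of
  multi-indices are used so that no summability has to be known beforehand.\<close>

lemma picard_bound:
  assumes I: "finite I" and i: "i \<in> I" and "finite F" "F \<subseteq> mindex I"
    and r: "r \<ge> 0" and \<delta>: "\<delta> \<ge> 0"
    and bd: "\<And>i. i \<in> I \<Longrightarrow> (\<Sum>j\<in>I. \<bar>a i j\<bar>) * r + (\<Sum>j\<in>I. \<Sum>l\<in>I. \<bar>b i j l\<bar>) * (\<delta> * \<delta>) \<le> \<delta>"
  shows "(\<Sum>\<alpha>\<in>F. \<bar>picard I a b n i \<alpha>\<bar> * r ^ mdeg I \<alpha>) \<le> \<delta>"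
  using assms(2-4)
proof (induction n arbitrary: i F)
  case (Suc n)
  let ?c = "\<lambda>j \<alpha>. \<bar>picard I a b n j \<alpha>\<bar> * r ^ mdeg I \<alpha>"
  let ?S = "\<lambda>j l \<alpha>. \<Sum>(\<beta>, \<gamma>)\<in>splits I \<alpha>. ?c j \<beta> * ?c l \<gamma>"
  have 1: "\<bar>picard I a b (Suc n) i \<alpha>\<bar> * r ^ mdeg I \<alpha>
      \<le> (\<Sum>j\<in>I. if \<alpha> = munit I j then \<bar>a i j\<bar> * r else 0)
        + (\<Sum>j\<in>I. \<Sum>l\<in>I. \<bar>b i j l\<bar> * ?S j l \<alpha>)" for \<alpha>
  proof -
    have "\<bar>picard I a b (Suc n) i \<alpha>\<bar> \<le> (\<Sum>j\<in>I. if \<alpha> = munit I j then \<bar>a i j\<bar> else 0)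
        + (\<Sum>j\<in>I. \<Sum>l\<in>I. \<bar>b i j l\<bar> * (\<Sum>(\<beta>, \<gamma>)\<in>splits I \<alpha>. \<bar>picard I a b n j \<beta>\<bar> * \<bar>picard I a b n l \<gamma>\<bar>))"
      unfolding picard.simps
      apply (rule order_trans[OF abs_triangle_ineq])
      apply (intro add_mono order_trans[OF sum_abs] sum_mono)
       apply simp
      apply (subst abs_mult)
      apply (intro mult_left_mono order_trans[OF sum_abs] sum_mono)
       apply (auto simp: abs_mult)
      done
    then have "\<bar>picard I a b (Suc n) i \<alpha>\<bar> * r ^ mdeg I \<alpha> \<le> ((\<Sum>j\<in>I. if \<alpha> = munit I j then \<bar>a i j\<bar> else 0)
        + (\<Sum>j\<in>I. \<Sum>l\<in>I. \<bar>b i j l\<bar> * (\<Sum>(\<beta>, \<gamma>)\<in>splits I \<alpha>. \<bar>picard I a b n j \<beta>\<bar> * \<bar>picard I a b n l \<gamma>\<bar>))) * r ^ mdeg I \<alpha>"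
      using r by (intro mult_right_mono) auto
    also have "\<dots> = (\<Sum>j\<in>I. if \<alpha> = munit I j then \<bar>a i j\<bar> * r else 0)
        + (\<Sum>j\<in>I. \<Sum>l\<in>I. \<bar>b i j l\<bar> * ?S j l \<alpha>)"
    proof -
      have "(\<Sum>j\<in>I. if \<alpha> = munit I j then \<bar>a i j\<bar> else 0) * r ^ mdeg I \<alpha>
          = (\<Sum>j\<in>I. if \<alpha> = munit I j then \<bar>a i j\<bar> * r else 0)"
        unfolding sum_distrib_right by (rule sum.cong) (auto simp: mdeg_munit I)
      moreover have "(\<Sum>(\<beta>, \<gamma>)\<in>splits I \<alpha>. \<bar>picard I a b n j \<beta>\<bar> * \<bar>picard I a b n l \<gamma>\<bar>) * r ^ mdeg I \<alpha>
          = ?S j l \<alpha>" for j l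
        unfolding sum_distrib_right
        by (rule sum.cong) (auto simp: splits_def mdeg_madd power_add)
      ultimately show ?thesis
        by (simp add: distrib_right sum_distrib_right mult.assoc)
    qed
    finally show ?thesis .
  qed
  have 2: "(\<Sum>\<alpha>\<in>F. \<Sum>j\<in>I. if \<alpha> = munit I j then \<bar>a i j\<bar> * r else 0) \<le> (\<Sum>j\<in>I. \<bar>a i j\<bar>) * r"
    unfolding sum_distrib_right
    by (subst sum.swap, rule sum_mono) (use r Suc.prems in simp)
  \<comment> \<open>The pairs that occur are distinct for distinct \<open>\<alpha>\<close> and lie
    in the rectangle \<open>?F1 \<times> ?F2\<close>; all terms are nonnegative, so the sum over the
    rectangle, a product of two sums, is an upper bound.\<close>
  have 3: "(\<Sum>\<alpha>\<in>F. ?S j l \<alpha>) \<le> \<delta> * \<delta>" if "j \<in> I" "l \<in> I" for j l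
  proof -
    let ?G = "Sigma F (splits I)"
    let ?F1 = "(fst \<circ> snd) ` ?G" and ?F2 = "(snd \<circ> snd) ` ?G"
    have fG: "finite ?G" using Suc.prems finite_splits[OF I] by auto
    have sub: "?F1 \<subseteq> mindex I" "?F2 \<subseteq> mindex I" by (auto simp: splits_def)
    have "(\<Sum>\<alpha>\<in>F. ?S j l \<alpha>) = (\<Sum>q\<in>?G. ?c j (fst (snd q)) * ?c l (snd (snd q)))"
      using Suc.prems finite_splits[OF I] by (subst sum.Sigma) (auto simp: case_prod_beta)
    also have "\<dots> = (\<Sum>p\<in>snd ` ?G. ?c j (fst p) * ?c l (snd p))"
      by (subst sum.reindex) (auto simp: inj_on_def splits_def)
    also have "\<dots> \<le> (\<Sum>p\<in>?F1 \<times> ?F2. ?c j (fst p) * ?c l (snd p))"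
      using fG r by (intro sum_mono2) (force simp del: mem_Sigma_iff)+
    also have "\<dots> = (\<Sum>\<beta>\<in>?F1. ?c j \<beta>) * (\<Sum>\<gamma>\<in>?F2. ?c l \<gamma>)"
      by (simp add: sum_product sum.cartesian_product case_prod_beta)
    also have "\<dots> \<le> \<delta> * \<delta>"
      using Suc.IH[OF that(1) _ sub(1)] Suc.IH[OF that(2) _ sub(2)] fG \<delta> r
      by (intro mult_mono sum_nonneg) auto
    finally show ?thesis .
  qed
  have "(\<Sum>\<alpha>\<in>F. \<Sum>j\<in>I. \<Sum>l\<in>I. \<bar>b i j l\<bar> * ?S j l \<alpha>) = (\<Sum>j\<in>I. \<Sum>l\<in>I. \<bar>b i j l\<bar> * (\<Sum>\<alpha>\<in>F. ?S j l \<alpha>))"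
    by (subst sum.swap, rule sum.cong[OF refl], subst sum.swap) (simp add: sum_distrib_left)
  also have "\<dots> \<le> (\<Sum>j\<in>I. \<Sum>l\<in>I. \<bar>b i j l\<bar>) * (\<delta> * \<delta>)"
    unfolding sum_distrib_right by (intro sum_mono mult_left_mono 3) auto
  finally have 4: "(\<Sum>\<alpha>\<in>F. \<Sum>j\<in>I. \<Sum>l\<in>I. \<bar>b i j l\<bar> * ?S j l \<alpha>) \<le> (\<Sum>j\<in>I. \<Sum>l\<in>I. \<bar>b i j l\<bar>) * (\<delta> * \<delta>)" .
  have "(\<Sum>\<alpha>\<in>F. \<bar>picard I a b (Suc n) i \<alpha>\<bar> * r ^ mdeg I \<alpha>)
     \<le> (\<Sum>\<alpha>\<in>F. (\<Sum>j\<in>I. if \<alpha> = munit I j then \<bar>a i j\<bar> * r else 0)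
        + (\<Sum>j\<in>I. \<Sum>l\<in>I. \<bar>b i j l\<bar> * ?S j l \<alpha>))"
    by (intro sum_mono 1)
  also have "\<dots> \<le> (\<Sum>j\<in>I. \<bar>a i j\<bar>) * r + (\<Sum>j\<in>I. \<Sum>l\<in>I. \<bar>b i j l\<bar>) * (\<delta> * \<delta>)"
    using 2 4 by (simp add: sum.distrib)
  also have "\<dots> \<le> \<delta>" using bd Suc.prems by blast
  finally show ?case .
qed (use \<delta> in simp)

lemma has_sum_sum_finite:
  fixes f :: "'a \<Rightarrow> 'b \<Rightarrow> real"
  assumes "\<And>a. a \<in> A \<Longrightarrow> (f a has_sum s a) X"
  shows "((\<lambda>x. \<Sum>a\<in>A. f a x) has_sum (\<Sum>a\<in>A. s a)) X"
  using assms by (induction A rule: infinite_finite_induct) (auto intro: has_sum_add)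

text \<open>The coefficient of degree \<open>m\<close> is taken from the \<open>m\<close>-th
  iterate, where it is already final, so the limit coefficients satisfy the recursion exactly. The
  majorant bound makes the series converge, and the Cauchy product turns the recursion into the
  equation for \<open>Y\<close>.\<close>

lemma quadratic_inverse_series:
  assumes I: "finite I" and \<delta>: "\<delta> > 0"
    and bd: "\<And>i. i \<in> I \<Longrightarrow> (\<Sum>j\<in>I. \<Sum>l\<in>I. \<bar>b i j l\<bar>) * \<delta> \<le> 1 / 2"
  obtains r c and Y :: "('i \<Rightarrow> real) \<Rightarrow> 'i \<Rightarrow> real" where "r > 0"
    "\<And>w. (\<And>i. i \<in> I \<Longrightarrow> \<bar>w i\<bar> < r) \<Longrightarrow> Y w \<in> Rpow I"
    "\<And>w i. (\<And>i. i \<in> I \<Longrightarrow> \<bar>w i\<bar> < r) \<Longrightarrow> i \<in> I \<Longrightarrow>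
        ((\<lambda>\<alpha>. c i \<alpha> * monom_at I w \<alpha>) has_sum Y w i) (mindex I)"
    "\<And>w i. (\<And>i. i \<in> I \<Longrightarrow> \<bar>w i\<bar> < r) \<Longrightarrow> i \<in> I \<Longrightarrow> \<bar>Y w i\<bar> \<le> \<delta>"
    "\<And>w i. (\<And>i. i \<in> I \<Longrightarrow> \<bar>w i\<bar> < r) \<Longrightarrow> i \<in> I \<Longrightarrow>
        Y w i = (\<Sum>j\<in>I. a i j * w j) + (\<Sum>j\<in>I. \<Sum>l\<in>I. b i j l * (Y w j * Y w l))"
proof -
  define A where "A = (\<Sum>i\<in>I. \<Sum>j\<in>I. \<bar>a i j\<bar>)"
  have A0: "A \<ge> 0" unfolding A_def by (intro sum_nonneg) auto
  \<comment> \<open>With this radius the linear part contributes at most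
    \<open>\<delta> / 2\<close>; hypothesis \<open>bd\<close> leaves the other half to the quadratic
    part.\<close>
  define r where "r = \<delta> / (2 * (A + 1))"
  have r0: "r > 0" using A0 \<delta> by (simp add: r_def)
  have rbd: "(\<Sum>j\<in>I. \<bar>a i j\<bar>) * r + (\<Sum>j\<in>I. \<Sum>l\<in>I. \<bar>b i j l\<bar>) * (\<delta> * \<delta>) \<le> \<delta>" if "i \<in> I" for i
  proof -
    have "(\<Sum>j\<in>I. \<bar>a i j\<bar>) \<le> A"
      unfolding A_def using that I
      by (intro member_le_sum[of i I "\<lambda>i. \<Sum>j\<in>I. \<bar>a i j\<bar>"]) (auto intro: sum_nonneg)
    then have "(\<Sum>j\<in>I. \<bar>a i j\<bar>) * r \<le> A * r" using r0 by (intro mult_right_mono) auto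
    also have "\<dots> \<le> \<delta> / 2" using A0 \<delta> by (simp add: r_def field_simps)
    finally have "(\<Sum>j\<in>I. \<bar>a i j\<bar>) * r \<le> \<delta> / 2" .
    moreover have "(\<Sum>j\<in>I. \<Sum>l\<in>I. \<bar>b i j l\<bar>) * \<delta> * \<delta> \<le> 1 / 2 * \<delta>"
      using bd[OF that] \<delta> by (intro mult_right_mono) auto
    ultimately show ?thesis by (simp add: mult.assoc)
  qed
  define c where "c i \<alpha> = picard I a b (mdeg I \<alpha>) i \<alpha>" for i \<alpha>
  have c_rec: "c i \<alpha> = (\<Sum>j\<in>I. if \<alpha> = munit I j then a i j else 0)
     + (\<Sum>j\<in>I. \<Sum>l\<in>I. b i j l * (\<Sum>(\<beta>, \<gamma>)\<in>splits I \<alpha>. c j \<beta> * c l \<gamma>))" for i \<alpha>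
  proof -
    have "c i \<alpha> = picard I a b (Suc (mdeg I \<alpha>)) i \<alpha>"
      unfolding c_def by (rule picard_Suc_eq[OF I order_refl, symmetric])
    moreover have "(\<Sum>(\<beta>, \<gamma>)\<in>splits I \<alpha>. picard I a b (mdeg I \<alpha>) j \<beta> * picard I a b (mdeg I \<alpha>) l \<gamma>)
        = (\<Sum>(\<beta>, \<gamma>)\<in>splits I \<alpha>. c j \<beta> * c l \<gamma>)" for j l
    proof (rule sum.cong[OF refl], clarify)
      fix \<beta> \<gamma> assume "(\<beta>, \<gamma>) \<in> splits I \<alpha>"
      then have "mdeg I \<beta> \<le> mdeg I \<alpha>" "mdeg I \<gamma> \<le> mdeg I \<alpha>" by (auto simp: splits_def mdeg_madd)
      then show "picard I a b (mdeg I \<alpha>) j \<beta> * picard I a b (mdeg I \<alpha>) l \<gamma> = c j \<beta> * c l \<gamma>"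
        unfolding c_def by (metis picard_stable[OF I])
    qed
    ultimately show ?thesis by simp
  qed
  have c_bd: "(\<Sum>\<alpha>\<in>F. \<bar>c i \<alpha>\<bar> * r ^ mdeg I \<alpha>) \<le> \<delta>" if "i \<in> I" "finite F" "F \<subseteq> mindex I" for i F
  proof -
    \<comment> \<open>A common iterate in which all coefficients with index in the finite set
      \<open>F\<close> are final; the bound for that iterate carries over.\<close>
    define n where "n = Max (insert 0 (mdeg I ` F))"
    have "mdeg I \<alpha> \<le> n" if "\<alpha> \<in> F" for \<alpha>
      using that \<open>finite F\<close> by (auto simp: n_def)
    then have "(\<Sum>\<alpha>\<in>F. \<bar>c i \<alpha>\<bar> * r ^ mdeg I \<alpha>) = (\<Sum>\<alpha>\<in>F. \<bar>picard I a b n i \<alpha>\<bar> * r ^ mdeg I \<alpha>)"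
      unfolding c_def using picard_stable[OF I, of _ n a b i] by (intro sum.cong) auto
    also have "\<dots> \<le> \<delta>"
      using that r0 \<delta> rbd by (intro picard_bound I) auto
    finally show ?thesis .
  qed
  define Y where "Y w = (\<lambda>i\<in>I. \<Sum>\<^sub>\<infinity>\<alpha>\<in>mindex I. c i \<alpha> * monom_at I w \<alpha>)" for w
  show ?thesis
  proof (rule that[OF r0, of Y c])
    fix w assume w: "\<And>i. i \<in> I \<Longrightarrow> \<bar>w i\<bar> < r"
    show "Y w \<in> Rpow I" by (simp add: Y_def)
    have m: "\<bar>monom_at I w \<alpha>\<bar> \<le> r ^ mdeg I \<alpha>" for \<alpha>
    proof -
      have "\<bar>monom_at I w \<alpha>\<bar> = (\<Prod>i\<in>I. \<bar>w i\<bar> ^ \<alpha> i)"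
        by (simp add: monom_at_def abs_prod power_abs)
      also have "\<dots> \<le> (\<Prod>i\<in>I. r ^ \<alpha> i)"
        by (intro prod_mono conjI power_mono less_imp_le[OF w]) auto
      finally show ?thesis by (simp add: mdeg_def power_sum)
    qed
    have fin: "(\<Sum>\<alpha>\<in>F. norm (c i \<alpha> * monom_at I w \<alpha>)) \<le> \<delta>" if "i \<in> I" "finite F" "F \<subseteq> mindex I" for i F
    proof -
      have "(\<Sum>\<alpha>\<in>F. norm (c i \<alpha> * monom_at I w \<alpha>)) \<le> (\<Sum>\<alpha>\<in>F. \<bar>c i \<alpha>\<bar> * r ^ mdeg I \<alpha>)"
        by (intro sum_mono) (auto simp: abs_mult intro!: mult_left_mono m)
      then show ?thesis using c_bd[OF that] by linarith
    qed
    have abs: "(\<lambda>\<alpha>. norm (c i \<alpha> * monom_at I w \<alpha>)) summable_on mindex I" if "i \<in> I" for i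
      by (rule nonneg_bdd_above_summable_on, simp, rule bdd_aboveI2[of _ _ \<delta>]) (use fin[OF that] in auto)
    have hs: "((\<lambda>\<alpha>. c i \<alpha> * monom_at I w \<alpha>) has_sum Y w i) (mindex I)" if "i \<in> I" for i
      using abs_summable_summable[OF abs[OF that]] that by (simp add: Y_def)
    then show "i \<in> I \<Longrightarrow> ((\<lambda>\<alpha>. c i \<alpha> * monom_at I w \<alpha>) has_sum Y w i) (mindex I)" for i .
    show "\<bar>Y w i\<bar> \<le> \<delta>" if "i \<in> I" for i
    proof -
      have "norm (\<Sum>\<^sub>\<infinity>\<alpha>\<in>mindex I. c i \<alpha> * monom_at I w \<alpha>) \<le> (\<Sum>\<^sub>\<infinity>\<alpha>\<in>mindex I. norm (c i \<alpha> * monom_at I w \<alpha>))"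
        by (rule norm_infsum_bound[OF abs[OF that]])
      also have "\<dots> \<le> \<delta>"
        by (rule infsum_le_finite_sums[OF abs[OF that] fin[OF that]])
      finally show ?thesis using that by (simp add: Y_def)
    qed
    show "Y w i = (\<Sum>j\<in>I. a i j * w j) + (\<Sum>j\<in>I. \<Sum>l\<in>I. b i j l * (Y w j * Y w l))" if "i \<in> I" for i
    proof (rule has_sum_unique[OF hs[OF that]])
      have lin: "((\<lambda>\<alpha>. (if \<alpha> = munit I j then a i j else 0) * monom_at I w \<alpha>) has_sum a i j * w j) (mindex I)"
        if "j \<in> I" for j
        by (rule has_sum_finite_neutralI[of "{munit I j}"]) (use that in \<open>auto simp: monom_at_munit I\<close>)
      have quad: "((\<lambda>\<alpha>. b i j l * ((\<Sum>(\<beta>, \<gamma>)\<in>splits I \<alpha>. c j \<beta> * c l \<gamma>) * monom_at I w \<alpha>))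
          has_sum b i j l * (Y w j * Y w l)) (mindex I)" if "j \<in> I" "l \<in> I" for j l
      proof (rule has_sum_cmult_right)
        have "(\<Sum>(\<beta>, \<gamma>)\<in>splits I \<alpha>. (c j \<beta> * monom_at I w \<beta>) * (c l \<gamma> * monom_at I w \<gamma>))
          = (\<Sum>(\<beta>, \<gamma>)\<in>splits I \<alpha>. c j \<beta> * c l \<gamma>) * monom_at I w \<alpha>" for \<alpha>
          unfolding sum_distrib_right
          by (rule sum.cong) (auto simp: splits_def monom_at_madd)
        with has_sum_mindex_mult[OF I hs[OF that(1)] hs[OF that(2)]]
        show "((\<lambda>\<alpha>. (\<Sum>(\<beta>, \<gamma>)\<in>splits I \<alpha>. c j \<beta> * c l \<gamma>) * monom_at I w \<alpha>) has_sum Y w j * Y w l) (mindex I)"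
          by simp
      qed
      have "((\<lambda>\<alpha>. (\<Sum>j\<in>I. (if \<alpha> = munit I j then a i j else 0) * monom_at I w \<alpha>)
          + (\<Sum>j\<in>I. \<Sum>l\<in>I. b i j l * ((\<Sum>(\<beta>, \<gamma>)\<in>splits I \<alpha>. c j \<beta> * c l \<gamma>) * monom_at I w \<alpha>)))
          has_sum (\<Sum>j\<in>I. a i j * w j) + (\<Sum>j\<in>I. \<Sum>l\<in>I. b i j l * (Y w j * Y w l))) (mindex I)"
        by (intro has_sum_add has_sum_sum_finite lin quad)
      moreover have "(\<Sum>j\<in>I. (if \<alpha> = munit I j then a i j else 0) * monom_at I w \<alpha>)
          + (\<Sum>j\<in>I. \<Sum>l\<in>I. b i j l * ((\<Sum>(\<beta>, \<gamma>)\<in>splits I \<alpha>. c j \<beta> * c l \<gamma>) * monom_at I w \<alpha>))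
          = c i \<alpha> * monom_at I w \<alpha>" for \<alpha>
        by (subst c_rec[of i]) (simp add: distrib_right sum_distrib_right mult.assoc)
      ultimately show "((\<lambda>\<alpha>. c i \<alpha> * monom_at I w \<alpha>) has_sum
          (\<Sum>j\<in>I. a i j * w j) + (\<Sum>j\<in>I. \<Sum>l\<in>I. b i j l * (Y w j * Y w l))) (mindex I)"
        by simp
    qed
  qed
qed

section \<open>Local inverses of quadratic maps\<close>

lemma ex_pos_lower_bound:
  fixes f :: "'i \<Rightarrow> real"
  assumes "finite I" "\<And>i. i \<in> I \<Longrightarrow> f i > 0"
  obtains e where "e > 0" "\<And>i. i \<in> I \<Longrightarrow> e \<le> f i"
proof
  \<comment> \<open>The inserted 1 provides a value when \<open>I\<close> is empty.\<close>
  show "Min (insert 1 (f ` I)) > 0" using assms by (subst Min_gr_iff) auto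
  show "Min (insert 1 (f ` I)) \<le> f i" if "i \<in> I" for i
    using assms that by (intro Min_le) auto
qed

text \<open>The maximum of the absolute values is at most half of itself. This contraction argument
  gives both the injectivity of the chart and that of its derivative.\<close>

lemma halving_imp_zero:
  fixes d :: "'i \<Rightarrow> real"
  assumes "finite I" "i \<in> I"
    and half: "\<And>M i. (\<And>j. j \<in> I \<Longrightarrow> \<bar>d j\<bar> \<le> M) \<Longrightarrow> i \<in> I \<Longrightarrow> \<bar>d i\<bar> \<le> M / 2"
  shows "d i = 0"
proof -
  define M where "M = Max ((\<lambda>j. \<bar>d j\<bar>) ` I)"
  have le: "\<bar>d j\<bar> \<le> M" if "j \<in> I" for j
    using assms that by (auto simp: M_def)
  have "M \<in> (\<lambda>j. \<bar>d j\<bar>) ` I"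
    unfolding M_def using assms by (intro Max_in) auto
  then obtain j where "j \<in> I" "M = \<bar>d j\<bar>" by auto
  with half[of M j] le have "M \<le> M / 2" by auto
  with le[OF assms(2)] show ?thesis by linarith
qed

text \<open>An enumeration of \<open>I\<close> transports the question to square matrices, where a
  trivial kernel excludes determinant zero and hence gives a two-sided inverse.\<close>

lemma inverse_matrix_on:
  fixes m :: "'i \<Rightarrow> 'i \<Rightarrow> real"
  assumes I: "finite I"
    and inj: "\<And>x i. (\<And>i. i \<in> I \<Longrightarrow> (\<Sum>j\<in>I. m i j * x j) = 0) \<Longrightarrow> i \<in> I \<Longrightarrow> x i = 0"
  obtains a where
    "\<And>i l. i \<in> I \<Longrightarrow> l \<in> I \<Longrightarrow> (\<Sum>j\<in>I. m i j * a j l) = (if i = l then 1 else 0)"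
    "\<And>i l. i \<in> I \<Longrightarrow> l \<in> I \<Longrightarrow> (\<Sum>j\<in>I. a i j * m j l) = (if i = l then 1 else 0)"
proof -
  define n where "n = card I"
  obtain e where e: "bij_betw e {0..<n} I"
    using ex_bij_betw_nat_finite[OF I] by (auto simp: n_def)
  define f where "f = inv_into {0..<n} e"
  have f: "f i < n" "e (f i) = i" if "i \<in> I" for i
    using that e bij_betw_inv_into_right[OF e] bij_betwE[OF bij_betw_inv_into[OF e]]
    by (auto simp: f_def)
  have fe: "f (e p) = p" "e p \<in> I" if "p < n" for p
    using that bij_betw_inv_into_left[OF e] bij_betwE[OF e] by (auto simp: f_def)
  have sumI: "(\<Sum>j\<in>I. h j) = (\<Sum>p = 0..<n. h (e p))" for h :: "'i \<Rightarrow> real"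
    by (rule sum.reindex_bij_betw[OF e, symmetric])
  define A where "A = mat n n (\<lambda>(p, q). m (e p) (e q))"
  have A: "A \<in> carrier_mat n n" by (simp add: A_def)
  have "Determinant.det A \<noteq> 0"
  proof
    assume "Determinant.det A = 0"
    then obtain v where v: "v \<in> carrier_vec n" "v \<noteq> 0\<^sub>v n" "A *\<^sub>v v = 0\<^sub>v n"
      using det_0_iff_vec_prod_zero_field[OF A] by auto
    have "(\<Sum>j\<in>I. m i j * vec_index v (f j)) = 0" if "i \<in> I" for i
    proof -
      have "(\<Sum>j\<in>I. m i j * vec_index v (f j)) = vec_index (A *\<^sub>v v) (f i)"
        unfolding sumI using v(1) f[OF that] by (simp add: A_def scalar_prod_def fe)
      with v(3) f[OF that] show ?thesis by simp
    qed
    then have z: "vec_index v (f j) = 0" if "j \<in> I" for j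
      using inj[of "\<lambda>j. vec_index v (f j)"] that by blast
    have "vec_index v p = 0" if "p < n" for p
      using z[of "e p"] fe that by simp
    with v(1,2) show False by (auto simp: vec_eq_iff)
  qed
  from det_non_zero_imp_unit[OF A this, of undefined]
  obtain B where B: "B \<in> carrier_mat n n" "A * B = 1\<^sub>m n" "B * A = 1\<^sub>m n"
    by (auto simp: Units_def ring_mat_def)
  show ?thesis
  proof
    fix i l assume il: "i \<in> I" "l \<in> I"
    have eq: "f i = f l \<longleftrightarrow> i = l" using f il by metis
    have "(A * B) $$ (f i, f l) = (\<Sum>j\<in>I. m i j * B $$ (f j, f l))"
      unfolding sumI using f il B(1) by (simp add: A_def scalar_prod_def fe)
    then show "(\<Sum>j\<in>I. m i j * B $$ (f j, f l)) = (if i = l then 1 else 0)"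
      using B(2) f il eq by simp
    have "(B * A) $$ (f i, f l) = (\<Sum>j\<in>I. B $$ (f i, f j) * m j l)"
      unfolding sumI using f il B(1) by (simp add: A_def scalar_prod_def fe)
    then show "(\<Sum>j\<in>I. B $$ (f i, f j) * m j l) = (if i = l then 1 else 0)"
      using B(3) f il eq by simp
  qed
qed

lemma openin_powertop_realI:
  assumes "finite I" "U \<subseteq> Rpow I"
    and "\<And>x. x \<in> U \<Longrightarrow> \<exists>r>0. \<forall>y\<in>Rpow I. (\<forall>i\<in>I. \<bar>y i - x i\<bar> < r) \<longrightarrow> y \<in> U"
  shows "openin (powertop_real I) U"
proof (subst openin_subopen, intro ballI)
  fix x assume "x \<in> U"
  with assms(3) obtain r where r: "r > 0" "\<And>y. y \<in> Rpow I \<Longrightarrow> \<forall>i\<in>I. \<bar>y i - x i\<bar> < r \<Longrightarrow> y \<in> U"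
    by meson
  let ?T = "PiE I (\<lambda>i. ball (x i) r)"
  have "openin (powertop_real I) ?T"
    using assms(1) by (subst openin_PiE) auto
  moreover have "x \<in> ?T" using \<open>x \<in> U\<close> assms(2) r(1) by (auto simp: PiE_iff)
  moreover have "?T \<subseteq> U"
    by (auto intro!: r(2) simp: PiE_iff dist_real_def abs_minus_commute)
  ultimately show "\<exists>T. openin (powertop_real I) T \<and> x \<in> T \<and> T \<subseteq> U" by blast
qed

definition qform :: "'i set \<Rightarrow> ('i \<Rightarrow> 'i \<Rightarrow> 'i \<Rightarrow> real) \<Rightarrow> ('i \<Rightarrow> real) \<Rightarrow> 'i \<Rightarrow> real" where
  "qform I b z i = (\<Sum>j\<in>I. \<Sum>l\<in>I. b i j l * (z j * z l))"

lemma qform_cong: "(\<And>i. i \<in> I \<Longrightarrow> x i = y i) \<Longrightarrow> qform I b x i = qform I b y i"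
  by (simp add: qform_def)

text \<open>Taylor expansion of the quadratic form; both orders of the indices appear in the
  derivative because \<open>b\<close> may be non-symmetric.\<close>

lemma qform_add:
  "qform I b (\<lambda>j. x j + h j) i
     = qform I b x i + (\<Sum>j\<in>I. \<Sum>l\<in>I. (b i j l + b i l j) * x l * h j) + qform I b h i"
proof -
  have "qform I b (\<lambda>j. x j + h j) i = (\<Sum>j\<in>I. \<Sum>l\<in>I. b i j l * (x j * x l))
     + ((\<Sum>j\<in>I. \<Sum>l\<in>I. b i j l * x l * h j) + (\<Sum>j\<in>I. \<Sum>l\<in>I. b i j l * x j * h l))
     + (\<Sum>j\<in>I. \<Sum>l\<in>I. b i j l * (h j * h l))"
    unfolding qform_def sum.distrib[symmetric] by (intro sum.cong refl) (simp add: algebra_simps)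
  also have "(\<Sum>j\<in>I. \<Sum>l\<in>I. b i j l * x j * h l) = (\<Sum>j\<in>I. \<Sum>l\<in>I. b i l j * x l * h j)"
    by (rule sum.swap)
  also have "(\<Sum>j\<in>I. \<Sum>l\<in>I. b i j l * x l * h j) + (\<Sum>j\<in>I. \<Sum>l\<in>I. b i l j * x l * h j)
      = (\<Sum>j\<in>I. \<Sum>l\<in>I. (b i j l + b i l j) * x l * h j)"
    unfolding sum.distrib[symmetric] by (intro sum.cong refl) (simp add: algebra_simps)
  finally show ?thesis by (simp add: qform_def)
qed

text \<open>
  To see that the inverse of \<open>z + b(z, z)\<close> is analytic at the image of \<open>z\<^sub>0\<close>, the origin is moved
  to \<open>z\<^sub>0\<close>: the map becomes \<open>h \<mapsto> m h + b(h, h)\<close> with \<open>m\<close> invertible, whose inverse solves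
  \<open>h = m\<inverse> w - m\<inverse> b(h, h)\<close>.
\<close>

lemma quadratic_local_inverse:
  fixes b :: "'i \<Rightarrow> 'i \<Rightarrow> 'i \<Rightarrow> real" and I :: "'i set" and \<epsilon> :: real
  defines "\<Phi> \<equiv> \<lambda>z. \<lambda>i\<in>I. z i + qform I b z i"
  assumes I: "finite I" and \<epsilon>: "\<epsilon> > 0"
  obtains \<delta> \<Psi> where "\<delta> > 0" "\<delta> \<le> \<epsilon>"
    "real_analytic_map I I (\<Phi> ` {z \<in> Rpow I. \<forall>i\<in>I. \<bar>z i\<bar> < \<delta>}) \<Psi>"
    "\<And>z. z \<in> Rpow I \<Longrightarrow> (\<And>i. i \<in> I \<Longrightarrow> \<bar>z i\<bar> < \<delta>) \<Longrightarrow> \<Psi> (\<Phi> z) = z"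
proof -
  define B where "B = (\<Sum>i\<in>I. \<Sum>j\<in>I. \<Sum>l\<in>I. \<bar>b i j l\<bar>)"
  have B0: "B \<ge> 0" unfolding B_def by (intro sum_nonneg) auto
  have Bi: "(\<Sum>j\<in>I. \<Sum>l\<in>I. \<bar>b i j l\<bar>) \<le> B" if "i \<in> I" for i
    unfolding B_def using that I
    by (intro member_le_sum[of i I "\<lambda>i. \<Sum>j\<in>I. \<Sum>l\<in>I. \<bar>b i j l\<bar>"]) (auto intro!: sum_nonneg)
  \<comment> \<open>The aim is \<open>B * \<delta> \<le> 1 / 4\<close>: a bilinear expression with
    one argument bounded by \<open>\<delta>\<close> and the other by \<open>M\<close> occurs twice,
    so its size is at most \<open>2 * B * \<delta> * M \<le> M / 2\<close>, as the contraction
    argument requires.\<close>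
  define \<delta> where "\<delta> = min \<epsilon> (1 / (4 * (B + 1)))"
  have \<delta>0: "\<delta> > 0" using \<epsilon> B0 by (simp add: \<delta>_def)
  have "B * \<delta> \<le> B * (1 / (4 * (B + 1)))" using B0 by (intro mult_left_mono) (auto simp: \<delta>_def)
  also have "\<dots> \<le> 1 / 4" using B0 by (simp add: field_simps)
  finally have B\<delta>: "B * \<delta> \<le> 1 / 4" .
  have small: "\<bar>\<Sum>j\<in>I. \<Sum>l\<in>I. t j l\<bar> \<le> M / 2"
    if "i \<in> I" "M \<ge> 0" "\<And>j l. j \<in> I \<Longrightarrow> l \<in> I \<Longrightarrow> \<bar>t j l\<bar> \<le> \<bar>b i j l\<bar> * (2 * \<delta> * M)" for t i M
  proof -
    have "\<bar>\<Sum>j\<in>I. \<Sum>l\<in>I. t j l\<bar> \<le> (\<Sum>j\<in>I. \<Sum>l\<in>I. \<bar>b i j l\<bar>) * (2 * \<delta> * M)"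
      unfolding sum_distrib_right
      by (intro order_trans[OF sum_abs] sum_mono that)
    also have "\<dots> \<le> B * (2 * \<delta> * M)"
      using Bi[OF that(1)] \<delta>0 that(2) by (intro mult_right_mono) auto
    also have "\<dots> = B * \<delta> * (2 * M)" by simp
    also have "\<dots> \<le> 1 / 4 * (2 * M)" using B\<delta> that(2) by (intro mult_right_mono) auto
    finally show ?thesis by simp
  qed
  define U where "U = {z \<in> Rpow I. \<forall>i\<in>I. \<bar>z i\<bar> < \<delta>}"
  have inj: "inj_on \<Phi> U"
  proof (rule inj_onI)
    fix x y assume xy: "x \<in> U" "y \<in> U" "\<Phi> x = \<Phi> y"
    have "x i - y i = 0" if "i \<in> I" for i
    proof (rule halving_imp_zero[OF I that])
      fix M i assume M: "\<And>j. j \<in> I \<Longrightarrow> \<bar>x j - y j\<bar> \<le> M" and i: "i \<in> I"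
      have M0: "M \<ge> 0" using M[OF i] by linarith
      have "x i - y i = qform I b y i - qform I b x i"
        using fun_cong[OF xy(3), of i] i by (simp add: \<Phi>_def)
      also have "\<dots> = (\<Sum>j\<in>I. \<Sum>l\<in>I. b i j l * (y j * y l - x j * x l))"
        by (simp add: qform_def sum_subtractf[symmetric] right_diff_distrib)
      also have "\<bar>\<dots>\<bar> \<le> M / 2"
      proof (rule small[OF i M0])
        fix j l assume jl: "j \<in> I" "l \<in> I"
        have "y j * y l - x j * x l = y j * (y l - x l) + (y j - x j) * x l" by (simp add: algebra_simps)
        also have "\<bar>\<dots>\<bar> \<le> \<bar>y j\<bar> * \<bar>y l - x l\<bar> + \<bar>y j - x j\<bar> * \<bar>x l\<bar>"
          by (metis abs_mult abs_triangle_ineq)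
        also have "\<dots> \<le> \<delta> * M + M * \<delta>"
          using xy(1,2) jl M[of j] M[of l] \<delta>0 M0
          by (intro add_mono mult_mono) (auto simp: U_def abs_minus_commute less_imp_le)
        also have "\<dots> = 2 * \<delta> * M" by simp
          finally show "\<bar>b i j l * (y j * y l - x j * x l)\<bar> \<le> \<bar>b i j l\<bar> * (2 * \<delta> * M)"
          by (auto simp: abs_mult intro!: mult_left_mono)
      qed
      finally show "\<bar>x i - y i\<bar> \<le> M / 2" .
    qed
    then show "x = y" using xy(1,2) by (intro PiE_ext[of x I "\<lambda>_. UNIV" y]) (auto simp: U_def)
  qed
  define \<Psi> where "\<Psi> = inv_into U \<Phi>"
  have \<Psi>\<Phi>: "\<Psi> (\<Phi> z) = z" if "z \<in> U" for z
    using inj that by (simp add: \<Psi>_def)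
  have local: "\<exists>r>0. (\<forall>y\<in>Rpow I. (\<forall>i\<in>I. \<bar>y i - \<Phi> z0 i\<bar> < r) \<longrightarrow> y \<in> \<Phi> ` U)
       \<and> (\<forall>i\<in>I. real_analytic_at I (\<lambda>y. \<Psi> y i) (\<Phi> z0))" if z0: "z0 \<in> U" for z0
  proof -
    \<comment> \<open>The derivative of \<open>\<Phi>\<close> at \<open>z0\<close>, a perturbation
      of the identity small enough to be injective.\<close>
    define m where "m i j = (if i = j then 1 else 0) + (\<Sum>l\<in>I. (b i j l + b i l j) * z0 l)" for i j
    have m_mult: "(\<Sum>j\<in>I. m i j * x j) = x i + (\<Sum>j\<in>I. \<Sum>l\<in>I. (b i j l + b i l j) * z0 l * x j)"
      if "i \<in> I" for i x
    proof -
      have "(\<Sum>j\<in>I. m i j * x j) = (\<Sum>j\<in>I. (if i = j then x j else 0)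
          + (\<Sum>l\<in>I. (b i j l + b i l j) * z0 l * x j))"
        by (rule sum.cong) (auto simp: m_def distrib_right sum_distrib_right)
      then show ?thesis using that I by (simp add: sum.distrib)
    qed
    obtain a where ma: "\<And>i l. i \<in> I \<Longrightarrow> l \<in> I \<Longrightarrow> (\<Sum>j\<in>I. m i j * a j l) = (if i = l then 1 else 0)"
    proof (rule inverse_matrix_on[OF I, of m])
      fix x i assume 0: "\<And>i. i \<in> I \<Longrightarrow> (\<Sum>j\<in>I. m i j * x j) = 0" and "i \<in> I"
      show "x i = 0"
      proof (rule halving_imp_zero[OF I \<open>i \<in> I\<close>])
        fix M i assume M: "\<And>j. j \<in> I \<Longrightarrow> \<bar>x j\<bar> \<le> M" and i: "i \<in> I"
        have M0: "M \<ge> 0" using M[OF i] by linarith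
        have "x i = - (\<Sum>j\<in>I. \<Sum>l\<in>I. (b i j l + b i l j) * z0 l * x j)"
          using 0[OF i] unfolding m_mult[OF i] by linarith
        also have "\<dots> = - ((\<Sum>j\<in>I. \<Sum>l\<in>I. b i j l * z0 l * x j) + (\<Sum>j\<in>I. \<Sum>l\<in>I. b i l j * z0 l * x j))"
          by (simp add: sum.distrib distrib_right)
        also have "(\<Sum>j\<in>I. \<Sum>l\<in>I. b i l j * z0 l * x j) = (\<Sum>j\<in>I. \<Sum>l\<in>I. b i j l * z0 j * x l)"
          by (rule sum.swap)
        also have "(\<Sum>j\<in>I. \<Sum>l\<in>I. b i j l * z0 l * x j) + (\<Sum>j\<in>I. \<Sum>l\<in>I. b i j l * z0 j * x l)
            = (\<Sum>j\<in>I. \<Sum>l\<in>I. b i j l * (z0 l * x j + z0 j * x l))"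
          unfolding sum.distrib[symmetric] by (intro sum.cong refl) (simp add: algebra_simps)
        finally have "\<bar>x i\<bar> = \<bar>\<Sum>j\<in>I. \<Sum>l\<in>I. b i j l * (z0 l * x j + z0 j * x l)\<bar>" by simp
        also have "\<dots> \<le> M / 2"
        proof (rule small[OF i M0])
          fix j l assume jl: "j \<in> I" "l \<in> I"
          have "\<bar>z0 l * x j + z0 j * x l\<bar> \<le> \<bar>z0 l\<bar> * \<bar>x j\<bar> + \<bar>z0 j\<bar> * \<bar>x l\<bar>"
            by (metis abs_mult abs_triangle_ineq)
          also have "\<dots> \<le> \<delta> * M + \<delta> * M"
            using z0 jl M[of j] M[of l] \<delta>0 M0
            by (intro add_mono mult_mono) (auto simp: U_def less_imp_le)
          also have "\<dots> = 2 * \<delta> * M" by simp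
          finally show "\<bar>b i j l * (z0 l * x j + z0 j * x l)\<bar> \<le> \<bar>b i j l\<bar> * (2 * \<delta> * M)"
            by (auto simp: abs_mult intro!: mult_left_mono)
        qed
        finally show "\<bar>x i\<bar> \<le> M / 2" .
      qed
    qed blast
    \<comment> \<open>Applying the inverse \<open>a\<close> to \<open>m h + b(h, h) = w\<close>
      gives the fixed point form \<open>h = a w + b'(h, h)\<close>.\<close>
    define b' where "b' i j l = - (\<Sum>p\<in>I. a i p * b p j l)" for i j l
    define B' where "B' = (\<Sum>i\<in>I. \<Sum>j\<in>I. \<Sum>l\<in>I. \<bar>b' i j l\<bar>)"
    have B'0: "B' \<ge> 0" unfolding B'_def by (intro sum_nonneg) auto
    have B'i: "(\<Sum>j\<in>I. \<Sum>l\<in>I. \<bar>b' i j l\<bar>) \<le> B'" if "i \<in> I" for i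
      unfolding B'_def using that I
      by (intro member_le_sum[of i I "\<lambda>i. \<Sum>j\<in>I. \<Sum>l\<in>I. \<bar>b' i j l\<bar>"]) (auto intro!: sum_nonneg)
    obtain e where e: "e > 0" "\<And>i. i \<in> I \<Longrightarrow> e \<le> \<delta> - \<bar>z0 i\<bar>"
      using ex_pos_lower_bound[OF I, of "\<lambda>i. \<delta> - \<bar>z0 i\<bar>"] z0 by (auto simp: U_def)
    \<comment> \<open>The bound \<open>e / 2\<close> keeps \<open>z0 + h\<close> inside the cube
      \<open>U\<close>; the other bound is the smallness that the power series solution
      demands.\<close>
    define \<delta>' where "\<delta>' = min (e / 2) (1 / (2 * (B' + 1)))"
    have \<delta>'0: "\<delta>' > 0" using e B'0 by (simp add: \<delta>'_def)
    have bd': "(\<Sum>j\<in>I. \<Sum>l\<in>I. \<bar>b' i j l\<bar>) * \<delta>' \<le> 1 / 2" if "i \<in> I" for i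
    proof -
      have "(\<Sum>j\<in>I. \<Sum>l\<in>I. \<bar>b' i j l\<bar>) * \<delta>' \<le> B' * (1 / (2 * (B' + 1)))"
        using B'i[OF that] B'0 \<delta>'0 by (intro mult_mono) (auto simp: \<delta>'_def)
      also have "\<dots> \<le> 1 / 2" using B'0 by (simp add: field_simps)
      finally show ?thesis .
    qed
    obtain r c and Y :: "('i \<Rightarrow> real) \<Rightarrow> 'i \<Rightarrow> real" where r: "r > 0"
      and Yhs: "\<And>w i. (\<And>i. i \<in> I \<Longrightarrow> \<bar>w i\<bar> < r) \<Longrightarrow> i \<in> I \<Longrightarrow>
        ((\<lambda>\<alpha>. c i \<alpha> * monom_at I w \<alpha>) has_sum Y w i) (mindex I)"
      and Ybd: "\<And>w i. (\<And>i. i \<in> I \<Longrightarrow> \<bar>w i\<bar> < r) \<Longrightarrow> i \<in> I \<Longrightarrow> \<bar>Y w i\<bar> \<le> \<delta>'"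
      and Yeq: "\<And>w i. (\<And>i. i \<in> I \<Longrightarrow> \<bar>w i\<bar> < r) \<Longrightarrow> i \<in> I \<Longrightarrow>
        Y w i = (\<Sum>j\<in>I. a i j * w j) + (\<Sum>j\<in>I. \<Sum>l\<in>I. b' i j l * (Y w j * Y w l))"
      by (rule quadratic_inverse_series[OF I \<delta>'0 bd', where a = a]) blast+
    define Z where "Z y = (\<lambda>i\<in>I. z0 i + Y (\<lambda>i. y i - \<Phi> z0 i) i)" for y
    have Z: "Z y \<in> U" "\<Phi> (Z y) = y" if y: "y \<in> Rpow I" "\<And>i. i \<in> I \<Longrightarrow> \<bar>y i - \<Phi> z0 i\<bar> < r" for y
    proof -
      define w where "w = (\<lambda>i. y i - \<Phi> z0 i)"
      have w: "\<bar>w i\<bar> < r" if "i \<in> I" for i using y(2)[OF that] by (simp add: w_def)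
      define h where "h = Y w"
      have Zh: "Z y = (\<lambda>i\<in>I. z0 i + h i)" by (simp add: Z_def h_def w_def)
      have "\<bar>z0 i + h i\<bar> < \<delta>" if "i \<in> I" for i
      proof -
        have "\<bar>h i\<bar> \<le> \<delta>'" unfolding h_def by (rule Ybd[OF w that])
        moreover have "\<delta>' \<le> e / 2" by (simp add: \<delta>'_def)
        ultimately show ?thesis using e(2)[OF that] e(1) by linarith
      qed
      then show "Z y \<in> U" by (simp add: Zh U_def)
      have mh: "(\<Sum>j\<in>I. m i j * h j) + qform I b h i = w i" if i: "i \<in> I" for i
      proof -
        have h: "h j = (\<Sum>p\<in>I. a j p * (w p - qform I b h p))" if "j \<in> I" for j
        proof -
          have "(\<Sum>q\<in>I. \<Sum>l\<in>I. b' j q l * (h q * h l)) = - (\<Sum>q\<in>I. \<Sum>l\<in>I. \<Sum>p\<in>I. a j p * b p q l * (h q * h l))"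
            by (simp add: b'_def sum_negf sum_distrib_right)
          also have "(\<Sum>q\<in>I. \<Sum>l\<in>I. \<Sum>p\<in>I. a j p * b p q l * (h q * h l))
             = (\<Sum>q\<in>I. \<Sum>p\<in>I. \<Sum>l\<in>I. a j p * b p q l * (h q * h l))"
            by (rule sum.cong[OF refl], rule sum.swap)
          also have "\<dots> = (\<Sum>p\<in>I. \<Sum>q\<in>I. \<Sum>l\<in>I. a j p * b p q l * (h q * h l))"
            by (rule sum.swap)
          also have "\<dots> = (\<Sum>p\<in>I. a j p * qform I b h p)"
            by (simp add: qform_def sum_distrib_left mult.assoc)
          finally have "(\<Sum>q\<in>I. \<Sum>l\<in>I. b' j q l * (h q * h l)) = - (\<Sum>p\<in>I. a j p * qform I b h p)" .
          moreover have "h j = (\<Sum>q\<in>I. a j q * w q) + (\<Sum>q\<in>I. \<Sum>l\<in>I. b' j q l * (h q * h l))"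
            unfolding h_def by (rule Yeq) (use w that in auto)
          ultimately show ?thesis by (simp add: right_diff_distrib sum_subtractf)
        qed
        have "(\<Sum>j\<in>I. m i j * h j) = (\<Sum>j\<in>I. \<Sum>p\<in>I. m i j * a j p * (w p - qform I b h p))"
          by (intro sum.cong refl) (subst h, auto simp: sum_distrib_left mult.assoc)
        also have "\<dots> = (\<Sum>p\<in>I. (\<Sum>j\<in>I. m i j * a j p) * (w p - qform I b h p))"
          by (subst sum.swap) (simp add: sum_distrib_right)
        also have "\<dots> = (\<Sum>p\<in>I. if i = p then w p - qform I b h p else 0)"
          by (rule sum.cong) (auto simp: ma i)
        also have "\<dots> = w i - qform I b h i" using i I by simp
        finally show ?thesis by simp
      qed
      have "\<Phi> (Z y) i = y i" if i: "i \<in> I" for i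
      proof -
        have "\<Phi> (Z y) i = z0 i + h i + qform I b (\<lambda>i. z0 i + h i) i"
          using i by (simp add: \<Phi>_def Zh cong: qform_cong)
        also have "\<dots> = \<Phi> z0 i + ((\<Sum>j\<in>I. m i j * h j) + qform I b h i)"
          using i by (simp add: \<Phi>_def qform_add m_mult)
        also have "\<dots> = y i" using mh[OF i] by (simp add: w_def)
        finally show ?thesis .
      qed
      then show "\<Phi> (Z y) = y"
        using y(1) by (intro PiE_ext[of "\<Phi> (Z y)" I "\<lambda>_. UNIV" y]) (auto simp: \<Phi>_def)
    qed
    show ?thesis
    proof (intro exI[of _ r] conjI ballI impI)
      show "y \<in> \<Phi> ` U" if "y \<in> Rpow I" "\<forall>i\<in>I. \<bar>y i - \<Phi> z0 i\<bar> < r" for y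
      proof (rule image_eqI[of _ _ "Z y"])
        show "y = \<Phi> (Z y)" by (rule Z(2)[symmetric]) (use that in auto)
        show "Z y \<in> U" by (rule Z(1)) (use that in auto)
      qed
      fix i assume i: "i \<in> I"
      have "real_analytic_at I (\<lambda>y. Y (\<lambda>i. y i - \<Phi> z0 i) i) (\<Phi> z0)"
        by (rule real_analytic_atI[OF r, of _ _ "c i"], rule Yhs) (use i in auto)
      then have "real_analytic_at I (\<lambda>y. z0 i + Y (\<lambda>i. y i - \<Phi> z0 i) i) (\<Phi> z0)"
        by (intro real_analytic_at_add real_analytic_at_const)
      then show "real_analytic_at I (\<lambda>y. \<Psi> y i) (\<Phi> z0)"
      proof (rule real_analytic_at_cong_local[OF _ r])
        fix y assume "y \<in> Rpow I" "\<And>i. i \<in> I \<Longrightarrow> \<bar>y i - \<Phi> z0 i\<bar> < r"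
        then have "Z y \<in> U" "\<Phi> (Z y) = y" by (auto intro: Z)
        \<comment> \<open>Injectivity of \<open>\<Phi>\<close> on all of \<open>U\<close> identifies
          the locally constructed solution with the one inverse \<open>\<Psi>\<close>, so the local
          expansions belong to a single function.\<close>
        with \<Psi>\<Phi>[of "Z y"] have "\<Psi> y = Z y" by simp
        then show "z0 i + Y (\<lambda>i. y i - \<Phi> z0 i) i = \<Psi> y i" using i by (simp add: Z_def)
      qed
    qed (rule r)
  qed
  show ?thesis
  proof (rule that[OF \<delta>0, of \<Psi>])
    show "\<delta> \<le> \<epsilon>" by (simp add: \<delta>_def)
    show "real_analytic_map I I (\<Phi> ` {z \<in> Rpow I. \<forall>i\<in>I. \<bar>z i\<bar> < \<delta>}) \<Psi>"
      unfolding real_analytic_map_def U_def[symmetric]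
    proof (intro conjI ballI)
      show "openin (powertop_real I) (\<Phi> ` U)"
      proof (rule openin_powertop_realI[OF I])
        show "\<Phi> ` U \<subseteq> Rpow I" by (auto simp: \<Phi>_def)
        show "\<exists>r>0. \<forall>y\<in>Rpow I. (\<forall>i\<in>I. \<bar>y i - x i\<bar> < r) \<longrightarrow> y \<in> \<Phi> ` U" if "x \<in> \<Phi> ` U" for x
          using that local by blast
      qed
      show "\<Psi> \<in> \<Phi> ` U \<rightarrow> Rpow I"
        using \<Psi>\<Phi> by (auto simp: U_def)
      show "real_analytic_at I (\<lambda>y. \<Psi> y j) x" if "x \<in> \<Phi> ` U" "j \<in> I" for x j
        using that local by auto
    qed
    show "\<Psi> (\<Phi> z) = z" if "z \<in> Rpow I" "\<And>i. i \<in> I \<Longrightarrow> \<bar>z i\<bar> < \<delta>" for z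
      using that by (intro \<Psi>\<Phi>) (auto simp: U_def)
  qed
qed

section \<open>Submanifolds cut out by quadratic charts\<close>

text \<open>Take \<open>J\<close> of maximal size such that the image of \<open>P\<close> contains
  vectors dual to the coordinates in \<open>J\<close>. An image vector that is not a combination of
  them would yield a further pivot. The resulting basis is in reduced echelon form, and expanding
  the columns of \<open>P\<close> in it turns the trace of \<open>P\<close> into
  \<open>card J\<close>.\<close>

lemma echelon_basis:
  fixes P :: "'i \<Rightarrow> 'i \<Rightarrow> real"
  assumes I: "finite I"
    and idem: "\<And>i j. i \<in> I \<Longrightarrow> j \<in> I \<Longrightarrow> (\<Sum>l\<in>I. P i l * P l j) = P i j"
  obtains J u where "J \<subseteq> I"
    "\<And>i j. i \<in> I \<Longrightarrow> j \<in> J \<Longrightarrow> (\<Sum>l\<in>I. P i l * u j l) = u j i"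
    "\<And>i j. i \<in> J \<Longrightarrow> j \<in> J \<Longrightarrow> u j i = (if i = j then 1 else 0 :: real)"
    "\<And>x i. (\<And>i. i \<in> I \<Longrightarrow> (\<Sum>l\<in>I. P i l * x l) = x i) \<Longrightarrow> i \<in> I \<Longrightarrow> x i = (\<Sum>j\<in>J. x j * u j i)"
    "real (card J) = (\<Sum>i\<in>I. P i i)"
proof -
  define dual where "dual J u \<longleftrightarrow> J \<subseteq> I \<and> (\<forall>i\<in>I. \<forall>j\<in>J. (\<Sum>l\<in>I. P i l * u j l) = u j i)
     \<and> (\<forall>i\<in>J. \<forall>j\<in>J. u j i = (if i = j then 1 else 0 :: real))" for J and u :: "'i \<Rightarrow> 'i \<Rightarrow> real"
  have bdd: "\<forall>J. (\<exists>u. dual J u) \<longrightarrow> card J < Suc (card I)"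
    using I by (auto simp: dual_def less_Suc_eq_le intro: card_mono)
  have "\<exists>u. dual {} u" by (simp add: dual_def)
  from ex_has_greatest_nat[where P = "\<lambda>J. \<exists>u. dual J u" and f = card, OF this bdd]
  obtain J where J: "\<exists>u. dual J u" "\<And>J'. \<exists>u. dual J' u \<Longrightarrow> card J' \<le> card J"
    by auto
  from J(1) obtain u where u: "dual J u" by blast
  have JI: "J \<subseteq> I" and fixu: "\<And>i j. i \<in> I \<Longrightarrow> j \<in> J \<Longrightarrow> (\<Sum>l\<in>I. P i l * u j l) = u j i"
    and del: "\<And>i j. i \<in> J \<Longrightarrow> j \<in> J \<Longrightarrow> u j i = (if i = j then 1 else 0 :: real)"
    using u by (auto simp: dual_def)
  have fJ: "finite J" using JI I finite_subset by blast
  have expand: "x i = (\<Sum>j\<in>J. x j * u j i)"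
    if fx: "\<And>i. i \<in> I \<Longrightarrow> (\<Sum>l\<in>I. P i l * x l) = x i" and i: "i \<in> I" for x i
  proof (rule ccontr)
    define v where "v m = x m - (\<Sum>j\<in>J. x j * u j m)" for m
    assume "x i \<noteq> (\<Sum>j\<in>J. x j * u j i)"
    then have vi: "v i \<noteq> 0" by (simp add: v_def)
    have vJ: "v m = 0" if "m \<in> J" for m
    proof -
      have "(\<Sum>j\<in>J. x j * u j m) = (\<Sum>j\<in>J. if m = j then x j else 0)"
        by (rule sum.cong) (auto simp: del that)
      then show ?thesis using that fJ by (simp add: v_def)
    qed
    have fv: "(\<Sum>l\<in>I. P m l * v l) = v m" if "m \<in> I" for m
    proof -
      have "(\<Sum>l\<in>I. P m l * v l) = (\<Sum>l\<in>I. P m l * x l) - (\<Sum>l\<in>I. \<Sum>j\<in>J. x j * (P m l * u j l))"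
        by (simp add: v_def right_diff_distrib sum_subtractf sum_distrib_left mult.left_commute)
      also have "(\<Sum>l\<in>I. \<Sum>j\<in>J. x j * (P m l * u j l)) = (\<Sum>j\<in>J. x j * (\<Sum>l\<in>I. P m l * u j l))"
        by (subst sum.swap) (simp add: sum_distrib_left)
      finally show ?thesis using fx[OF that] fixu[OF that] by (simp add: v_def)
    qed
    have iJ: "i \<notin> J" using vJ vi by blast
    \<comment> \<open>One step of Gaussian elimination: the new vector is normalised at the pivot
      \<open>i\<close>, and coordinate \<open>i\<close> is cleared from the old ones. Duality on
      \<open>J\<close> persists since \<open>v\<close> vanishes there.\<close>
    define u' where "u' j m = (if j = i then v m / v i else u j m - u j i * (v m / v i))" for j m
    have "dual (insert i J) u'"
      unfolding dual_def
    proof (intro conjI ballI)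
      show "insert i J \<subseteq> I" using JI i by blast
    next
      fix m j assume m: "m \<in> I" and j: "j \<in> insert i J"
      have 1: "(\<Sum>l\<in>I. P m l * (v l / v i)) = v m / v i"
        using fv[OF m] by (simp add: sum_divide_distrib[symmetric])
      show "(\<Sum>l\<in>I. P m l * u' j l) = u' j m"
      proof (cases "j = i")
        case True
        then show ?thesis using 1 by (simp add: u'_def)
      next
        case False
        then have "(\<Sum>l\<in>I. P m l * u' j l)
            = (\<Sum>l\<in>I. P m l * u j l) - u j i * (\<Sum>l\<in>I. P m l * (v l / v i))"
          by (simp add: u'_def right_diff_distrib sum_subtractf sum_distrib_left mult.left_commute)
        also have "\<dots> = u j m - u j i * (v m / v i)"
          using False j by (subst 1) (simp add: fixu[OF m])
        finally show ?thesis using False by (simp add: u'_def)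
      qed
    next
      fix m j assume "m \<in> insert i J" "j \<in> insert i J"
      then show "u' j m = (if m = j then 1 else 0)"
        using vi vJ iJ by (auto simp: u'_def del)
    qed
    then have "card (insert i J) \<le> card J" using J(2) by blast
    with iJ fJ show False by simp
  qed
  \<comment> \<open>By idempotency every column of \<open>P\<close> is fixed by \<open>P\<close>, so
    the expansion applies to it.\<close>
  have "(\<Sum>i\<in>I. P i i) = (\<Sum>i\<in>I. \<Sum>j\<in>J. P j i * u j i)"
  proof (rule sum.cong[OF refl])
    fix i assume i: "i \<in> I"
    show "P i i = (\<Sum>j\<in>J. P j i * u j i)"
      by (rule expand[of "\<lambda>l. P l i"]) (use idem i in auto)
  qed
  also have "\<dots> = (\<Sum>j\<in>J. \<Sum>i\<in>I. P j i * u j i)" by (rule sum.swap)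
  also have "\<dots> = (\<Sum>j\<in>J. 1)"
    using JI by (intro sum.cong refl) (auto simp: fixu del)
  finally have tr: "real (card J) = (\<Sum>i\<in>I. P i i)" by simp
  show ?thesis by (rule that[OF JI], fact fixu, fact del, fact expand, fact tr)
qed

lemma sum_mult_assoc_on:
  fixes a b :: "'i \<Rightarrow> 'i \<Rightarrow> real"
  shows "(\<Sum>j\<in>I. a i j * (\<Sum>l\<in>I. b j l * x l)) = (\<Sum>l\<in>I. (\<Sum>j\<in>I. a i j * b j l) * x l)"
  by (simp add: sum_distrib_left sum_distrib_right mult.assoc) (rule sum.swap)

lemma sum_kronecker:
  fixes x :: "'i \<Rightarrow> real"
  assumes "finite I" "i \<in> I" "\<And>l. l \<in> I \<Longrightarrow> m l = (if i = l then 1 else 0)"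
  shows "(\<Sum>l\<in>I. m l * x l) = x i"
proof -
  have "(\<Sum>l\<in>I. m l * x l) = (\<Sum>l\<in>I. if i = l then x l else 0)"
    by (rule sum.cong) (auto simp: assms(3))
  then show ?thesis using assms by simp
qed

text \<open>With \<open>sum_qform\<close>, this shows that conjugating \<open>z + b(z, z)\<close> by
  an invertible linear map gives a map of the same form, so a linear change of coordinates may
  precede the local inversion.\<close>

lemma qform_linear_subst:
  "qform I b (\<lambda>q. \<Sum>s\<in>I. t q s * y s) p = qform I (\<lambda>p j l. \<Sum>q\<in>I. \<Sum>r\<in>I. b p q r * (t q j * t r l)) y p"
proof -
  have "qform I b (\<lambda>q. \<Sum>s\<in>I. t q s * y s) p
      = (\<Sum>q\<in>I. \<Sum>r\<in>I. \<Sum>j\<in>I. \<Sum>l\<in>I. b p q r * (t q j * t r l) * (y j * y l))"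
    unfolding qform_def sum_product
    unfolding sum_distrib_left by (intro sum.cong refl) (simp add: mult_ac)
  also have "\<dots> = (\<Sum>q\<in>I. \<Sum>j\<in>I. \<Sum>r\<in>I. \<Sum>l\<in>I. b p q r * (t q j * t r l) * (y j * y l))"
    by (rule sum.cong[OF refl], rule sum.swap)
  also have "\<dots> = (\<Sum>j\<in>I. \<Sum>q\<in>I. \<Sum>r\<in>I. \<Sum>l\<in>I. b p q r * (t q j * t r l) * (y j * y l))"
    by (rule sum.swap)
  also have "\<dots> = (\<Sum>j\<in>I. \<Sum>q\<in>I. \<Sum>l\<in>I. \<Sum>r\<in>I. b p q r * (t q j * t r l) * (y j * y l))"
    by (rule sum.cong[OF refl], rule sum.cong[OF refl], rule sum.swap)
  also have "\<dots> = (\<Sum>j\<in>I. \<Sum>l\<in>I. \<Sum>q\<in>I. \<Sum>r\<in>I. b p q r * (t q j * t r l) * (y j * y l))"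
    by (rule sum.cong[OF refl], rule sum.swap)
  finally show ?thesis by (simp add: qform_def sum_distrib_right)
qed

lemma sum_qform:
  "(\<Sum>p\<in>I. t i p * qform I b y p) = qform I (\<lambda>i j l. \<Sum>p\<in>I. t i p * b p j l) y i"
proof -
  have "(\<Sum>p\<in>I. t i p * qform I b y p) = (\<Sum>p\<in>I. \<Sum>j\<in>I. \<Sum>l\<in>I. t i p * b p j l * (y j * y l))"
    by (simp add: qform_def sum_distrib_left mult.assoc)
  also have "\<dots> = (\<Sum>j\<in>I. \<Sum>p\<in>I. \<Sum>l\<in>I. t i p * b p j l * (y j * y l))"
    by (rule sum.swap)
  also have "\<dots> = (\<Sum>j\<in>I. \<Sum>l\<in>I. \<Sum>p\<in>I. t i p * b p j l * (y j * y l))"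
    by (rule sum.cong[OF refl], rule sum.swap)
  finally show ?thesis by (simp add: qform_def sum_distrib_right)
qed

lemma real_analytic_at_qform:
  assumes "finite I" "\<And>i. i \<in> I \<Longrightarrow> real_analytic_at I (\<lambda>y. g y i) x"
  shows "real_analytic_at I (\<lambda>y. qform I b (g y) i) x"
  unfolding qform_def
  by (intro real_analytic_at_sum real_analytic_at_mult real_analytic_at_const assms)

lemma abs_sum_mult_le:
  fixes t x :: "'i \<Rightarrow> real"
  assumes "\<And>j. j \<in> I \<Longrightarrow> \<bar>x j\<bar> \<le> e"
  shows "\<bar>\<Sum>j\<in>I. t j * x j\<bar> \<le> (\<Sum>j\<in>I. \<bar>t j\<bar>) * e"
proof -
  have "\<bar>\<Sum>j\<in>I. t j * x j\<bar> \<le> (\<Sum>j\<in>I. \<bar>t j * x j\<bar>)" by (rule sum_abs)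
  also have "\<dots> \<le> (\<Sum>j\<in>I. \<bar>t j\<bar> * e)"
    by (rule sum_mono) (simp add: abs_mult assms mult_left_mono)
  finally show ?thesis by (simp add: sum_distrib_right)
qed

text \<open>The assumption only flattens \<open>S\<close> to the image of an idempotent, whereas the
  definition of a submanifold asks for a coordinate subspace. A linear shear built from the echelon
  basis moves one to the other, and the trace fixes the number of free coordinates.\<close>

theorem real_analytic_submanifoldI:
  fixes I :: "'i set" and S :: "('i \<Rightarrow> real) set"
  assumes I: "finite I" and S: "S \<subseteq> Rpow I"
    and chart: "\<And>p. p \<in> S \<Longrightarrow> \<exists>P b \<epsilon>. \<epsilon> > 0 \<and>
      (\<forall>i\<in>I. \<forall>j\<in>I. (\<Sum>l\<in>I. P i l * P l j) = P i j) \<and> (\<Sum>i\<in>I. P i i) = real d \<and>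
      (\<forall>z\<in>Rpow I. (\<forall>i\<in>I. \<bar>z i\<bar> < \<epsilon>) \<longrightarrow>
         ((\<lambda>i\<in>I. p i + z i) \<in> S \<longleftrightarrow>
          (\<forall>i\<in>I. (\<Sum>l\<in>I. P i l * (z l + qform I b z l)) = z i + qform I b z i)))"
  shows "real_analytic_submanifold I d S"
  unfolding real_analytic_submanifold_def
proof (intro conjI S ballI)
  fix p assume p: "p \<in> S"
  then have pR: "p \<in> Rpow I" using S by blast
  from chart[OF p] obtain P b \<epsilon> where ch: "\<epsilon> > 0 \<and>
      (\<forall>i\<in>I. \<forall>j\<in>I. (\<Sum>l\<in>I. P i l * P l j) = P i j) \<and> (\<Sum>i\<in>I. P i i) = real d \<and>
      (\<forall>z\<in>Rpow I. (\<forall>i\<in>I. \<bar>z i\<bar> < \<epsilon>) \<longrightarrow>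
         ((\<lambda>i\<in>I. p i + z i) \<in> S \<longleftrightarrow>
          (\<forall>i\<in>I. (\<Sum>l\<in>I. P i l * (z l + qform I b z l)) = z i + qform I b z i)))"
    by (elim exE)
  note ch1 = ch[THEN conjunct1] and ch2 = ch[THEN conjunct2, THEN conjunct1]
    and ch3 = ch[THEN conjunct2, THEN conjunct2, THEN conjunct1]
    and ch4 = ch[THEN conjunct2, THEN conjunct2, THEN conjunct2]
  have idem: "(\<Sum>l\<in>I. P i l * P l j) = P i j" if "i \<in> I" "j \<in> I" for i j
    using ch2 that by blast
  have loc: "(\<lambda>i\<in>I. p i + z i) \<in> S \<longleftrightarrow>
          (\<forall>i\<in>I. (\<Sum>l\<in>I. P i l * (z l + qform I b z l)) = z i + qform I b z i)"
    if "z \<in> Rpow I" "\<And>i. i \<in> I \<Longrightarrow> \<bar>z i\<bar> < \<epsilon>" for z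
    by (rule ch4[THEN bspec, THEN mp]) (use that in auto)
  obtain J u where J: "J \<subseteq> I"
    and fixu: "\<And>i j. i \<in> I \<Longrightarrow> j \<in> J \<Longrightarrow> (\<Sum>l\<in>I. P i l * u j l) = u j i"
    and del: "\<And>i j. i \<in> J \<Longrightarrow> j \<in> J \<Longrightarrow> u j i = (if i = j then 1 else 0 :: real)"
    and expand: "\<And>x i. (\<And>i. i \<in> I \<Longrightarrow> (\<Sum>l\<in>I. P i l * x l) = x i) \<Longrightarrow> i \<in> I \<Longrightarrow>
        x i = (\<Sum>j\<in>J. x j * u j i)"
    and cJ: "real (card J) = (\<Sum>i\<in>I. P i i)"
  proof (rule echelon_basis[OF I idem], goal_cases)
    case (3 J u)
    show thesis by (rule 3(1)[OF 3(2)], fact 3(3), fact 3(4), fact 3(5), fact 3(6))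
  qed
  \<comment> \<open>\<open>N\<close> maps the coordinates in \<open>J\<close> to those outside
    \<open>J\<close>, so its square is zero and \<open>1 - N\<close>, \<open>1 + N\<close> are
    mutually inverse. The shear \<open>1 - N\<close> clears the coordinates outside \<open>J\<close>
    from every vector in the image of \<open>P\<close>.\<close>
  define N where "N i j = (if i \<in> I - J \<and> j \<in> J then u j i else 0)" for i j
  have NN: "N i j * N j l = 0" "N j l * N i j = 0" for i j l by (simp_all add: N_def)
  define t where "t i j = (if i = j then 1 else 0) - N i j" for i j
  define t' where "t' i j = (if i = j then 1 else 0) + N i j" for i j
  have tx: "(\<Sum>j\<in>I. t i j * x j) = x i - (\<Sum>j\<in>I. N i j * x j)"
    and t'x: "(\<Sum>j\<in>I. t' i j * x j) = x i + (\<Sum>j\<in>I. N i j * x j)" if "i \<in> I" for i x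
  proof -
    have "(\<Sum>j\<in>I. t i j * x j) = (\<Sum>j\<in>I. (if i = j then x j else 0) - N i j * x j)"
      "(\<Sum>j\<in>I. t' i j * x j) = (\<Sum>j\<in>I. (if i = j then x j else 0) + N i j * x j)"
      by (rule sum.cong; auto simp: t_def t'_def algebra_simps)+
    then show "(\<Sum>j\<in>I. t i j * x j) = x i - (\<Sum>j\<in>I. N i j * x j)"
      "(\<Sum>j\<in>I. t' i j * x j) = x i + (\<Sum>j\<in>I. N i j * x j)"
      using that I by (simp_all add: sum_subtractf sum.distrib)
  qed
  have Nx: "(\<Sum>j\<in>I. N i j * x j) = (if i \<in> J then 0 else \<Sum>j\<in>J. x j * u j i)" if "i \<in> I" for i x
  proof (cases "i \<in> J")
    case False
    have "(\<Sum>j\<in>I. N i j * x j) = (\<Sum>j\<in>J. N i j * x j)"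
      using I J by (intro sum.mono_neutral_right) (auto simp: N_def)
    also have "\<dots> = (\<Sum>j\<in>J. x j * u j i)"
      using False that by (intro sum.cong) (auto simp: N_def)
    finally show ?thesis using False by simp
  qed (simp add: N_def)
  have tt': "(\<Sum>j\<in>I. t i j * t' j l) = (if i = l then 1 else 0)"
    and t't: "(\<Sum>j\<in>I. t' i j * t j l) = (if i = l then 1 else 0)" if "i \<in> I" "l \<in> I" for i l
  proof -
    have "(\<Sum>j\<in>I. N i j * t' j l) = N i l" "(\<Sum>j\<in>I. N i j * t j l) = N i l"
      using that I by (simp_all add: t_def t'_def algebra_simps sum.distrib sum_subtractf NN
          if_distrib[of "\<lambda>x. _ * x"] cong: if_cong)
    then show "(\<Sum>j\<in>I. t i j * t' j l) = (if i = l then 1 else 0)"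
      "(\<Sum>j\<in>I. t' i j * t j l) = (if i = l then 1 else 0)"
      using that by (simp_all add: tx t'x) (simp_all add: t_def t'_def)
  qed
  define T where "T x = (\<lambda>i\<in>I. \<Sum>j\<in>I. t i j * x j)" for x
  define T' where "T' x = (\<lambda>i\<in>I. \<Sum>j\<in>I. t' i j * x j)" for x
  have TR: "T x \<in> Rpow I" "T' x \<in> Rpow I" for x by (simp_all add: T_def T'_def)
  have TT': "T (T' x) = x" and T'T: "T' (T x) = x" if "x \<in> Rpow I" for x
  proof -
    have "T (T' x) i = x i" "T' (T x) i = x i" if "i \<in> I" for i
      using that I by (simp_all add: T_def T'_def sum_mult_assoc_on tt' t't sum_kronecker cong: sum.cong)
    then show "T (T' x) = x" "T' (T x) = x"
      using that TR by (metis PiE_ext)+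
  qed
  define \<Phi> where "\<Phi> z = (\<lambda>i\<in>I. z i + qform I b z i)" for z
  define b1 where "b1 p j l = (\<Sum>q\<in>I. \<Sum>r\<in>I. b p q r * (t' q j * t' r l))" for p j l
  define b2 where "b2 i j l = (\<Sum>p\<in>I. t i p * b1 p j l)" for i j l
  define \<Phi>2 where "\<Phi>2 z = (\<lambda>i\<in>I. z i + qform I b2 z i)" for z
  have conj: "\<Phi>2 (T z) = T (\<Phi> z)" if "z \<in> Rpow I" for z
  proof -
    have "\<Phi>2 (T z) i = T (\<Phi> z) i" if i: "i \<in> I" for i
    proof -
      have "qform I b2 (T z) i = (\<Sum>p\<in>I. t i p * qform I b1 (T z) p)"
        unfolding sum_qform b2_def ..
      also have "\<dots> = (\<Sum>p\<in>I. t i p * qform I b (\<lambda>q. \<Sum>s\<in>I. t' q s * T z s) p)"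
        unfolding qform_linear_subst b1_def ..
      also have "\<dots> = (\<Sum>p\<in>I. t i p * qform I b z p)"
      proof (intro sum.cong refl arg_cong2[where f = "(*)"] qform_cong)
        fix q assume "q \<in> I"
        then show "(\<Sum>s\<in>I. t' q s * T z s) = z q"
          using fun_cong[OF T'T[OF \<open>z \<in> Rpow I\<close>], of q] by (simp add: T'_def)
      qed
      finally show ?thesis
        using i by (simp add: \<Phi>2_def T_def \<Phi>_def distrib_left sum.distrib)
    qed
    then show ?thesis by (metis (no_types, lifting) PiE_ext TR(1) \<Phi>2_def restrict_PiE_iff UNIV_I)
  qed
  \<comment> \<open>\<open>C\<close> exceeds the row sums of the inverse shear; a cube of size at
    most \<open>\<epsilon> / C\<close> in sheared coordinates thus stays where the local description
    of \<open>S\<close> holds.\<close>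
  define C where "C = 1 + (\<Sum>i\<in>I. \<Sum>j\<in>I. \<bar>t' i j\<bar>)"
  have C1: "C \<ge> 1" unfolding C_def by (simp add: sum_nonneg)
  obtain \<delta> \<Psi> where \<delta>: "\<delta> > 0" "\<delta> \<le> \<epsilon> / C"
    and an\<Psi>: "real_analytic_map I I (\<Phi>2 ` {z \<in> Rpow I. \<forall>i\<in>I. \<bar>z i\<bar> < \<delta>}) \<Psi>"
    and \<Psi>\<Phi>: "\<And>z. z \<in> Rpow I \<Longrightarrow> (\<And>i. i \<in> I \<Longrightarrow> \<bar>z i\<bar> < \<delta>) \<Longrightarrow> \<Psi> (\<Phi>2 z) = z"
    unfolding \<Phi>2_def
    by (rule quadratic_local_inverse[OF I, of "\<epsilon> / C" b2]) (use ch1 C1 in auto)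
  define U0 where "U0 = {z \<in> Rpow I. \<forall>i\<in>I. \<bar>z i\<bar> < \<delta>}"
  define D where "D x = (\<lambda>i\<in>I. x i - p i)" for x
  define U where "U = {x \<in> Rpow I. T (D x) \<in> U0}"
  define W where "W = \<Phi>2 ` U0"
  define \<phi> where "\<phi> x = \<Phi>2 (T (D x))" for x
  define \<psi> where "\<psi> y = (\<lambda>i\<in>I. p i + T' (\<Psi> y) i)" for y
  have \<Psi>in: "\<Psi> y \<in> U0" "\<Phi>2 (\<Psi> y) = y" if "y \<in> W" for y
    using that \<Psi>\<Phi> by (auto simp: W_def U0_def)
  have D\<psi>: "D (\<psi> y) = T' (\<Psi> y)" for y
    using TR(2)[of "\<Psi> y"] by (intro PiE_ext[of _ I "\<lambda>_. UNIV"]) (auto simp: D_def \<psi>_def)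
  have TD\<psi>: "T (D (\<psi> y)) = \<Psi> y" if "y \<in> W" for y
    using \<Psi>in[OF that] by (simp add: D\<psi> TT' U0_def)
  have \<psi>\<phi>: "\<psi> (\<phi> x) = x" if "x \<in> U" for x
  proof -
    have "\<Psi> (\<phi> x) = T (D x)" using that by (auto simp: U_def U0_def \<phi>_def intro!: \<Psi>\<Phi>)
    then have "T' (\<Psi> (\<phi> x)) = D x" by (simp add: T'T D_def)
    then show ?thesis using that
      by (intro PiE_ext[of _ I "\<lambda>_. UNIV"]) (auto simp: \<psi>_def D_def U_def)
  qed
  have \<phi>\<psi>: "\<phi> (\<psi> y) = y" if "y \<in> W" for y
    using TD\<psi>[OF that] \<Psi>in[OF that] by (simp add: \<phi>_def)
  have \<phi>U: "\<phi> x \<in> W" if "x \<in> U" for x using that by (simp add: \<phi>_def U_def W_def)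
  have \<psi>W: "\<psi> y \<in> U" if "y \<in> W" for y
    using TD\<psi>[OF that] \<Psi>in[OF that] by (simp add: U_def \<psi>_def)
  have openU: "openin (powertop_real I) U"
  proof (rule openin_powertop_realI[OF I])
    show "U \<subseteq> Rpow I" by (auto simp: U_def)
    fix x assume x: "x \<in> U"
    define C' where "C' = 1 + (\<Sum>i\<in>I. \<Sum>j\<in>I. \<bar>t i j\<bar>)"
    have C'1: "C' \<ge> 1" unfolding C'_def by (simp add: sum_nonneg)
    obtain e where e: "e > 0" "\<And>i. i \<in> I \<Longrightarrow> e \<le> \<delta> - \<bar>T (D x) i\<bar>"
      using ex_pos_lower_bound[OF I, of "\<lambda>i. \<delta> - \<bar>T (D x) i\<bar>"] x by (auto simp: U_def U0_def)
    show "\<exists>r>0. \<forall>y\<in>Rpow I. (\<forall>i\<in>I. \<bar>y i - x i\<bar> < r) \<longrightarrow> y \<in> U"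
    proof (intro exI[of _ "e / C'"] conjI ballI impI)
      show "e / C' > 0" using e C'1 by simp
      fix y assume y: "y \<in> Rpow I" "\<forall>i\<in>I. \<bar>y i - x i\<bar> < e / C'"
      have "\<bar>T (D y) i\<bar> < \<delta>" if i: "i \<in> I" for i
      proof -
        have "T (D y) i = T (D x) i + (\<Sum>j\<in>I. t i j * (y j - x j))"
          using i by (simp add: T_def D_def sum.distrib[symmetric] algebra_simps)
        moreover have "\<bar>\<Sum>j\<in>I. t i j * (y j - x j)\<bar> < e"
        proof -
          have "\<bar>\<Sum>j\<in>I. t i j * (y j - x j)\<bar> \<le> (\<Sum>j\<in>I. \<bar>t i j\<bar>) * (e / C')"
            by (rule abs_sum_mult_le) (use y(2) in \<open>auto simp: less_imp_le\<close>)
          also have "\<dots> \<le> (C' - 1) * (e / C')"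
            using member_le_sum[of i I "\<lambda>i. \<Sum>j\<in>I. \<bar>t i j\<bar>"] i I e C'1
            by (intro mult_right_mono) (auto simp: C'_def sum_nonneg)
          also have "\<dots> < C' * (e / C')" using e C'1 by (intro mult_strict_right_mono) auto
          finally show ?thesis using C'1 by simp
        qed
        ultimately show ?thesis using e(2)[OF i] by linarith
      qed
      then show "y \<in> U" using y(1) TR by (simp add: U_def U0_def)
    qed
  qed
  have an\<phi>: "real_analytic_map I I U \<phi>"
    unfolding real_analytic_map_def
  proof (intro conjI ballI openU)
    show "\<phi> \<in> U \<rightarrow> Rpow I" by (simp add: \<phi>_def \<Phi>2_def)
    fix x i assume "x \<in> U" and i: "i \<in> I"
    have TD: "real_analytic_at I (\<lambda>y. T (D y) i) x" if "i \<in> I" for i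
    proof (rule real_analytic_at_cong)
      show "real_analytic_at I (\<lambda>y. \<Sum>j\<in>I. t i j * (y j + - p j)) x"
        by (intro real_analytic_at_sum real_analytic_at_mult real_analytic_at_const
            real_analytic_at_add real_analytic_at_coord I)
    qed (simp add: T_def D_def that)
    have "real_analytic_at I (\<lambda>y. T (D y) i + qform I b2 (T (D y)) i) x"
      by (intro real_analytic_at_add real_analytic_at_qform TD I i)
    then show "real_analytic_at I (\<lambda>y. \<phi> y i) x"
      using i by (simp add: \<phi>_def \<Phi>2_def)
  qed
  have an\<psi>: "real_analytic_map I I W \<psi>"
    unfolding real_analytic_map_def
  proof (intro conjI ballI)
    show "openin (powertop_real I) W"
      using an\<Psi> by (simp add: real_analytic_map_def W_def U0_def)
    show "\<psi> \<in> W \<rightarrow> Rpow I" by (simp add: \<psi>_def)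
    fix y i assume y: "y \<in> W" and i: "i \<in> I"
    have "real_analytic_at I (\<lambda>y. \<Psi> y j) y" if "j \<in> I" for j
      using an\<Psi> y that unfolding real_analytic_map_def W_def U0_def by blast
    then have "real_analytic_at I (\<lambda>y. p i + (\<Sum>j\<in>I. t' i j * \<Psi> y j)) y"
      by (intro real_analytic_at_sum real_analytic_at_mult real_analytic_at_const
            real_analytic_at_add I)
    then show "real_analytic_at I (\<lambda>y. \<psi> y i) y"
      using i by (simp add: \<psi>_def T'_def)
  qed
  have inS: "x \<in> S \<longleftrightarrow> (\<forall>i\<in>I - J. \<phi> x i = 0)" if x: "x \<in> U" for x
  proof -
    have DR: "D x \<in> Rpow I" by (simp add: D_def)
    have small: "\<bar>D x i\<bar> < \<epsilon>" if i: "i \<in> I" for i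
    proof -
      have "\<bar>\<Sum>j\<in>I. t' i j * T (D x) j\<bar> \<le> (\<Sum>j\<in>I. \<bar>t' i j\<bar>) * \<delta>"
        by (rule abs_sum_mult_le) (use x in \<open>auto simp: U_def U0_def less_imp_le\<close>)
      also have "\<dots> \<le> (C - 1) * \<delta>"
        using member_le_sum[of i I "\<lambda>i. \<Sum>j\<in>I. \<bar>t' i j\<bar>"] i I \<delta>
        by (intro mult_right_mono) (auto simp: C_def sum_nonneg)
      also have "\<dots> < C * \<delta>" using \<delta> by (intro mult_strict_right_mono) auto
      also have "\<dots> \<le> \<epsilon>" using \<delta>(2) C1 by (simp add: field_simps)
      finally show ?thesis
        using fun_cong[OF T'T[OF DR], of i] i by (simp add: T'_def)
    qed
    have "(\<lambda>i\<in>I. p i + D x i) = x"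
      using x by (intro PiE_ext[of _ I "\<lambda>_. UNIV"]) (auto simp: D_def U_def)
    then have "x \<in> S \<longleftrightarrow> (\<forall>i\<in>I. (\<Sum>l\<in>I. P i l * \<Phi> (D x) l) = \<Phi> (D x) i)"
      using loc[OF DR small] by (simp add: \<Phi>_def)
    \<comment> \<open>Fixed vectors of \<open>P\<close> are exactly the combinations of the
      \<open>u j\<close> with their own \<open>J\<close>-coordinates as coefficients;
      \<open>T\<close> subtracts this combination from the coordinates outside
      \<open>J\<close>.\<close>
    also have "\<dots> \<longleftrightarrow> (\<forall>i\<in>I - J. T (\<Phi> (D x)) i = 0)"
    proof
      assume "\<forall>i\<in>I. (\<Sum>l\<in>I. P i l * \<Phi> (D x) l) = \<Phi> (D x) i"
      then have ex: "\<Phi> (D x) i = (\<Sum>j\<in>J. \<Phi> (D x) j * u j i)" if "i \<in> I" for i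
        using expand[of "\<Phi> (D x)"] that by blast
      show "\<forall>i\<in>I - J. T (\<Phi> (D x)) i = 0"
      proof
        fix i assume "i \<in> I - J"
        then have "T (\<Phi> (D x)) i = \<Phi> (D x) i - (\<Sum>j\<in>J. \<Phi> (D x) j * u j i)"
          by (simp add: T_def tx Nx)
        with ex[of i] \<open>i \<in> I - J\<close> show "T (\<Phi> (D x)) i = 0" by simp
      qed
    next
      assume 0: "\<forall>i\<in>I - J. T (\<Phi> (D x)) i = 0"
      have ex: "\<Phi> (D x) i = (\<Sum>j\<in>J. \<Phi> (D x) j * u j i)" if "i \<in> I" for i
      proof (cases "i \<in> J")
        case True
        have "(\<Sum>j\<in>J. u j i * \<Phi> (D x) j) = \<Phi> (D x) i"
          using J I finite_subset True by (intro sum_kronecker) (auto simp: del)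
        then show ?thesis by (simp add: mult.commute)
      next
        case False
        then show ?thesis using 0 that by (auto simp: T_def tx Nx)
      qed
      show "\<forall>i\<in>I. (\<Sum>l\<in>I. P i l * \<Phi> (D x) l) = \<Phi> (D x) i"
      proof
        fix i assume i: "i \<in> I"
        have "(\<Sum>l\<in>I. P i l * \<Phi> (D x) l) = (\<Sum>l\<in>I. \<Sum>j\<in>J. \<Phi> (D x) j * (P i l * u j l))"
          by (intro sum.cong refl) (subst ex, auto simp: sum_distrib_left mult_ac)
        also have "\<dots> = (\<Sum>j\<in>J. \<Phi> (D x) j * (\<Sum>l\<in>I. P i l * u j l))"
          by (subst sum.swap) (simp add: sum_distrib_left)
        also have "\<dots> = (\<Sum>j\<in>J. \<Phi> (D x) j * u j i)" by (simp add: fixu i)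
        also have "\<dots> = \<Phi> (D x) i" using ex[OF i] by simp
        finally show "(\<Sum>l\<in>I. P i l * \<Phi> (D x) l) = \<Phi> (D x) i" .
      qed
    qed
    also have "T (\<Phi> (D x)) = \<phi> x" using conj[OF DR] by (simp add: \<phi>_def)
    finally show ?thesis .
  qed
  show "\<exists>U W \<phi> \<psi> J. p \<in> U \<and> real_analytic_map I I U \<phi> \<and> real_analytic_map I I W \<psi> \<and>
        \<phi> ` U = W \<and> \<psi> ` W = U \<and> (\<forall>x\<in>U. \<psi> (\<phi> x) = x) \<and> (\<forall>y\<in>W. \<phi> (\<psi> y) = y) \<and>
        J \<subseteq> I \<and> card J = d \<and> \<phi> ` (U \<inter> S) = {y\<in>W. \<forall>i\<in>I - J. y i = 0}"
  proof (rule exI[of _ U], rule exI[of _ W], rule exI[of _ \<phi>], rule exI[of _ \<psi>], rule exI[of _ J],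
      intro conjI an\<phi> an\<psi> J)
    have "T (D p) i = 0" if "i \<in> I" for i using that by (simp add: T_def D_def)
    then show "p \<in> U" using pR TR \<delta> by (auto simp: U_def U0_def)
    show "\<phi> ` U = W" using \<phi>U \<phi>\<psi> \<psi>W by (metis image_subsetI subsetI image_eqI subset_antisym)
    show "\<psi> ` W = U" using \<phi>U \<psi>\<phi> \<psi>W by (metis image_subsetI subsetI image_eqI subset_antisym)
    show "\<forall>x\<in>U. \<psi> (\<phi> x) = x" using \<psi>\<phi> by blast
    show "\<forall>y\<in>W. \<phi> (\<psi> y) = y" using \<phi>\<psi> by blast
    show "card J = d" using cJ ch3 by simp
    show "\<phi> ` (U \<inter> S) = {y\<in>W. \<forall>i\<in>I - J. y i = 0}"
    proof (intro equalityI subsetI)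
      fix y assume "y \<in> \<phi> ` (U \<inter> S)"
      then show "y \<in> {y\<in>W. \<forall>i\<in>I - J. y i = 0}" using inS \<phi>U by blast
    next
      fix y assume "y \<in> {y\<in>W. \<forall>i\<in>I - J. y i = 0}"
      then have "y = \<phi> (\<psi> y)" "\<psi> y \<in> U \<inter> S" using inS[OF \<psi>W[of y]] \<psi>W[of y] \<phi>\<psi>[of y] by auto
      then show "y \<in> \<phi> ` (U \<inter> S)" by blast
    qed
  qed
qed

section \<open>Trace and rank of an idempotent matrix\<close>

text \<open>Rank factorisation \<open>A = B * C\<close>, the columns of \<open>B\<close> being a
  basis of the column space. Idempotency gives \<open>C * B = 1\<close>, and trace
  \<open>(B * C)\<close> equals trace \<open>(C * B)\<close>, which is the rank. Integrality of
  traces rests on this.\<close>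

lemma idempotent_trace_eq_rank:
  fixes A :: "'a :: field mat"
  assumes A: "A \<in> carrier_mat n n" and AA: "A * A = A"
  shows "(\<Sum>i<n. A $$ (i, i)) = of_nat (vec_space.rank n A)"
proof -
  interpret vec_space "TYPE('a)" n .
  let ?S = "set (cols A)"
  have S: "?S \<subseteq> carrier_vec n" using cols_dim[of A] A by auto
  obtain U where U: "maximal U (\<lambda>T. T \<subseteq> ?S \<and> lin_indpt T)"
    using maximal_exists[of "\<lambda>T. T \<subseteq> ?S \<and> lin_indpt T" "card ?S" "{}"]
    by (meson List.finite_set card_mono empty_iff empty_subsetI finite_lin_indpt2 rev_finite_subset)
  have rk: "rank A = card U" by (rule rank_card_indpt[OF A U])
  have US: "U \<subseteq> ?S" and Uli: "lin_indpt U" using U by (auto simp: maximal_def)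
  have fU: "finite U" using US finite_subset by auto
  have Uc: "U \<subseteq> carrier_vec n" using US S by auto
  have span: "v \<in> span U" if "v \<in> ?S" for v
  proof (rule ccontr)
    assume nv: "v \<notin> span U"
    then have "v \<notin> U" using span_mem[OF Uc] by blast
    moreover have "lin_indpt (U \<union> {v})"
      using lin_dep_iff_in_span[OF Uc Uli, of v] nv that S \<open>v \<notin> U\<close> by blast
    ultimately show False
      using U that US unfolding maximal_def by blast
  qed
  obtain us where us: "set us = U" "distinct us" using finite_distinct_list[OF fU] by blast
  define r where "r = length us"
  have r: "r = card U" using us by (simp add: r_def distinct_card[symmetric])
  define B where "B = mat_of_cols n us"
  have B: "B \<in> carrier_mat n r" by (simp add: B_def r_def)
  have cB: "cols B = us" unfolding B_def using us Uc by (intro cols_mat_of_cols) auto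
  have ex: "\<exists>c \<in> carrier_vec r. B *\<^sub>v c = v" if v: "v \<in> ?S" for v
  proof -
    obtain a where "v = lincomb a U"
      using span[OF v] fU Uc finite_in_span by blast
    then have "B *\<^sub>v (vec r (\<lambda>i. a (col B i))) = v"
      using mat_mult_eq_lincomb[OF B, of a] us cB by simp
    then show ?thesis by (intro bexI[of _ "vec r (\<lambda>i. a (col B i))"]) auto
  qed
  then obtain c where c: "\<And>v. v \<in> ?S \<Longrightarrow> c v \<in> carrier_vec r" "\<And>v. v \<in> ?S \<Longrightarrow> B *\<^sub>v c v = v"
    by metis
  define C where "C = mat_of_cols r (map c (cols A))"
  have C: "C \<in> carrier_mat r n" using A mat_of_cols_carrier[of r "map c (cols A)"] by (simp add: C_def)
  have colS: "col A j \<in> ?S" if "j < n" for j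
    using that A by (metis carrier_matD(2) cols_length cols_nth nth_mem)
  have "col (B * C) j = col A j" if j: "j < n" for j
  proof -
    have "col C j = c (col A j)"
      unfolding C_def using j A c(1)[OF colS[OF j]] by (subst col_mat_of_cols) auto
    then show ?thesis using col_mult2[OF B C j] c(2)[OF colS[OF j]] by simp
  qed
  then have BC: "B * C = A"
    using A B C by (intro mat_col_eqI) auto
  have AB: "A * B = B"
  proof (rule mat_col_eqI)
    fix j assume "j < dim_col B"
    then have j: "j < r" using B by simp
    have "col B j \<in> ?S" using cB j US us by (metis B carrier_matD(2) cols_length cols_nth nth_mem subsetD)
    then obtain l where l: "l < n" "col B j = col A l"
      using A by (metis carrier_matD(2) cols_length cols_nth in_set_conv_nth)
    have "col (A * B) j = A *\<^sub>v col A l" using col_mult2[OF A B j] l by simp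
    also have "\<dots> = col (A * A) l" using col_mult2[OF A A l(1)] by simp
    finally show "col (A * B) j = col B j" using AA l by simp
  qed (use A B in auto)
  \<comment> \<open>\<open>B * (C * B - 1) = A * B - B = 0\<close>, and the columns of
    \<open>B\<close> are independent.\<close>
  have CB: "C * B = 1\<^sub>m r"
  proof (rule mat_col_eqI)
    fix j assume "j < dim_col (1\<^sub>m r :: 'a mat)"
    then have j: "j < r" by simp
    define v where "v = col (C * B) j - col (1\<^sub>m r) j"
    have cCB: "col (C * B) j = C *\<^sub>v col B j" by (rule col_mult2[OF C B j])
    have vc: "v \<in> carrier_vec r" using B C j by (simp add: v_def)
    have "B *\<^sub>v v = B *\<^sub>v (C *\<^sub>v col B j) - B *\<^sub>v col (1\<^sub>m r) j"
      unfolding v_def cCB using B C j by (intro mult_minus_distrib_mat_vec) auto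
    also have "B *\<^sub>v (C *\<^sub>v col B j) = (B * C) *\<^sub>v col B j"
      using B C j by (intro assoc_mult_mat_vec[symmetric]) auto
    also have "\<dots> = col (A * B) j" unfolding BC by (rule col_mult2[OF A B j, symmetric])
    also have "\<dots> = col B j" by (simp add: AB)
    also have "B *\<^sub>v col (1\<^sub>m r) j = col B j"
      using col_mult2[OF B one_carrier_mat j] B by simp
    finally have "B *\<^sub>v v = 0\<^sub>v n" using B j by simp
    then have "v = 0\<^sub>v r"
      using lin_depI[OF B vc] Uli us cB by auto
    then show "col (C * B) j = col (1\<^sub>m r) j"
      using B C j unfolding v_def by (intro eq_vecI) (auto simp: vec_eq_iff)
  qed (use B C in auto)
  have "(\<Sum>i<n. A $$ (i, i)) = (\<Sum>i<n. \<Sum>l<r. B $$ (i, l) * C $$ (l, i))"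
    unfolding BC[symmetric] using B C
    by (intro sum.cong refl) (auto simp: scalar_prod_def atLeast0LessThan)
  also have "\<dots> = (\<Sum>l<r. \<Sum>i<n. C $$ (l, i) * B $$ (i, l))"
    by (subst sum.swap) (simp add: mult.commute)
  also have "\<dots> = (\<Sum>l<r. (C * B) $$ (l, l))"
    using B C by (intro sum.cong refl) (auto simp: scalar_prod_def atLeast0LessThan)
  also have "\<dots> = of_nat r" by (simp add: CB)
  finally show ?thesis using rk r by simp
qed

section \<open>Matrices over the real or complex numbers\<close>

text \<open>
  The last assumption evaluates the real trace of \<open>x \<mapsto> z * conjugate x\<close>, which vanishes over \<open>\<complex>\<close>
  because the map is conjugate linear.
\<close>

class real_or_complex = conjugatable_field + real_normed_field + euclidean_space +
  assumes conjugate_scaleR_one: "conjugate (r *\<^sub>R 1) = r *\<^sub>R 1"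
    and conjugate_mult_self_scaleR: "conjugate x * x = (norm x * norm x) *\<^sub>R 1"
    and inner_eq_inner_one: "inner x y = inner (x * conjugate y) 1"
    and add_conjugate_scaleR: "x + conjugate x = (2 * inner x 1) *\<^sub>R 1"
    and conjugate_cases: "(\<forall>x. conjugate x = x) \<or> (\<forall>z. (\<Sum>b\<in>Basis. inner (z * conjugate b) b) = 0)"

instance real :: real_or_complex
  by standard simp_all

instance complex :: real_or_complex
proof
  fix x y :: complex and r :: real
  show "conjugate x * x = (norm x * norm x) *\<^sub>R 1"
    by (simp add: complex_eq_iff power2_eq_square[symmetric] cmod_power2) 
  \<comment> \<open>The second alternative holds: the basis elements 1 and i contribute
    \<open>Re z\<close> and \<open>- Re z\<close>.\<close>
  show "(\<forall>x :: complex. conjugate x = x) \<or> (\<forall>z :: complex. (\<Sum>b\<in>Basis. inner (z * conjugate b) b) = 0)"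
    by (simp add: Basis_complex_def inner_complex_def)
qed (auto simp: inner_complex_def complex_eq_iff)

lemma conjugate_of_real: "conjugate (of_real r) = (of_real r :: 'e :: real_or_complex)"
  by (simp add: of_real_def conjugate_scaleR_one)

lemma conjugate_mult_self: "conjugate x * x = (of_real ((norm x)\<^sup>2) :: 'e :: real_or_complex)"
  by (simp add: of_real_def conjugate_mult_self_scaleR power2_eq_square)

lemma add_conjugate: "x + conjugate x = (of_real (2 * inner x 1) :: 'e :: real_or_complex)"
  by (simp add: of_real_def add_conjugate_scaleR)

lemma conjugate_one [simp]: "conjugate (1 :: 'e :: real_or_complex) = 1"
  using conjugate_of_real[of 1] by simp

lemma conjugate_diff: "conjugate (x - y) = conjugate x - conjugate (y :: 'e :: real_or_complex)"
  using conjugate_dist_add[of x "- y"] by (simp add: conjugate_neg)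

lemma inner_one_one [simp]: "inner 1 (1 :: 'e :: real_or_complex) = 1"
  by (simp add: dot_square_norm)

lemma inner_of_real_one [simp]: "inner (of_real r) (1 :: 'e :: real_or_complex) = r"
  by (simp add: of_real_def)

lemma inner_of_real_mult: "inner (of_real r * x) y = r * inner x (y :: 'e :: real_or_complex)"
  by (simp add: scaleR_conv_of_real[symmetric])

lemma norm_conjugate [simp]: "norm (conjugate x) = norm (x :: 'e :: real_or_complex)"
proof -
  have "of_real ((norm (conjugate x))\<^sup>2) = (of_real ((norm x)\<^sup>2) :: 'e)"
    using conjugate_mult_self[of x] conjugate_mult_self[of "conjugate x"] by (simp add: mult.commute)
  then show ?thesis by (simp only: of_real_eq_iff) (simp add: power2_eq_iff_nonneg)
qed

lemma self_conjugate_eq: "conjugate x = x \<Longrightarrow> x = of_real (inner x (1 :: 'e :: real_or_complex))"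
proof -
  assume "conjugate x = x"
  then have "of_real 2 * x = of_real 2 * of_real (inner x 1)"
    using add_conjugate[of x] by simp
  then show ?thesis by (simp only: mult_cancel_left) simp
qed

text \<open>
  A \<open>k \<times> k\<close> matrix is a function whose entries outside \<open>{..<k} \<times> {..<k}\<close> vanish; the ring laws
  then need no side conditions except for the unit.
\<close>

type_synonym 'e fmat = "nat \<Rightarrow> nat \<Rightarrow> 'e"

definition fmult :: "nat \<Rightarrow> 'e::real_or_complex fmat \<Rightarrow> 'e fmat \<Rightarrow> 'e fmat" where
  "fmult k A B = (\<lambda>i j. \<Sum>l<k. A i l * B l j)"

definition adj :: "'e::real_or_complex fmat \<Rightarrow> 'e fmat" where
  "adj A = (\<lambda>i j. conjugate (A j i))"

definition one_fmat :: "nat \<Rightarrow> 'e::real_or_complex fmat" where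
  "one_fmat k = (\<lambda>i j. if i = j \<and> i < k then 1 else 0)"

definition supp :: "nat \<Rightarrow> 'e::real_or_complex fmat \<Rightarrow> bool" where
  "supp k A \<longleftrightarrow> (\<forall>i j. \<not> (i < k \<and> j < k) \<longrightarrow> A i j = 0)"

definition scale :: "real \<Rightarrow> 'e::real_or_complex fmat \<Rightarrow> 'e fmat" where
  "scale r A = (\<lambda>i j. of_real r * A i j)"

definition diag_fmat :: "nat \<Rightarrow> (nat \<Rightarrow> real) \<Rightarrow> 'e::real_or_complex fmat" where
  "diag_fmat k v = (\<lambda>i j. if i = j \<and> i < k then of_real (v i) else 0)"

text \<open>The entrywise sum is submultiplicative with constant 1 and dominates every entry, so
  explicit smallness conditions can be stated in it.\<close>

definition norm1 :: "nat \<Rightarrow> 'e::real_or_complex fmat \<Rightarrow> real" where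
  "norm1 k A = (\<Sum>i<k. \<Sum>j<k. norm (A i j))"

lemma fmult_assoc: "fmult k (fmult k A B) C = fmult k A (fmult k B C)"
proof (intro ext)
  fix i j
  have "(\<Sum>l<k. (\<Sum>m<k. A i m * B m l) * C l j) = (\<Sum>l<k. \<Sum>m<k. A i m * (B m l * C l j))"
    by (simp add: sum_distrib_right mult.assoc)
  also have "\<dots> = (\<Sum>m<k. A i m * (\<Sum>l<k. B m l * C l j))"
    by (subst sum.swap) (simp add: sum_distrib_left)
  finally show "fmult k (fmult k A B) C i j = fmult k A (fmult k B C) i j" by (simp add: fmult_def)
qed

lemma fmult_add_left: "fmult k (A + B) C = fmult k A C + fmult k B C"
  and fmult_add_right: "fmult k C (A + B) = fmult k C A + fmult k C B"
  and fmult_diff_left: "fmult k (A - B) C = fmult k A C - fmult k B C"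
  and fmult_diff_right: "fmult k C (A - B) = fmult k C A - fmult k C B"
  by (simp_all add: fun_eq_iff fmult_def sum.distrib sum_subtractf algebra_simps)

lemma fmult_zero [simp]: "fmult k 0 A = 0" "fmult k A 0 = 0"
  by (simp_all add: fun_eq_iff fmult_def)

lemma fmult_scale: "fmult k (scale r A) B = scale r (fmult k A B)" "fmult k A (scale r B) = scale r (fmult k A B)"
  by (simp_all add: fun_eq_iff fmult_def scale_def sum_distrib_left mult_ac)

lemma scale_add: "scale r (A + B) = scale r A + scale r B" and scale_diff: "scale r (A - B) = scale r A - scale r B"
  and scale_scale: "scale r (scale t A) = scale (r * t) A"
  and scale_one [simp]: "scale 1 A = A"
  by (simp_all add: fun_eq_iff scale_def algebra_simps)

lemma adj_add: "adj (A + B) = adj A + adj B" and adj_diff: "adj (A - B) = adj A - adj B"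
  by (simp_all add: fun_eq_iff adj_def conjugate_dist_add conjugate_diff)

lemma adj_fmult: "adj (fmult k A B) = fmult k (adj B) (adj A)"
  by (simp add: fun_eq_iff adj_def fmult_def sum_conjugate conjugate_dist_mul mult.commute)

lemma adj_one_fmat [simp]: "adj (one_fmat k) = one_fmat k" and adj_diag_fmat [simp]: "adj (diag_fmat k v) = diag_fmat k v"
  by (auto simp: fun_eq_iff adj_def one_fmat_def diag_fmat_def conjugate_of_real)

lemma supp_add: "supp k A \<Longrightarrow> supp k B \<Longrightarrow> supp k (A + B)"
  and supp_diff: "supp k A \<Longrightarrow> supp k B \<Longrightarrow> supp k (A - B)"
  and supp_scale: "supp k A \<Longrightarrow> supp k (scale r A)"
  by (simp_all add: supp_def scale_def)

lemma supp_fmult: assumes "supp k A" "supp k B" shows "supp k (fmult k A B)"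
  unfolding supp_def
proof (intro allI impI)
  fix i j assume ij: "\<not> (i < k \<and> j < k)"
  have "A i l * B l j = 0" for l
    using assms ij by (cases "i < k") (auto simp: supp_def)
  then show "fmult k A B i j = 0" by (simp add: fmult_def)
qed

lemma fmult_one_fmat_left [simp]: assumes "supp k A" shows "fmult k (one_fmat k) A = A"
proof (intro ext)
  fix i j
  have "fmult k (one_fmat k) A i j = (\<Sum>l<k. if i = l then A i j else 0)"
    unfolding fmult_def by (rule sum.cong) (auto simp: one_fmat_def)
  then show "fmult k (one_fmat k) A i j = A i j" using assms by (auto simp: supp_def)
qed

lemma fmult_one_fmat_right [simp]: assumes "supp k A" shows "fmult k A (one_fmat k) = A"
proof (intro ext)
  fix i j
  have "fmult k A (one_fmat k) i j = (\<Sum>l<k. if j = l then A i j else 0)"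
    unfolding fmult_def by (rule sum.cong) (auto simp: one_fmat_def)
  then show "fmult k A (one_fmat k) i j = A i j" using assms by (auto simp: supp_def)
qed

lemma trace_fmult: "(\<Sum>i<k. fmult k A B i i) = (\<Sum>i<k. fmult k B A i i)"
  unfolding fmult_def by (subst sum.swap) (simp add: mult.commute)

lemma norm1_nonneg: "norm1 k A \<ge> 0"
  by (simp add: norm1_def sum_nonneg)

lemma norm1_fmult: "norm1 k (fmult k A B) \<le> norm1 k A * norm1 k B"
proof -
  have "norm1 k (fmult k A B) \<le> (\<Sum>i<k. \<Sum>j<k. \<Sum>l<k. norm (A i l) * norm (B l j))"
    unfolding norm1_def fmult_def by (intro sum_mono order_trans[OF norm_sum]) (simp add: norm_mult)
  also have "\<dots> = (\<Sum>i<k. \<Sum>l<k. norm (A i l) * (\<Sum>j<k. norm (B l j)))"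
    by (rule sum.cong[OF refl], subst sum.swap) (simp add: sum_distrib_left)
  also have "\<dots> \<le> (\<Sum>i<k. \<Sum>l<k. norm (A i l) * norm1 k B)"
    unfolding norm1_def
    by (intro sum_mono mult_left_mono member_le_sum[where f = "\<lambda>l. \<Sum>j<k. norm (B l j)"])
      (auto intro: sum_nonneg)
  also have "\<dots> = norm1 k A * norm1 k B" by (simp add: norm1_def sum_distrib_right)
  finally show ?thesis .
qed

lemma norm1_diff: "norm1 k (A - B) \<le> norm1 k A + norm1 k B"
  unfolding norm1_def sum.distrib[symmetric] by (intro sum_mono) (simp add: norm_triangle_ineq4)

lemma norm1_eq_0: "supp k A \<Longrightarrow> norm1 k A = 0 \<Longrightarrow> A = 0"
  by (auto simp: norm1_def supp_def fun_eq_iff sum_nonneg_eq_0_iff sum_nonneg)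

lemma idempotent_trace_nat:
  assumes "fmult k A A = A" obtains r :: nat where "(\<Sum>i<k. A i i) = of_nat r"
proof -
  define M where "M = mat k k (\<lambda>(i, j). A i j)"
  have "M * M = M"
    using fun_cong[OF fun_cong[OF assms]]
    by (intro eq_matI) (auto simp: M_def scalar_prod_def fmult_def atLeast0LessThan)
  from idempotent_trace_eq_rank[OF _ this, of k] have "(\<Sum>i<k. A i i) = of_nat (vec_space.rank k M)"
    by (simp add: M_def)
  then show ?thesis by (rule that)
qed

text \<open>For an equivalence relation \<open>r\<close> these are the block diagonal matrices of
  its classes, a self-adjoint algebra. A relation in place of a list of blocks treats all parts at
  once, without reordering the indices.\<close>

definition blockwise :: "nat \<Rightarrow> (nat \<Rightarrow> nat \<Rightarrow> bool) \<Rightarrow> 'e::real_or_complex fmat \<Rightarrow> bool" where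
  "blockwise k r A \<longleftrightarrow> (\<forall>i j. \<not> (i < k \<and> j < k \<and> r i j) \<longrightarrow> A i j = 0)"

lemma blockwise_supp: "blockwise k r A \<Longrightarrow> supp k A"
  by (auto simp: blockwise_def supp_def)

lemma blockwise_add: "blockwise k r A \<Longrightarrow> blockwise k r B \<Longrightarrow> blockwise k r (A + B)"
  and blockwise_diff: "blockwise k r A \<Longrightarrow> blockwise k r B \<Longrightarrow> blockwise k r (A - B)"
  and blockwise_scale: "blockwise k r A \<Longrightarrow> blockwise k r (scale c A)"
  by (simp_all add: blockwise_def scale_def)

lemma blockwise_fmult: assumes "transp r" "blockwise k r A" "blockwise k r B" shows "blockwise k r (fmult k A B)"
  unfolding blockwise_def
proof (intro allI impI)
  fix i j assume ij: "\<not> (i < k \<and> j < k \<and> r i j)"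
  have "A i l * B l j = 0" for l
    using assms(2,3) ij transpD[OF assms(1), of i l j]
    by (cases "i < k \<and> l < k \<and> r i l") (auto simp: blockwise_def)
  then show "fmult k A B i j = 0" by (simp add: fmult_def)
qed

lemma blockwise_adj: assumes "symp r" "blockwise k r A" shows "blockwise k r (adj A)"
  unfolding blockwise_def adj_def
proof (intro allI impI)
  fix i j assume "\<not> (i < k \<and> j < k \<and> r i j)"
  then have "\<not> (j < k \<and> i < k \<and> r j i)" using sympD[OF assms(1), of j i] by blast
  then show "conjugate (A j i) = 0" using assms(2) by (simp add: blockwise_def)
qed

lemma blockwise_one_fmat: "reflp_on {..<k} r \<Longrightarrow> blockwise k r (one_fmat k)"
  and blockwise_diag_fmat: "reflp_on {..<k} r \<Longrightarrow> blockwise k r (diag_fmat k v)"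
  by (auto simp: blockwise_def one_fmat_def diag_fmat_def reflp_on_def split: if_splits)

section \<open>The chart at a projection with constant diagonal\<close>

text \<open>
  The last clause says that the graph of the nonzero entries of \<open>P\<close> connects each class of \<open>r\<close>.
\<close>

definition good :: "nat \<Rightarrow> (nat \<Rightarrow> nat \<Rightarrow> bool) \<Rightarrow> real \<Rightarrow> 'e::real_or_complex fmat \<Rightarrow> bool" where
  "good k r s P \<longleftrightarrow> blockwise k r P \<and> adj P = P \<and> fmult k P P = P \<and> (\<forall>i<k. P i i = of_real s) \<and>
     (\<forall>w :: nat \<Rightarrow> real. (\<forall>i<k. \<forall>j<k. P i j \<noteq> 0 \<longrightarrow> w i = w j) \<longrightarrow>
        (\<forall>i<k. \<forall>j<k. r i j \<longrightarrow> w i = w j))"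

lemma sum_antisym_zero:
  fixes f :: "nat \<Rightarrow> nat \<Rightarrow> real"
  assumes "\<And>i j. f i j = - f j i"
  shows "(\<Sum>i<k. \<Sum>j<k. f i j) = 0"
proof -
  have "(\<Sum>i<k. \<Sum>j<k. f i j) = (\<Sum>i<k. \<Sum>j<k. - f j i)"
    by (intro sum.cong refl assms)
  also have "\<dots> = - (\<Sum>i<k. \<Sum>j<k. f i j)"
    by (subst sum.swap) (simp add: sum_negf)
  finally show ?thesis by simp
qed

text \<open>If no nonzero entry links \<open>A\<close> to its complement, then \<open>X\<close>
  restricted to \<open>A\<close> is again idempotent, so its trace is a natural number. This serves
  both the local constancy of traces and the divisibility of the part sizes.\<close>

lemma commuting_trace_nat:
  fixes X :: "'e::real_or_complex fmat"
  assumes X: "fmult k X X = X"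
    and commuting: "\<And>i j. i < k \<Longrightarrow> j < k \<Longrightarrow> X i j \<noteq> 0 \<Longrightarrow> i \<in> A \<longleftrightarrow> j \<in> A"
  obtains m :: nat where "(\<Sum>j<k. if j \<in> A then X j j else 0) = of_nat m"
proof -
  \<comment> \<open>Cutting the rows is enough: entries in a row from \<open>A\<close> and a column
    outside \<open>A\<close> vanish by \<open>commuting\<close>.\<close>
  define Y where "Y = (\<lambda>a b. if a < k \<and> b < k \<and> a \<in> A then X a b else 0)"
  have "fmult k Y Y = Y"
  proof (intro ext)
    fix a b
    show "fmult k Y Y a b = Y a b"
    proof (cases "a < k \<and> b < k \<and> a \<in> A")
      case True
      have "fmult k Y Y a b = (\<Sum>m<k. X a m * X m b)"
        unfolding fmult_def
      proof (rule sum.cong[OF refl])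
        fix m assume "m \<in> {..<k}"
        then show "Y a m * Y m b = X a m * X m b"
          using True commuting[of a m] by (cases "X a m = 0") (auto simp: Y_def)
      qed
      also have "\<dots> = X a b" using fun_cong[OF fun_cong[OF X], of a b] by (simp add: fmult_def)
      finally show ?thesis using True by (simp add: Y_def)
    qed (auto simp: fmult_def Y_def intro!: sum.neutral)
  qed
  then obtain m :: nat where "(\<Sum>j<k. Y j j) = of_nat m" by (rule idempotent_trace_nat)
  moreover have "(\<Sum>j<k. Y j j) = (\<Sum>j<k. if j \<in> A then X j j else 0)"
    by (rule sum.cong) (auto simp: Y_def)
  ultimately show ?thesis using that by metis
qed

locale frame_proj =
  fixes k :: nat and r :: "nat \<Rightarrow> nat \<Rightarrow> bool" and s :: real and P :: "'e::real_or_complex fmat"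
  assumes r_refl: "reflp r" and r_sym: "symp r" and r_trans: "transp r"
    and good: "good k r s P"
begin

abbreviation mult (infixl "\<star>" 70) where "A \<star> B \<equiv> fmult k A B"

definition Q :: "'e fmat" where "Q = one_fmat k - P"

lemma P_blockwise: "blockwise k r P" and P_adj [simp]: "adj P = P" and PP [simp]: "P \<star> P = P"
  and P_diag: "i < k \<Longrightarrow> P i i = of_real s"
  using good by (auto simp: good_def)

lemma conn:
  "\<forall>i<k. \<forall>j<k. P i j \<noteq> 0 \<longrightarrow> w i = w j \<Longrightarrow> i < k \<Longrightarrow> j < k \<Longrightarrow> r i j \<Longrightarrow> (w i :: real) = w j"
  using good by (simp add: good_def)

lemma refl_on: "reflp_on {..<k} r"
  using r_refl by (auto simp: reflp_on_def)

lemma rsym: "r i j = r j i" using r_sym by (auto dest: sympD)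

lemma P_supp: "supp k P" by (rule blockwise_supp[OF P_blockwise])

lemma PPX [simp]: "P \<star> (P \<star> X) = P \<star> X"
  by (simp add: fmult_assoc[symmetric])

lemma Q_blockwise: "blockwise k r Q"
  unfolding Q_def by (intro blockwise_diff blockwise_one_fmat refl_on P_blockwise)

lemma Q_adj [simp]: "adj Q = Q"
  by (simp add: Q_def adj_diff)

lemma QX: "supp k X \<Longrightarrow> Q \<star> X = X - P \<star> X" and XQ: "supp k X \<Longrightarrow> X \<star> Q = X - X \<star> P"
  by (simp_all add: Q_def fmult_diff_left fmult_diff_right)

lemmas fmult_simps = fmult_assoc fmult_add_left fmult_add_right fmult_diff_left fmult_diff_right
lemmas blockwise_simps = blockwise_fmult[OF r_trans] blockwise_add blockwise_diff blockwise_scale blockwise_adj[OF r_sym] P_blockwise Q_blockwise blockwise_diag_fmat[OF refl_on] blockwise_one_fmat[OF refl_on]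

text \<open>
  Composing the quadratic term of the chart with this map onto the Hermitian matrices which are
  blockwise with respect to \<open>r\<close> makes these two linear conditions visible in the values of the chart.
\<close>

definition herm_block :: "'e fmat \<Rightarrow> 'e fmat" where
  "herm_block X = (\<lambda>i j. if i < k \<and> j < k \<and> r i j then of_real (1 / 2) * (X i j + conjugate (X j i)) else 0)"

lemma herm_block_blockwise: "blockwise k r (herm_block X)"
  by (simp add: blockwise_def herm_block_def)

lemma herm_block_supp: "supp k (herm_block X)"
  by (rule blockwise_supp[OF herm_block_blockwise])

lemma herm_block_adj [simp]: "adj (herm_block X) = herm_block X"
  by (auto simp: fun_eq_iff adj_def herm_block_def rsym conjugate_dist_mul conjugate_of_real conjugate_dist_add
      add.commute simp del: of_real_divide)

lemma herm_block_id: assumes "blockwise k r X" "adj X = X" shows "herm_block X = X"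
proof (intro ext)
  fix i j
  have "conjugate (X j i) = X i j" using fun_cong[OF fun_cong[OF assms(2)], of i j] by (simp add: adj_def)
  then show "herm_block X i j = X i j"
    using assms(1) by (auto simp: herm_block_def blockwise_def)
qed

lemma herm_block_add: "herm_block (X + Y) = herm_block X + herm_block Y"
  by (auto simp: fun_eq_iff herm_block_def conjugate_dist_add algebra_simps)

lemma herm_block_scale: "herm_block (scale c X) = scale c (herm_block X)"
  by (auto simp: fun_eq_iff herm_block_def scale_def conjugate_dist_mul conjugate_of_real algebra_simps)

section \<open>Tangent directions and the lift of the diagonal\<close>

text \<open>The last equation is the linearisation of idempotency at \<open>P\<close>. It says that
  both diagonal corners of \<open>H\<close> vanish, so \<open>V\<close> is the blockwise part of the
  tangent space of the Grassmannian at \<open>P\<close>.\<close>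

definition V :: "'e fmat \<Rightarrow> bool" where
  "V H \<longleftrightarrow> blockwise k r H \<and> adj H = H \<and> P \<star> H + H \<star> P = H"

definition PiV :: "'e fmat \<Rightarrow> 'e fmat" where
  "PiV X = P \<star> (herm_block X \<star> Q) + Q \<star> (herm_block X \<star> P)"

text \<open>Eliminating \<open>Q\<close> leaves words in \<open>P\<close> and
  \<open>herm_block X\<close> that rewriting with \<open>P \<star> P = P\<close> brings to normal
  form.\<close>

lemma PiV_expand:
  "PiV X = (P \<star> herm_block X - P \<star> (herm_block X \<star> P)) + (herm_block X \<star> P - P \<star> (herm_block X \<star> P))"
  by (simp add: PiV_def QX XQ supp_fmult herm_block_supp P_supp fmult_diff_right)

lemma V_PiV: "V (PiV X)"
  unfolding V_def
proof (intro conjI)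
  show "blockwise k r (PiV X)" by (simp add: PiV_def blockwise_simps herm_block_blockwise)
  show "adj (PiV X) = PiV X" by (simp add: PiV_def adj_add adj_fmult fmult_assoc add.commute)
  show "P \<star> PiV X + PiV X \<star> P = PiV X"
    unfolding PiV_expand fmult_simps PPX PP by simp
qed

lemma V_PHP: assumes "V H" shows "P \<star> (H \<star> P) = 0"
proof -
  have e: "P \<star> H + H \<star> P = H" using assms by (simp add: V_def)
  have "P \<star> (P \<star> H + H \<star> P) = P \<star> H" by (simp only: e)
  then show ?thesis by (simp add: fmult_simps)
qed

lemma PiV_id: assumes "V H" shows "PiV H = H"
proof -
  have "herm_block H = H" using assms by (intro herm_block_id) (auto simp: V_def)
  then show ?thesis using V_PHP[OF assms] assms by (simp add: PiV_expand V_def)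
qed

lemma V_add: "V H \<Longrightarrow> V H' \<Longrightarrow> V (H + H')" and V_diff: "V H \<Longrightarrow> V H' \<Longrightarrow> V (H - H')"
proof -
  assume "V H" "V H'"
  then have e: "P \<star> H + H \<star> P = H" "P \<star> H' + H' \<star> P = H'"
    and b: "blockwise k r H" "blockwise k r H'" "adj H = H" "adj H' = H'" by (auto simp: V_def)
  have "P \<star> (H + H') + (H + H') \<star> P = (P \<star> H + H \<star> P) + (P \<star> H' + H' \<star> P)"
    by (simp add: fmult_simps)
  then show "V (H + H')" unfolding V_def e by (simp add: blockwise_add adj_add b)
  have "P \<star> (H - H') + (H - H') \<star> P = (P \<star> H + H \<star> P) - (P \<star> H' + H' \<star> P)"
    by (simp add: fmult_simps)
  then show "V (H - H')" unfolding V_def e by (simp add: blockwise_diff adj_diff b)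
qed

text \<open>For the trace inner product this is the adjoint of taking the diagonal on
  \<open>V\<close>. Composed with the diagonal it gives a symmetric positive semidefinite operator,
  the natural candidate for solving for a prescribed diagonal.\<close>

definition CC :: "(nat \<Rightarrow> real) \<Rightarrow> 'e fmat" where "CC w = PiV (diag_fmat k w)"

lemma V_CC: "V (CC w)" unfolding CC_def by (rule V_PiV)

definition n2 :: "nat \<Rightarrow> nat \<Rightarrow> real" where "n2 i j = (norm (P i j))\<^sup>2"

lemma P_conj: "conjugate (P i j) = P j i"
  using fun_cong[OF fun_cong[OF P_adj], of j i] by (simp add: adj_def)

lemma P_mult_swap: "P i j * P j i = of_real (n2 i j)"
  using conjugate_mult_self[of "P i j"] by (simp add: n2_def P_conj mult.commute)

lemma n2_sym: "n2 i j = n2 j i"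
  using norm_conjugate[of "P i j"] by (simp add: n2_def P_conj)

lemma sum_n2: "(\<Sum>j<k. of_real (n2 i j)) = P i i"
  using fun_cong[OF fun_cong[OF PP], of i i] by (simp add: fmult_def P_mult_swap)

lemma n2_r: "n2 i j \<noteq> 0 \<Longrightarrow> r i j"
  using P_blockwise by (auto simp: n2_def blockwise_def)

text \<open>With \<open>D\<close> the diagonal matrix of \<open>w\<close>, the matrix is
  \<open>P D + D P - 2 P D P\<close>. Since \<open>P\<close> is a Hermitian idempotent, row
  \<open>i\<close> of the weights \<open>n2\<close> sums to \<open>P i i\<close>, which combines the
  terms into differences \<open>w i - w j\<close>.\<close>

lemma CC_diag: assumes "i < k" shows "CC w i i = of_real (2 * (\<Sum>j<k. n2 i j * (w i - w j)))"
proof -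
  have E: "herm_block (diag_fmat k w) = diag_fmat k w" by (intro herm_block_id) (simp_all add: blockwise_simps)
  have 1: "(P \<star> diag_fmat k w) i i = of_real (w i) * P i i"
  proof -
    have "(P \<star> diag_fmat k w) i i = (\<Sum>l<k. if i = l then P i i * of_real (w i) else 0)"
      unfolding fmult_def by (rule sum.cong) (auto simp: diag_fmat_def)
    then show ?thesis using assms by (simp add: mult.commute)
  qed
  have dgX: "(diag_fmat k w \<star> X) l j = of_real (w l) * X l j" if "l < k" for X :: "'e fmat" and l j
  proof -
    have "(diag_fmat k w \<star> X) l j = (\<Sum>m<k. if l = m then of_real (w l) * X l j else 0)"
      unfolding fmult_def by (rule sum.cong) (auto simp: diag_fmat_def)
    then show ?thesis using that by simp
  qed
  have 2: "(P \<star> (diag_fmat k w \<star> P)) i i = of_real (\<Sum>j<k. n2 i j * w j)"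
  proof -
    have "(P \<star> (diag_fmat k w \<star> P)) i i = (\<Sum>l<k. P i l * (of_real (w l) * P l i))"
      unfolding fmult_def[of k P] by (rule sum.cong[OF refl]) (simp add: dgX)
    also have "\<dots> = (\<Sum>l<k. of_real (n2 i l * w l))"
      by (rule sum.cong[OF refl]) (simp add: P_mult_swap[symmetric] mult_ac)
    finally show ?thesis by simp
  qed
  have "CC w i i = 2 * (of_real (w i) * P i i - of_real (\<Sum>j<k. n2 i j * w j))"
    by (simp add: CC_def PiV_expand E 1 2 dgX assms)
  also have "\<dots> = 2 * (of_real (w i) * of_real (\<Sum>j<k. n2 i j) - of_real (\<Sum>j<k. n2 i j * w j))"
    by (simp add: sum_n2[symmetric])
  also have "\<dots> = of_real (2 * (w i * (\<Sum>j<k. n2 i j) - (\<Sum>j<k. n2 i j * w j)))"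
    by simp
  also have "w i * (\<Sum>j<k. n2 i j) - (\<Sum>j<k. n2 i j * w j) = (\<Sum>j<k. n2 i j * (w i - w j))"
    by (simp add: sum_distrib_left sum_subtractf algebra_simps)
  finally show ?thesis .
qed

text \<open>
  The diagonal of \<^term>\<open>CC w\<close> is the graph Laplacian of \<open>w\<close> with edge weights \<open>2 \<bar>P\<^sub>i\<^sub>j\<bar>\<^sup>2\<close>; the sum over
  the class is added to make it invertible.
\<close>

definition laplace :: "nat \<Rightarrow> nat \<Rightarrow> real" where
  "laplace i j = (if i = j then 2 * (\<Sum>l<k. n2 i l) else 0) - 2 * n2 i j + (if r i j then 1 else 0)"

definition block_sum :: "(nat \<Rightarrow> real) \<Rightarrow> nat \<Rightarrow> real" where
  "block_sum v i = (\<Sum>j<k. if r i j then v j else 0)"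

definition block_size :: "nat \<Rightarrow> real" where "block_size i = block_sum (\<lambda>_. 1) i"

lemma block_sum_cong: "(\<And>j. j < k \<Longrightarrow> v j = w j) \<Longrightarrow> block_sum v i = block_sum w i"
  unfolding block_sum_def by (rule sum.cong) auto

lemma block_sum_r: "r i j \<Longrightarrow> block_sum v i = block_sum v j"
  unfolding block_sum_def by (rule sum.cong) (use r_sym r_trans in \<open>auto dest: sympD transpD\<close>)

lemma block_sum_add: "block_sum (\<lambda>i. v i + w i) c = block_sum v c + block_sum w c"
  unfolding block_sum_def sum.distrib[symmetric] by (rule sum.cong) auto

lemma block_sum_const: assumes "\<And>j. j < k \<Longrightarrow> r i j \<Longrightarrow> v j = c" shows "block_sum v i = block_size i * c"
  unfolding block_size_def block_sum_def sum_distrib_right by (rule sum.cong) (auto simp: assms)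

lemma block_size_pos: "i < k \<Longrightarrow> block_size i > 0"
proof -
  assume i: "i < k"
  have "(if r i i then 1 else 0) \<le> block_size i"
    unfolding block_size_def block_sum_def
    by (rule member_le_sum[where f = "\<lambda>j. if r i j then 1 else 0"]) (use i in auto)
  then show ?thesis using reflpD[OF r_refl, of i] by simp
qed

lemma laplace_mult:
  assumes "i < k"
  shows "(\<Sum>j<k. laplace i j * x j) = 2 * (\<Sum>j<k. n2 i j * (x i - x j)) + block_sum x i"
proof -
  have "(\<Sum>j<k. laplace i j * x j) = (\<Sum>j<k. (if i = j then 2 * (\<Sum>l<k. n2 i l) * x i else 0)
      - 2 * (n2 i j * x j) + (if r i j then x j else 0))"
    by (rule sum.cong) (auto simp: laplace_def algebra_simps)
  also have "\<dots> = 2 * ((\<Sum>l<k. n2 i l) * x i) - 2 * (\<Sum>j<k. n2 i j * x j) + block_sum x i"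
    using assms by (simp add: sum.distrib sum_subtractf block_sum_def sum_distrib_left)
  also have "(\<Sum>l<k. n2 i l) * x i = (\<Sum>j<k. n2 i j * x i)" by (simp add: sum_distrib_right)
  finally show ?thesis by (simp add: right_diff_distrib sum_subtractf)
qed

text \<open>The weights are symmetric and vanish between classes, so exchanging the two indices
  changes the sign of the summand.\<close>

lemma block_sum_laplace: "block_sum (\<lambda>i. 2 * (\<Sum>j<k. n2 i j * (x i - x j))) c = 0"
proof -
  let ?f = "\<lambda>i j. if r c i then 2 * (n2 i j * (x i - x j)) else 0"
  have "?f i j = - ?f j i" for i j
  proof (cases "n2 i j = 0")
    case True
    then show ?thesis using n2_sym[of i j] by simp
  next
    case False
    then have "r c i = r c j" using n2_r[OF False] r_sym r_trans by (auto dest: sympD transpD)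
    then show ?thesis using n2_sym[of i j] by (simp add: algebra_simps)
  qed
  then have "(\<Sum>i<k. \<Sum>j<k. ?f i j) = 0" by (rule sum_antisym_zero)
  moreover have "block_sum (\<lambda>i. 2 * (\<Sum>j<k. n2 i j * (x i - x j))) c = (\<Sum>i<k. \<Sum>j<k. ?f i j)"
    unfolding block_sum_def by (rule sum.cong) (auto simp: sum_distrib_left)
  ultimately show ?thesis by simp
qed

lemma block_sum_laplace_mult:
  assumes "c < k" shows "block_sum (\<lambda>i. \<Sum>j<k. laplace i j * x j) c = block_size c * block_sum x c"
proof -
  have "block_sum (\<lambda>i. \<Sum>j<k. laplace i j * x j) c = block_sum (\<lambda>i. 2 * (\<Sum>j<k. n2 i j * (x i - x j)) + block_sum x i) c"
    by (rule block_sum_cong) (rule laplace_mult)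
  also have "\<dots> = block_sum (\<lambda>i. 2 * (\<Sum>j<k. n2 i j * (x i - x j))) c + block_sum (block_sum x) c"
    by (rule block_sum_add)
  also have "block_sum (block_sum x) c = block_size c * block_sum x c"
  proof (rule block_sum_const)
    show "block_sum x j = block_sum x c" if "r c j" for j
      using block_sum_r[OF that] by simp
  qed
  finally show ?thesis by (simp add: block_sum_laplace)
qed

text \<open>Summing over a class removes the Laplacian and leaves
  \<open>block_size c * block_sum x c = 0\<close>; so the class sums of \<open>x\<close> vanish and
  the Laplacian alone annihilates \<open>x\<close>. Then the Dirichlet energy, the weighted sum of
  the squares of \<open>x i - x j\<close>, is zero and \<open>x\<close> is constant along the edges
  of \<open>P\<close>. Connectivity makes it constant on each class, with class sum zero.\<close>

lemma laplace_inj: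
  assumes 0: "\<And>i. i < k \<Longrightarrow> (\<Sum>j<k. laplace i j * x j) = 0" and i: "i < k"
  shows "x i = 0"
proof -
  have b0: "block_sum x c = 0" if "c < k" for c
  proof -
    have "block_size c * block_sum x c = block_sum (\<lambda>_. 0) c"
      unfolding block_sum_laplace_mult[OF that, symmetric] by (rule block_sum_cong) (rule 0)
    then show ?thesis using block_size_pos[OF that] by (simp add: block_sum_def)
  qed
  have g0: "(\<Sum>j<k. n2 i j * (x i - x j)) = 0" if "i < k" for i
    using 0[OF that] laplace_mult[OF that, of x] b0[OF that] by simp
  have "(\<Sum>i<k. \<Sum>j<k. n2 i j * (x i - x j)\<^sup>2)
      = 2 * (\<Sum>i<k. x i * (\<Sum>j<k. n2 i j * (x i - x j)))
        + (\<Sum>i<k. \<Sum>j<k. - n2 i j * (x i * x i) + n2 i j * (x j * x j))"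
    unfolding sum_distrib_left sum.distrib[symmetric]
    by (rule sum.cong[OF refl], rule sum.cong[OF refl]) (simp add: power2_eq_square algebra_simps)
  also have "(\<Sum>i<k. \<Sum>j<k. - n2 i j * (x i * x i) + n2 i j * (x j * x j)) = 0"
  proof (rule sum_antisym_zero)
    show "- n2 i j * (x i * x i) + n2 i j * (x j * x j)
        = - (- n2 j i * (x j * x j) + n2 j i * (x i * x i))" for i j
      using n2_sym[of i j] by simp
  qed
  also have "(\<Sum>i<k. x i * (\<Sum>j<k. n2 i j * (x i - x j))) = 0"
    by (rule sum.neutral) (simp add: g0)
  finally have z: "(\<Sum>i<k. \<Sum>j<k. n2 i j * (x i - x j)\<^sup>2) = 0" by simp
  have nz: "n2 i j * (x i - x j)\<^sup>2 = 0" if "i < k" "j < k" for i j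
  proof -
    have "(\<Sum>j<k. n2 i j * (x i - x j)\<^sup>2) = 0"
      using z that by (subst (asm) sum_nonneg_eq_0_iff) (auto intro!: sum_nonneg simp: n2_def)
    then show ?thesis
      using that by (subst (asm) sum_nonneg_eq_0_iff) (auto simp: n2_def)
  qed
  have step: "x i = x j" if "i < k" "j < k" "P i j \<noteq> 0" for i j
    using nz[OF that(1,2)] that(3) by (simp add: n2_def)
  have xc: "x j = x i" if "j < k" "r i j" for j
  proof -
    have "\<forall>i<k. \<forall>j<k. P i j \<noteq> 0 \<longrightarrow> x i = x j" using step by simp
    from conn[OF this i that] show ?thesis by simp
  qed
  have "block_sum x i = block_size i * x i" by (rule block_sum_const) (rule xc)
  then show ?thesis using b0[OF i] block_size_pos[OF i] by simp
qed

definition inv_laplace :: "nat \<Rightarrow> nat \<Rightarrow> real" where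
  "inv_laplace = (SOME a. \<forall>i<k. \<forall>l<k. (\<Sum>j<k. laplace i j * a j l) = (if i = l then 1 else 0))"

lemma laplace_inv_laplace: "i < k \<Longrightarrow> l < k \<Longrightarrow> (\<Sum>j<k. laplace i j * inv_laplace j l) = (if i = l then 1 else 0)"
proof -
  have "\<exists>a. \<forall>i<k. \<forall>l<k. (\<Sum>j<k. laplace i j * a j l) = (if i = l then 1 else 0)"
  proof (rule inverse_matrix_on[of "{..<k}" laplace], goal_cases)
    case (2 x i)
    show ?case by (rule laplace_inj[of x i]) (use 2 in \<open>simp_all add: lessThan_iff\<close>)
  next
    case (3 a)
    then show ?case by (intro exI[of _ a]) simp
  qed simp
  from someI_ex[OF this, folded inv_laplace_def]
  show "i < k \<Longrightarrow> l < k \<Longrightarrow> (\<Sum>j<k. laplace i j * inv_laplace j l) = (if i = l then 1 else 0)" by blast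
qed

text \<open>A linear right inverse, within \<open>V\<close>, to taking the diagonal: exact on
  vectors with vanishing class sums, and in general correct up to the class average.\<close>

definition diag_lift :: "(nat \<Rightarrow> real) \<Rightarrow> 'e fmat" where
  "diag_lift v = CC (\<lambda>i. \<Sum>j<k. inv_laplace i j * v j)"

lemma diag_lift_diag: assumes i: "i < k" shows "diag_lift v i i = of_real (v i - block_sum v i / block_size i)"
proof -
  define u where "u i = (\<Sum>j<k. inv_laplace i j * v j)" for i
  have lu: "(\<Sum>j<k. laplace i j * u j) = v i" if "i < k" for i
    unfolding u_def sum_mult_assoc_on using that by (intro sum_kronecker) (auto simp: laplace_inv_laplace)
  have "block_sum v i = block_size i * block_sum u i"
    unfolding block_sum_laplace_mult[OF i, symmetric] by (rule block_sum_cong) (simp add: lu)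
  then have "block_sum u i = block_sum v i / block_size i" using block_size_pos[OF i] by simp
  moreover have "2 * (\<Sum>j<k. n2 i j * (u i - u j)) = v i - block_sum u i"
    using laplace_mult[OF i, of u] lu[OF i] by simp
  ultimately show ?thesis unfolding diag_lift_def u_def[symmetric] by (simp only: CC_diag[OF i])
qed

lemma V_diag_lift: "V (diag_lift v)" unfolding diag_lift_def by (rule V_CC)

lemma diag_lift_cong: "(\<And>i. i < k \<Longrightarrow> v i = w i) \<Longrightarrow> diag_lift v = diag_lift w"
  unfolding diag_lift_def by (intro arg_cong[where f = CC] ext sum.cong) auto

definition re_diag :: "'e fmat \<Rightarrow> nat \<Rightarrow> real" where "re_diag X i = inner (X i i) 1"

lemma herm_diag: assumes "adj H = H" shows "H i i = of_real (re_diag H i)"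
proof -
  have "conjugate (H i i) = H i i"
    using fun_cong[OF fun_cong[OF assms], of i i] by (simp add: adj_def)
  then show ?thesis unfolding re_diag_def by (rule self_conjugate_eq)
qed

text \<open>The indicator matrix \<open>A\<close> of a class commutes with \<open>P\<close>.
  Cyclicity of the trace therefore inserts a second \<open>P\<close> and reduces both trace
  \<open>(A P H)\<close> and trace \<open>(A H P)\<close> to the corner \<open>P H P = 0\<close>.
  This is the only obstruction to prescribing the diagonal within \<open>V\<close>.\<close>

lemma V_block_sum: assumes "V H" shows "block_sum (re_diag H) i = 0"
proof -
  define A :: "'e fmat" where "A = diag_fmat k (\<lambda>j. if r i j then 1 else 0)"
  have AX: "(A \<star> X) a b = (if a < k \<and> r i a then X a b else 0)" for X :: "'e fmat" and a b
  proof -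
    have "(A \<star> X) a b = (\<Sum>m<k. if a = m then (if r i a then X a b else 0) else 0)"
      unfolding fmult_def A_def by (rule sum.cong) (auto simp: diag_fmat_def)
    then show ?thesis by auto
  qed
  have XA: "(X \<star> A) a b = (if b < k \<and> r i b then X a b else 0)" for X :: "'e fmat" and a b
  proof -
    have "(X \<star> A) a b = (\<Sum>m<k. if b = m then (if r i b then X a b else 0) else 0)"
      unfolding fmult_def A_def by (rule sum.cong) (auto simp: diag_fmat_def)
    then show ?thesis by auto
  qed
  have "(A \<star> P) a b = (P \<star> A) a b" for a b
  proof (cases "P a b = 0")
    case False
    then have "a < k" "b < k" "r a b" using P_blockwise by (auto simp: blockwise_def)
    then show ?thesis using r_sym r_trans by (auto simp: AX XA dest: sympD transpD)
  qed (simp add: AX XA)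
  then have comm: "A \<star> P = P \<star> A" by (intro ext)
  have H: "P \<star> H + H \<star> P = H" using assms by (simp add: V_def)
  have t1: "(\<Sum>j<k. (A \<star> (P \<star> H)) j j) = 0"
  proof -
    have "A \<star> (P \<star> H) = A \<star> P \<star> (P \<star> H)" by (simp add: fmult_assoc)
    also have "\<dots> = P \<star> (A \<star> (P \<star> H))" by (simp only: comm) (simp add: fmult_assoc)
    finally have "(\<Sum>j<k. (A \<star> (P \<star> H)) j j) = (\<Sum>j<k. (P \<star> (A \<star> (P \<star> H))) j j)"
      by (rule arg_cong[where f = "\<lambda>X. \<Sum>j<k. X j j"])
    also have "(\<Sum>j<k. (P \<star> (A \<star> (P \<star> H))) j j) = (\<Sum>j<k. (A \<star> (P \<star> H) \<star> P) j j)"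
      by (rule trace_fmult)
    also have "A \<star> (P \<star> H) \<star> P = 0" using V_PHP[OF assms] by (simp add: fmult_assoc)
    finally show ?thesis by simp
  qed
  have t2: "(\<Sum>j<k. (A \<star> (H \<star> P)) j j) = 0"
  proof -
    have "(\<Sum>j<k. (A \<star> H \<star> P) j j) = (\<Sum>j<k. (P \<star> (A \<star> H)) j j)" by (rule trace_fmult)
    also have "P \<star> (A \<star> H) = A \<star> (P \<star> H)" by (simp only: fmult_assoc[symmetric] comm)
    finally show ?thesis using t1 by (simp add: fmult_assoc)
  qed
  have "(\<Sum>j<k. (A \<star> H) j j) = (\<Sum>j<k. (A \<star> (P \<star> H + H \<star> P)) j j)" by (simp only: H)
  also have "\<dots> = 0" using t1 t2 by (simp add: fmult_add_right sum.distrib)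
  finally have "(\<Sum>j<k. (A \<star> H) j j) = 0" .
  then have "inner (\<Sum>j<k. (A \<star> H) j j) 1 = 0" by simp
  moreover have "inner (\<Sum>j<k. (A \<star> H) j j) 1 = block_sum (re_diag H) i"
    unfolding inner_sum_left block_sum_def by (rule sum.cong) (auto simp: AX re_diag_def)
  ultimately show ?thesis by simp
qed

section \<open>The quadratic chart\<close>

text \<open>On the diagonal \<open>X = Y\<close>, with \<open>Y\<close> Hermitian and blockwise,
  this is the correction \<open>P Y\<^sup>2 P - Q Y\<^sup>2 Q\<close>. The bilinear version is kept
  because the coordinates need the coefficients of the form.\<close>

definition WW :: "'e fmat \<Rightarrow> 'e fmat \<Rightarrow> 'e fmat" where
  "WW X Y = P \<star> (herm_block X \<star> (herm_block Y \<star> P)) - Q \<star> (herm_block X \<star> (herm_block Y \<star> Q))"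

text \<open>At a point of the set, \<open>Y\<close> has zero diagonal and \<open>Y + WW Y Y\<close>
  lies in \<open>V\<close>, so its diagonal is that of \<open>WW Y Y\<close>. Subtracting the lift
  of this diagonal lands in the linear space of elements of \<open>V\<close> with zero
  diagonal.\<close>

definition phi :: "'e fmat \<Rightarrow> 'e fmat" where
  "phi Y = Y + (WW Y Y - diag_lift (re_diag (WW Y Y)))"

definition K :: "'e fmat \<Rightarrow> bool" where "K H \<longleftrightarrow> V H \<and> (\<forall>i<k. H i i = 0)"

definition PiK :: "'e fmat \<Rightarrow> 'e fmat" where "PiK X = PiV X - diag_lift (re_diag (PiV X))"

lemma K_PiK: "K (PiK X)"
  unfolding K_def PiK_def
proof (intro conjI allI impI V_diff V_PiV V_diag_lift)
  fix i assume i: "i < k"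
  have "PiV X i i = of_real (re_diag (PiV X) i)"
    using V_PiV[of X] by (intro herm_diag) (simp add: V_def)
  then show "(PiV X - diag_lift (re_diag (PiV X))) i i = 0"
    using V_block_sum[OF V_PiV[of X], of i] by (simp add: diag_lift_diag[OF i])
qed

lemma CC_zero: "CC (\<lambda>_. 0) = 0"
proof -
  have "diag_fmat k (\<lambda>_. 0) = (0 :: 'e fmat)" by (auto simp: diag_fmat_def fun_eq_iff)
  moreover have "herm_block 0 = (0 :: 'e fmat)" by (auto simp: herm_block_def fun_eq_iff)
  ultimately show ?thesis by (simp add: CC_def PiV_def)
qed

lemma PiK_id: assumes "K H" shows "PiK H = H"
proof -
  have "PiV H = H" using assms by (intro PiV_id) (simp add: K_def)
  moreover have "diag_lift (re_diag H) = diag_lift (\<lambda>_. 0)"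
    using assms by (intro diag_lift_cong) (simp add: K_def re_diag_def)
  moreover have "diag_lift (\<lambda>_. 0) = 0" by (simp add: diag_lift_def CC_zero)
  ultimately show ?thesis by (simp add: PiK_def)
qed

lemma K_iff: "K H \<longleftrightarrow> PiK H = H"
  using K_PiK[of H] PiK_id[of H] by auto

lemma goodD:
  assumes "good k r s X"
  shows "blockwise k r X" "adj X = X" "X \<star> X = X" "i < k \<Longrightarrow> X i i = of_real s"
  using assms by (auto simp: good_def)

lemma WW_blockwise: "blockwise k r (WW X Y)"
  by (simp add: WW_def blockwise_simps herm_block_blockwise)

lemma WW_adj: "adj (WW Y Y) = WW Y Y"
  by (simp add: WW_def adj_diff adj_fmult fmult_assoc)

text \<open>Idempotency gives \<open>Y\<^sup>2 = Y - P Y - Y P\<close>, hence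
  \<open>P Y\<^sup>2 P = - P Y P\<close> and \<open>Q Y\<^sup>2 Q = Q Y Q\<close>. So
  \<open>Y + WW Y Y\<close> is the off-diagonal part \<open>PiV Y\<close>, and in fact
  \<open>phi Y = PiK Y\<close>.\<close>

lemma K_phi:
  assumes g: "good k r s (P + Y)"
  shows "K (phi Y)"
proof -
  have Y: "Y = (P + Y) - P" by simp
  have Yb: "blockwise k r Y" by (subst Y) (intro blockwise_diff goodD[OF g] P_blockwise)
  have Ya: "adj Y = Y" by (subst (1 2) Y) (simp only: adj_diff goodD(2)[OF g] P_adj)
  have E: "herm_block Y = Y" by (rule herm_block_id[OF Yb Ya])
  have Ys: "supp k Y" by (rule blockwise_supp[OF Yb])
  have "(P + Y) \<star> (P + Y) = P + Y" by (rule goodD[OF g])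
  then have e: "Y \<star> Y = Y - P \<star> Y - Y \<star> P"
    by (simp add: fmult_add_left fmult_add_right) (simp add: algebra_simps)
  have eX: "Y \<star> (Y \<star> X) = Y \<star> X - P \<star> (Y \<star> X) - Y \<star> (P \<star> X)" for X :: "'e fmat"
    unfolding fmult_assoc[symmetric] e fmult_diff_left ..
  have 1: "P \<star> (Y \<star> (Y \<star> P)) = - (P \<star> (Y \<star> P))"
    unfolding eX fmult_simps PPX PP by simp
  have 2: "Q \<star> (Y \<star> (Y \<star> Q)) = Y - P \<star> Y - Y \<star> P + P \<star> (Y \<star> P)"
  proof -
    have PQ: "P \<star> Q = 0" using XQ[OF P_supp] by simp
    have QP: "Q \<star> P = 0" using QX[OF P_supp] by simp
    have QPX: "Q \<star> (P \<star> X) = 0" for X :: "'e fmat"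
      unfolding fmult_assoc[symmetric] QP by simp
    have "Q \<star> (Y \<star> (Y \<star> Q)) = Q \<star> (Y \<star> Q)"
      unfolding eX fmult_simps PQ QPX by simp
    also have "\<dots> = Y - P \<star> Y - Y \<star> P + P \<star> (Y \<star> P)"
      by (simp add: QX XQ supp_diff supp_fmult Ys P_supp fmult_simps)
    finally show ?thesis .
  qed
  have W: "WW Y Y = PiV Y - Y"
    unfolding WW_def E 1 2 PiV_expand by (simp add: algebra_simps)
  have rdW: "re_diag (WW Y Y) i = re_diag (PiV Y) i" if "i < k" for i
  proof -
    have "Y i i = 0" using goodD(4)[OF g that] P_diag[OF that] by simp
    then show ?thesis by (simp add: W re_diag_def)
  qed
  have "phi Y = PiV Y - diag_lift (re_diag (PiV Y))"
  proof -
    have c: "diag_lift (re_diag (WW Y Y)) = diag_lift (re_diag (PiV Y))" by (rule diag_lift_cong[OF rdW])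
    show ?thesis unfolding phi_def c unfolding W by simp
  qed
  then show ?thesis using K_PiK[of Y] by (simp add: PiK_def)
qed

lemma QRQ_split:
  assumes "supp k R" "P \<star> (R \<star> P) = 0" "Q \<star> (R \<star> Q) = 0"
  shows "P \<star> R = P \<star> (R \<star> Q)" "R \<star> Q = P \<star> (R \<star> Q)" "R = P \<star> (R \<star> Q) + Q \<star> (R \<star> P)"
proof -
  have 1: "R \<star> Q = R - R \<star> P" by (rule XQ[OF assms(1)])
  show 2: "P \<star> R = P \<star> (R \<star> Q)" using assms(2) by (simp add: 1 fmult_diff_right)
  have "supp k (R \<star> Q)" by (intro supp_fmult assms blockwise_supp[OF Q_blockwise])
  from QX[OF this] assms(3) show 3: "R \<star> Q = P \<star> (R \<star> Q)" by simp
  have "supp k (R \<star> P)" by (intro supp_fmult assms P_supp)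
  from QX[OF this] assms(2) have "Q \<star> (R \<star> P) = R \<star> P" by simp
  with 3 have "P \<star> (R \<star> Q) + Q \<star> (R \<star> P) = R \<star> Q + R \<star> P" by simp
  also have "\<dots> = R" by (simp add: 1)
  finally show "R = P \<star> (R \<star> Q) + Q \<star> (R \<star> P)" by simp
qed

text \<open>
  The defect \<open>R = (P + Y)\<^sup>2 - (P + Y)\<close> commutes with \<open>P + Y\<close> and is off-diagonal. Hence its corner
  \<open>Z = P R Q\<close> satisfies \<open>Z = Z Y Q - P Y Z\<close>, which forces \<open>Z = 0\<close> for small \<open>Y\<close>.
\<close>

lemma good_if_K_phi:
  assumes Y: "supp k Y" and K: "K (phi Y)"
    and small: "norm1 k Y * (norm1 k P + norm1 k Q) \<le> 1 / 2" "norm1 k Y < 1"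
    and nz: "\<And>i j. i < k \<Longrightarrow> j < k \<Longrightarrow> P i j \<noteq> 0 \<Longrightarrow> norm (Y i j) < norm (P i j)"
  shows "good k r s (P + Y)"
proof -
  \<comment> \<open>Undoing the diagonal correction gives \<open>Y = H - WW Y Y\<close> with
    \<open>H\<close> in \<open>V\<close>. Both terms are Hermitian and blockwise by construction,
    hence so is \<open>Y\<close>, of which only the support was known.\<close>
  define H where "H = phi Y + diag_lift (re_diag (WW Y Y))"
  have VH: "V H" unfolding H_def using K by (intro V_add V_diag_lift) (simp add: K_def)
  have YW: "Y = H - WW Y Y" by (simp add: H_def phi_def)
  have Yb: "blockwise k r Y" by (subst YW) (use VH in \<open>auto simp: V_def intro: blockwise_diff WW_blockwise\<close>)
  have Ya: "adj Y = Y"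
  proof -
    have "adj (H - WW Y Y) = H - WW Y Y" using VH by (simp add: adj_diff WW_adj V_def)
    with YW show ?thesis by metis
  qed
  have E: "herm_block Y = Y" by (rule herm_block_id[OF Yb Ya])
  have PQ: "P \<star> Q = 0" using XQ[OF P_supp] by simp
  have QP: "Q \<star> P = 0" using QX[OF P_supp] by simp
  have Qs: "supp k Q" by (rule blockwise_supp[OF Q_blockwise])
  have QQ: "Q \<star> Q = Q" using QX[OF Qs] PQ by simp
  have QPX: "Q \<star> (P \<star> X) = 0" and PQX: "P \<star> (Q \<star> X) = 0" and QQX: "Q \<star> (Q \<star> X) = Q \<star> X" for X :: "'e fmat"
    unfolding fmult_assoc[symmetric] QP PQ QQ by simp_all
  define R where "R = Y \<star> Y + P \<star> Y + Y \<star> P - Y"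
  have Rs: "supp k R" unfolding R_def by (intro supp_diff supp_add supp_fmult Y P_supp)
  have PHP: "P \<star> (H \<star> P) = 0" by (rule V_PHP[OF VH])
  have QHQ: "Q \<star> (H \<star> Q) = 0"
  proof -
    have Hs: "supp k H" and e: "P \<star> H + H \<star> P = H" using VH by (auto simp: V_def intro: blockwise_supp)
    have "H \<star> Q = H - H \<star> P" by (rule XQ[OF Hs])
    also have "\<dots> = P \<star> H" using e by (metis add_diff_cancel_right')
    finally show ?thesis by (simp add: QPX)
  qed
  have PYP: "P \<star> (Y \<star> P) = - (P \<star> (Y \<star> (Y \<star> P)))"
  proof -
    have "P \<star> (Y \<star> P) = P \<star> ((H - WW Y Y) \<star> P)" using YW by simp
    then show ?thesis
      unfolding WW_def E fmult_simps PHP PPX PP QPX QP PQX by simp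
  qed
  have QYQ: "Q \<star> (Y \<star> Q) = Q \<star> (Y \<star> (Y \<star> Q))"
  proof -
    have "Q \<star> (Y \<star> Q) = Q \<star> ((H - WW Y Y) \<star> Q)" using YW by simp
    then show ?thesis
      unfolding WW_def E fmult_simps QHQ QQX QQ QPX PQ by simp
  qed
  have PRP: "P \<star> (R \<star> P) = 0"
    unfolding R_def fmult_simps PPX PP using PYP by simp
  have QRQ: "Q \<star> (R \<star> Q) = 0"
    unfolding R_def fmult_simps QPX PQ using QYQ by simp
  note RR = QRQ_split[OF Rs PRP QRQ]
  define Z where "Z = P \<star> (R \<star> Q)"
  have PPY: "(P + Y) \<star> (P + Y) = P + Y + R"
    by (simp add: R_def fmult_add_left fmult_add_right)
  have comm: "R \<star> (P + Y) = (P + Y) \<star> R"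
  proof -
    have "R = (P + Y) \<star> (P + Y) - (P + Y)" unfolding PPY by simp
    then show ?thesis by (metis fmult_assoc fmult_diff_left fmult_diff_right)
  qed
  \<comment> \<open>The corner \<open>P R (P + Y) Q\<close> is computed twice, as it stands and
    after commuting \<open>R\<close> past \<open>P + Y\<close>.\<close>
  have Zeq: "Z = Z \<star> (Y \<star> Q) - P \<star> (Y \<star> Z)"
  proof -
    have "P \<star> (R \<star> ((P + Y) \<star> Q)) = Z \<star> ((P + Y) \<star> Q)"
      unfolding Z_def RR(1)[symmetric] fmult_assoc ..
    also have "\<dots> = Z \<star> (Y \<star> Q)" by (simp add: fmult_add_left PQ)
    finally have 1: "P \<star> (R \<star> ((P + Y) \<star> Q)) = Z \<star> (Y \<star> Q)" .
    have "P \<star> (R \<star> ((P + Y) \<star> Q)) = P \<star> ((R \<star> (P + Y)) \<star> Q)" by (simp only: fmult_assoc)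
    also have "\<dots> = P \<star> ((P + Y) \<star> (R \<star> Q))" by (simp only: comm fmult_assoc)
    also have "R \<star> Q = Z" unfolding Z_def by (rule RR(2))
    also have "P \<star> ((P + Y) \<star> Z) = Z + P \<star> (Y \<star> Z)"
      by (simp add: fmult_simps Z_def)
    finally have 2: "P \<star> (R \<star> ((P + Y) \<star> Q)) = Z + P \<star> (Y \<star> Z)" .
    have "Z \<star> (Y \<star> Q) = Z + P \<star> (Y \<star> Z)" by (rule HOL.trans[OF 1[symmetric] 2])
    then show ?thesis by (metis add_diff_cancel_right')
  qed
  have "norm1 k Z \<le> norm1 k (Z \<star> (Y \<star> Q)) + norm1 k (P \<star> (Y \<star> Z))"
    using norm1_diff[of k "Z \<star> (Y \<star> Q)" "P \<star> (Y \<star> Z)"] Zeq by simp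
  also have "\<dots> \<le> norm1 k Z * (norm1 k Y * norm1 k Q) + norm1 k P * (norm1 k Y * norm1 k Z)"
    by (intro add_mono order_trans[OF norm1_fmult] mult_left_mono norm1_fmult norm1_nonneg)
  also have "\<dots> = norm1 k Z * (norm1 k Y * (norm1 k P + norm1 k Q))" by (simp add: algebra_simps)
  also have "\<dots> \<le> norm1 k Z * (1 / 2)" by (intro mult_left_mono small norm1_nonneg)
  finally have nZ: "norm1 k Z = 0" using norm1_nonneg[of k Z] by simp
  have "supp k Z" unfolding Z_def by (intro supp_fmult P_supp Rs Qs)
  from norm1_eq_0[OF this nZ] have Z0: "Z = 0" .
  have "adj R = R" by (simp add: R_def adj_add adj_diff adj_fmult Ya add_ac)
  then have "adj Z = Q \<star> (R \<star> P)" by (simp add: Z_def adj_fmult fmult_assoc)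
  moreover have "adj (0 :: 'e fmat) = 0" by (simp add: adj_def fun_eq_iff)
  ultimately have R0: "R = 0" using RR(3) Z0 unfolding Z_def by simp
  have idem: "(P + Y) \<star> (P + Y) = P + Y" using PPY R0 by simp
  have PYb: "blockwise k r (P + Y)" by (rule blockwise_add[OF P_blockwise Yb])
  have Yd: "Y i i = of_real (re_diag Y i)" for i by (rule herm_diag[OF Ya])
  \<comment> \<open>Over each class the traces of \<open>P + Y\<close> and of \<open>P\<close> are
    natural numbers, and they differ by less than 1 because \<open>norm1 k Y < 1\<close>.\<close>
  have bsY: "block_sum (re_diag Y) i = 0" for i
  proof -
    have blk: "\<exists>m :: nat. (\<Sum>j<k. if r i j then X j j else 0) = of_nat m"
      if X: "blockwise k r X" "X \<star> X = X" for X :: "'e fmat"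
    proof (rule commuting_trace_nat[OF X(2), of "{j. r i j}"])
      fix a b assume "X a b \<noteq> 0"
      then have "r a b" using X(1) by (auto simp: blockwise_def)
      then show "a \<in> {j. r i j} \<longleftrightarrow> b \<in> {j. r i j}"
        using r_sym r_trans by (auto dest: sympD transpD)
    qed auto
    obtain m m' :: nat where m: "(\<Sum>j<k. if r i j then P j j else 0) = of_nat m"
      "(\<Sum>j<k. if r i j then (P + Y) j j else 0) = of_nat m'"
      using blk[OF P_blockwise PP] blk[OF PYb idem] by blast
    have "(\<Sum>j<k. if r i j then Y j j else 0)
        = (\<Sum>j<k. if r i j then (P + Y) j j else 0) - (\<Sum>j<k. if r i j then P j j else 0)"
      unfolding sum_subtractf[symmetric] by (rule sum.cong) auto
    then have eq: "(\<Sum>j<k. if r i j then Y j j else 0) = of_int (int m' - int m)"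
      by (simp add: m)
    have "norm (\<Sum>j<k. if r i j then Y j j else 0) \<le> (\<Sum>j<k. norm (Y j j))"
      by (intro order_trans[OF norm_sum] sum_mono) simp
    also have "\<dots> \<le> norm1 k Y"
      unfolding norm1_def by (intro sum_mono member_le_sum[where f = "\<lambda>l. norm (Y _ l)"]) auto
    also have "\<dots> < 1" by (rule small)
    finally have "\<bar>int m' - int m\<bar> < 1"
      unfolding eq norm_of_int by linarith
    then have "(\<Sum>j<k. if r i j then Y j j else 0) = 0" using eq by simp
    moreover have "(\<Sum>j<k. if r i j then Y j j else 0) = of_real (block_sum (re_diag Y) i)"
      unfolding block_sum_def of_real_sum by (rule sum.cong) (auto simp: Yd)
    ultimately show ?thesis by simp
  qed
  \<comment> \<open>The class sums of \<open>re_diag (WW Y Y)\<close> vanish, since those of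
    \<open>H\<close> and \<open>Y\<close> do. The lift then reproduces the diagonal of
    \<open>WW Y Y\<close> exactly, so \<open>Y\<close> and \<open>phi Y\<close> have the same
    diagonal, namely zero.\<close>
  have diag: "Y i i = 0" if i: "i < k" for i
  proof -
    have rdW: "re_diag (WW Y Y) j = re_diag H j - re_diag Y j" for j
      using YW by (simp add: re_diag_def H_def phi_def inner_add_left inner_diff_left)
    have "block_sum (re_diag (WW Y Y)) i = block_sum (re_diag H) i - block_sum (re_diag Y) i"
      unfolding block_sum_def sum_subtractf[symmetric] by (rule sum.cong) (auto simp: rdW)
    then have "block_sum (re_diag (WW Y Y)) i = 0" by (simp add: bsY V_block_sum[OF VH])
    then have "diag_lift (re_diag (WW Y Y)) i i = of_real (re_diag (WW Y Y) i)" by (simp add: diag_lift_diag[OF i])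
    moreover have "WW Y Y i i = of_real (re_diag (WW Y Y) i)" by (rule herm_diag[OF WW_adj])
    moreover have "phi Y i i = 0" using K i by (simp add: K_def)
    ultimately show ?thesis by (simp add: phi_def)
  qed
  show ?thesis
    unfolding good_def
  proof (intro conjI PYb idem allI impI)
    show "adj (P + Y) = P + Y" by (simp add: adj_add Ya)
    show "(P + Y) i i = of_real s" if "i < k" for i using that by (simp add: diag P_diag)
    fix w :: "nat \<Rightarrow> real" and i j
    assume w: "\<forall>i<k. \<forall>j<k. (P + Y) i j \<noteq> 0 \<longrightarrow> w i = w j" and ij: "i < k" "j < k" "r i j"
    \<comment> \<open>Nonzero entries of \<open>P\<close> stay nonzero in \<open>P + Y\<close>, so
      the graph of \<open>P + Y\<close> contains that of \<open>P\<close> and inherits its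
      connectivity.\<close>
    have "\<forall>i<k. \<forall>j<k. P i j \<noteq> 0 \<longrightarrow> w i = w j"
    proof (intro allI impI)
      fix i j assume *: "i < k" "j < k" "P i j \<noteq> 0"
      have "P i j + Y i j \<noteq> 0"
        using nz[OF *] by (metis add_eq_0_iff norm_minus_cancel less_irrefl)
      then show "w i = w j" using w * by simp
    qed
    from conn[OF this ij] show "w i = w j" .
  qed
qed

theorem good_iff_K_phi:
  obtains \<epsilon> where "\<epsilon> > 0"
    "\<And>Y. supp k Y \<Longrightarrow> (\<And>i j. i < k \<Longrightarrow> j < k \<Longrightarrow> norm (Y i j) < \<epsilon>) \<Longrightarrow> good k r s (P + Y) \<longleftrightarrow> K (phi Y)"
proof -
  \<comment> \<open>The value 1 at vanishing entries is a placeholder that leaves a positive lower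
    bound over all index pairs.\<close>
  define f where "f p = (if P (fst p) (snd p) = 0 then 1 else norm (P (fst p) (snd p)))" for p
  have "\<exists>e>0. \<forall>p\<in>{..<k} \<times> {..<k}. e \<le> f p"
  proof (rule ex_pos_lower_bound[of "{..<k} \<times> {..<k}" f], goal_cases)
    case (3 e)
    then show ?case by blast
  qed (auto simp: f_def)
  then obtain e where e: "e > 0" "\<And>p. p \<in> {..<k} \<times> {..<k} \<Longrightarrow> e \<le> f p"
    by blast
  define c where "c = 1 + norm1 k P + norm1 k Q"
  have c1: "c \<ge> 1" using norm1_nonneg[of k P] norm1_nonneg[of k Q] by (simp add: c_def)
  define N where "N = real k * real k + 1"
  have kk: "N > 0" by (simp add: N_def add_nonneg_pos)
  \<comment> \<open>The bound \<open>e\<close> protects the nonzero entries of \<open>P\<close>. The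
    other bound gives \<open>norm1 k Y \<le> 1 / (2 * c)\<close>, as \<open>N\<close> exceeds the
    number of entries; this is below 1 and settles the contraction for the corner of the
    defect.\<close>
  define \<epsilon> where "\<epsilon> = min e (1 / (2 * c * N))"
  have \<epsilon>0: "\<epsilon> > 0" using e c1 kk by (simp add: \<epsilon>_def)
  show ?thesis
  proof (rule that[OF \<epsilon>0])
    fix Y :: "'e fmat" assume Y: "supp k Y" and sm: "\<And>i j. i < k \<Longrightarrow> j < k \<Longrightarrow> norm (Y i j) < \<epsilon>"
    have "norm1 k Y \<le> (\<Sum>i<k. \<Sum>j<k. \<epsilon>)"
      unfolding norm1_def by (intro sum_mono) (use sm in \<open>auto simp: less_imp_le\<close>)
    also have "\<dots> \<le> N * \<epsilon>" using \<epsilon>0 by (simp add: N_def algebra_simps)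
    also have "\<dots> \<le> N * (1 / (2 * c * N))"
      using kk by (intro mult_left_mono) (auto simp: \<epsilon>_def)
    also have "\<dots> = 1 / (2 * c)" using kk by (simp add: field_simps)
    finally have nY: "norm1 k Y \<le> 1 / (2 * c)" .
    have "norm1 k Y * (norm1 k P + norm1 k Q) \<le> 1 / (2 * c) * c"
      using norm1_nonneg[of k P] norm1_nonneg[of k Q] c1 by (intro mult_mono nY) (auto simp: c_def)
    also have "\<dots> = 1 / 2" using c1 by simp
    finally have s1: "norm1 k Y * (norm1 k P + norm1 k Q) \<le> 1 / 2" .
    have "1 / (2 * c) < 1" using c1 by (simp add: field_simps)
    with nY have s2: "norm1 k Y < 1" by linarith
    have s3: "norm (Y i j) < norm (P i j)" if "i < k" "j < k" "P i j \<noteq> 0" for i j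
      using sm[OF that(1,2)] e(2)[of "(i, j)"] that by (simp add: \<epsilon>_def f_def)
    show "good k r s (P + Y) \<longleftrightarrow> K (phi Y)"
      using K_phi good_if_K_phi[OF Y _ s1 s2 s3] by blast
  qed
qed

end

section \<open>Real coordinates and dimension\<close>

definition unit_at :: "nat \<times> nat \<times> 'e \<Rightarrow> 'e::real_or_complex fmat" where
  "unit_at t = (\<lambda>i j. if i = fst t \<and> j = fst (snd t) then snd (snd t) else 0)"

definition coord_of :: "'e::real_or_complex fmat \<Rightarrow> nat \<times> nat \<times> 'e \<Rightarrow> real" where
  "coord_of X t = inner (X (fst t) (fst (snd t))) (snd (snd t))"

definition of_coords :: "nat \<Rightarrow> (nat \<times> nat \<times> 'e \<Rightarrow> real) \<Rightarrow> 'e::real_or_complex fmat" where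
  "of_coords k x = (\<lambda>i j. if i < k \<and> j < k then \<Sum>b\<in>Basis. x (i, j, b) *\<^sub>R b else 0)"

definition real_linear :: "('e::real_or_complex fmat \<Rightarrow> 'e fmat) \<Rightarrow> bool" where
  "real_linear F \<longleftrightarrow> (\<forall>X Y. F (X + Y) = F X + F Y) \<and> (\<forall>c X. F (scale c X) = scale c (F X))"

lemma finite_mat_idx [simp]: "finite (mat_idx k)"
  by (simp add: mat_idx_def)

lemma sum_mat_idx: "(\<Sum>t\<in>mat_idx k. f t) = (\<Sum>i<k. \<Sum>j<k. \<Sum>b\<in>Basis. f (i, j, b))"
  by (simp add: mat_idx_def sum.cartesian_product case_prod_beta)

lemma sum_apply2: "(\<Sum>t\<in>A. f t) i j = (\<Sum>t\<in>A. f t i j)"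
  for f :: "'a \<Rightarrow> 'e::real_or_complex fmat"
  by (induction A rule: infinite_finite_induct) auto

lemma real_linear_sum:
  assumes "real_linear F"
  shows "F (\<Sum>t\<in>A. scale (g t) (X t)) = (\<Sum>t\<in>A. scale (g t) (F (X t)))"
proof (induction A rule: infinite_finite_induct)
  have sc0: "scale 0 A = 0" for A :: "'a fmat" by (simp add: scale_def fun_eq_iff)
  have "F (scale 0 0) = scale 0 (F 0)" using assms by (simp add: real_linear_def)
  then have F0: "F 0 = 0" by (simp add: sc0)
  show "F (\<Sum>t\<in>{}. scale (g t) (X t)) = (\<Sum>t\<in>{}. scale (g t) (F (X t)))" by (simp add: F0)
  show "F (\<Sum>t\<in>A. scale (g t) (X t)) = (\<Sum>t\<in>A. scale (g t) (F (X t)))" if "infinite A" for A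
    using that by (simp add: F0)
next
  case (insert x A)
  show ?case
    unfolding sum.insert[OF insert.hyps] insert.IH[symmetric] using assms unfolding real_linear_def by metis
qed

lemma expand_unit_at:
  assumes "supp k X" shows "X = (\<Sum>t\<in>mat_idx k. scale (coord_of X t) (unit_at t))"
proof (intro ext)
  fix i j
  have "(\<Sum>t\<in>mat_idx k. scale (coord_of X t) (unit_at t)) i j = (\<Sum>t\<in>mat_idx k. of_real (coord_of X t) * unit_at t i j)"
    unfolding sum_apply2 by (simp add: scale_def)
  also have "\<dots> = (\<Sum>a<k. \<Sum>a'<k. \<Sum>b\<in>Basis. of_real (inner (X a a') b) * (if i = a \<and> j = a' then b else 0))"
    unfolding sum_mat_idx coord_of_def unit_at_def fst_conv snd_conv ..
  also have "\<dots> = (\<Sum>a<k. \<Sum>a'<k. if i = a then if j = a' then \<Sum>b\<in>Basis. inner (X a a') b *\<^sub>R b else 0 else 0)"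
    by (intro sum.cong HOL.refl) (auto simp: scaleR_conv_of_real)
  also have "\<dots> = (\<Sum>a<k. if i = a then \<Sum>a'<k. if j = a' then X a a' else 0 else 0)"
    by (intro sum.cong HOL.refl) (auto simp: euclidean_representation)
  also have "\<dots> = X i j" using assms by (auto simp: supp_def)
  finally show "X i j = (\<Sum>t\<in>mat_idx k. scale (coord_of X t) (unit_at t)) i j" ..
qed

lemma real_linear_expand:
  assumes "real_linear F" "supp k X"
  shows "F X i j = (\<Sum>t\<in>mat_idx k. of_real (coord_of X t) * F (unit_at t) i j)"
proof -
  have "F X = (\<Sum>t\<in>mat_idx k. scale (coord_of X t) (F (unit_at t)))"
    by (subst expand_unit_at[OF assms(2)]) (rule real_linear_sum[OF assms(1)])
  then show ?thesis by (simp add: sum_apply2 scale_def)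
qed

lemma real_linear_expand_inner:
  assumes "real_linear F" "supp k X"
  shows "inner (F X i j) y = (\<Sum>t\<in>mat_idx k. coord_of X t * inner (F (unit_at t) i j) y)"
  unfolding real_linear_expand[OF assms] inner_sum_left by (simp add: inner_of_real_mult)

lemma real_linear_expand_coord_of:
  assumes "real_linear F" "supp k X"
  shows "coord_of (F X) t' = (\<Sum>t\<in>mat_idx k. coord_of (F (unit_at t)) t' * coord_of X t)"
  unfolding coord_of_def[of "F _"] real_linear_expand_inner[OF assms] by (simp add: mult.commute)

lemma supp_of_coords: "supp k (of_coords k x)"
  by (auto simp: supp_def of_coords_def)

lemma coord_of_of_coords: "t \<in> mat_idx k \<Longrightarrow> coord_of (of_coords k x) t = x t"
  by (auto simp: mat_idx_def coord_of_def of_coords_def)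

lemma of_coords_coord_of: assumes "supp k X" shows "of_coords k (coord_of X) = X"
  using assms by (auto simp: fun_eq_iff of_coords_def coord_of_def supp_def euclidean_representation)

lemma of_coords_add: "of_coords k (\<lambda>t. x t + y t) = of_coords k x + of_coords k y"
  by (auto simp: fun_eq_iff of_coords_def sum.distrib scaleR_left_distrib)

lemma of_coords_cong: "(\<And>t. t \<in> mat_idx k \<Longrightarrow> x t = y t) \<Longrightarrow> of_coords k x = of_coords k y"
  by (auto simp: fun_eq_iff of_coords_def mat_idx_def intro!: sum.cong)

lemma eq_iff_coord_of:
  assumes "supp k X" "supp k Y"
  shows "X = Y \<longleftrightarrow> (\<forall>t\<in>mat_idx k. coord_of X t = coord_of Y t)"
  using of_coords_coord_of[OF assms(1)] of_coords_coord_of[OF assms(2)] of_coords_cong[of k "coord_of X" "coord_of Y"] by auto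

lemma norm_of_coords_le:
  fixes e :: real
  assumes "\<And>t. t \<in> mat_idx k \<Longrightarrow> \<bar>x t\<bar> \<le> e" "e \<ge> 0"
  shows "norm (of_coords k x i j :: 'e::real_or_complex) \<le> DIM('e) * e"
proof (cases "i < k \<and> j < k")
  case True
  have "norm (of_coords k x i j) \<le> (\<Sum>b\<in>(Basis :: 'e set). norm (x (i, j, b) *\<^sub>R b))"
    using True norm_sum[of "\<lambda>b. x (i, j, b) *\<^sub>R b" "Basis :: 'e set"] by (simp add: of_coords_def)
  also have "\<dots> \<le> (\<Sum>b\<in>(Basis :: 'e set). e)"
    using True by (intro sum_mono) (auto simp: mat_idx_def intro!: assms)
  finally show ?thesis by simp
qed (use assms in \<open>auto simp: of_coords_def\<close>)

lemma sum_inner_mult_conjugate_Basis: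
  fixes z :: "'e :: real_or_complex"
  shows "(\<forall>x :: 'e. conjugate x = x) \<Longrightarrow> (\<Sum>b\<in>Basis. inner (z * conjugate b) b) = DIM('e) * inner z 1"
proof -
  assume id: "\<forall>x :: 'e. conjugate x = x"
  have "inner (z * conjugate b) b = inner z 1" if "b \<in> Basis" for b
  proof -
    have "inner (z * conjugate b) b = inner (z * (conjugate b * b)) 1"
      using id by (subst inner_eq_inner_one) (simp add: mult.assoc)
    then show ?thesis using that by (simp add: conjugate_mult_self)
  qed
  then show ?thesis by simp
qed

context frame_proj begin

text \<open>The bilinear form with \<open>phi Y = Y + BB Y Y\<close>; its values on the matrices
  \<open>unit_at t\<close> are the coefficients of the chart in coordinates.\<close>

definition BB :: "'e fmat \<Rightarrow> 'e fmat \<Rightarrow> 'e fmat" where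
  "BB X Y = WW X Y - diag_lift (re_diag (WW X Y))"

lemma PiV_add: "PiV (X + Y) = PiV X + PiV Y" and PiV_scale: "PiV (scale c X) = scale c (PiV X)"
  by (simp_all add: PiV_def herm_block_add herm_block_scale fmult_simps fmult_scale scale_add add_ac)

lemma CC_add: "CC (\<lambda>i. v i + w i) = CC v + CC w"
proof -
  have "diag_fmat k (\<lambda>i. v i + w i) = (diag_fmat k v + diag_fmat k w :: 'e fmat)" by (auto simp: diag_fmat_def fun_eq_iff)
  then show ?thesis by (simp add: CC_def PiV_add)
qed

lemma CC_scale: "CC (\<lambda>i. c * v i) = scale c (CC v)"
proof -
  have "diag_fmat k (\<lambda>i. c * v i) = (scale c (diag_fmat k v) :: 'e fmat)" by (auto simp: diag_fmat_def fun_eq_iff scale_def)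
  then show ?thesis by (simp add: CC_def PiV_scale)
qed

lemma diag_lift_add: "diag_lift (\<lambda>i. v i + w i) = diag_lift v + diag_lift w"
  unfolding diag_lift_def CC_add[symmetric] by (simp add: distrib_left sum.distrib)

lemma diag_lift_scale: "diag_lift (\<lambda>i. c * v i) = scale c (diag_lift v)"
  unfolding diag_lift_def CC_scale[symmetric] by (simp add: sum_distrib_left mult.left_commute)

lemma diag_lift_re_diag_add: "diag_lift (re_diag (X + Y)) = diag_lift (re_diag X) + diag_lift (re_diag Y)"
  unfolding diag_lift_add[symmetric] by (rule diag_lift_cong) (simp add: re_diag_def inner_add_left)

lemma diag_lift_re_diag_scale: "diag_lift (re_diag (scale c X)) = scale c (diag_lift (re_diag X))"
  unfolding diag_lift_scale[symmetric] by (rule diag_lift_cong) (simp add: re_diag_def scale_def inner_of_real_mult)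

lemma real_linear_PiV: "real_linear PiV"
  by (simp add: real_linear_def PiV_add PiV_scale)

lemma real_linear_PiK: "real_linear PiK"
  by (simp add: real_linear_def PiK_def PiV_add PiV_scale diag_lift_re_diag_add diag_lift_re_diag_scale scale_diff)

lemma WW_add: "WW (X + X') Y = WW X Y + WW X' Y" "WW X (Y + Y') = WW X Y + WW X Y'"
  and WW_scale: "WW (scale c X) Y = scale c (WW X Y)" "WW X (scale c Y) = scale c (WW X Y)"
  by (simp_all add: WW_def herm_block_add herm_block_scale fmult_simps fmult_scale scale_diff)

lemma real_linear_BB: "real_linear (\<lambda>X. BB X Y)" "real_linear (BB X)"
  by (simp_all add: real_linear_def BB_def WW_add WW_scale diag_lift_re_diag_add diag_lift_re_diag_scale scale_diff)

text \<open>The coordinates describe a multiple \<open>P / s\<close>, whereas the chart is built at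
  the projection \<open>P\<close>. Rescaling puts the factor \<open>s\<close> on the quadratic term,
  and the outer factor is absorbed by the linear space \<open>K\<close>.\<close>

lemma phi_scale: "phi (scale c X) = scale c (X + scale c (BB X X))"
  by (simp add: phi_def BB_def WW_scale diag_lift_re_diag_scale scale_diff scale_add)

lemma V_supp: "V H \<Longrightarrow> supp k H"
  by (auto simp: V_def intro: blockwise_supp)

lemma BB_supp: "supp k (BB X Y)"
  unfolding BB_def by (intro supp_diff blockwise_supp[OF WW_blockwise] V_supp V_diag_lift)

lemma PiK_supp: "supp k (PiK X)"
  using K_PiK[of X] by (auto simp: K_def intro: V_supp)

lemma K_scale: assumes "c \<noteq> 0" shows "K (scale c H) \<longleftrightarrow> K H"
proof -
  have "PiK (scale c H) = scale c (PiK H)" using real_linear_PiK by (simp add: real_linear_def)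
  then show ?thesis using assms by (simp add: K_iff scale_def fun_eq_iff)
qed

definition PiK_mat :: "nat \<times> nat \<times> 'e \<Rightarrow> nat \<times> nat \<times> 'e \<Rightarrow> real" where
  "PiK_mat t t' = coord_of (PiK (unit_at t')) t"

lemma PiK_mat_mult: "supp k X \<Longrightarrow> (\<Sum>l\<in>mat_idx k. PiK_mat t l * coord_of X l) = coord_of (PiK X) t"
  unfolding PiK_mat_def by (rule real_linear_expand_coord_of[OF real_linear_PiK, symmetric])

lemma PiK_mat_idem: "(\<Sum>l\<in>mat_idx k. PiK_mat t l * PiK_mat l t') = PiK_mat t t'"
  using PiK_mat_mult[OF PiK_supp, of t "unit_at t'"] PiK_id[OF K_PiK] by (simp add: PiK_mat_def)

lemma PiK_fix_iff:
  assumes "supp k X"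
  shows "K X \<longleftrightarrow> (\<forall>t\<in>mat_idx k. (\<Sum>l\<in>mat_idx k. PiK_mat t l * coord_of X l) = coord_of X t)"
  unfolding K_iff eq_iff_coord_of[OF PiK_supp assms] PiK_mat_mult[OF assms] ..

lemma qform_BB:
  assumes "supp k X"
  shows "qform (mat_idx k) (\<lambda>t t1 t2. c * coord_of (BB (unit_at t1) (unit_at t2)) t) (coord_of X) t = c * coord_of (BB X X) t"
proof -
  have "coord_of (BB X X) t = (\<Sum>t1\<in>mat_idx k. coord_of (BB (unit_at t1) X) t * coord_of X t1)"
    by (rule real_linear_expand_coord_of[OF real_linear_BB(1) assms])
  also have "\<dots> = (\<Sum>t1\<in>mat_idx k. (\<Sum>t2\<in>mat_idx k. coord_of (BB (unit_at t1) (unit_at t2)) t * coord_of X t2) * coord_of X t1)"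
    unfolding real_linear_expand_coord_of[OF real_linear_BB(2) assms] ..
  finally show ?thesis
    by (simp add: qform_def sum_distrib_left sum_distrib_right mult_ac)
qed

section \<open>Traces that give the dimension\<close>

text \<open>\<open>herm_block\<close> splits the matrix unit into two halves. The direct half passes
  through diagonal entries of \<open>P\<close> and \<open>Q\<close> in both orders, each time with
  factor \<open>s * (1 - s)\<close>; the transposed half brings the conjugate-linear term.\<close>

lemma PiV_unit_at_entry:
  assumes "i < k" "j < k" "r i j"
  shows "PiV (unit_at (i, j, b)) i j = of_real (s * (1 - s)) * b + P i j * Q i j * conjugate b"
proof -
  let ?h = "of_real (1 / 2) :: 'e"
  have e: "(A \<star> (unit_at (a, a', x) \<star> B)) m l = A m a * x * B a' l" if "a < k" "a' < k"
    for A B :: "'e fmat" and a a' x m l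
  proof -
    have 1: "(unit_at (a, a', x) \<star> B) q l = (if q = a then x * B a' l else 0)" for q
    proof -
      have "(unit_at (a, a', x) \<star> B) q l = (\<Sum>p<k. if a' = p then (if q = a then x * B a' l else 0) else 0)"
        unfolding fmult_def by (rule sum.cong) (auto simp: unit_at_def)
      then show ?thesis using that by simp
    qed
    have "(A \<star> (unit_at (a, a', x) \<star> B)) m l = (\<Sum>q<k. if a = q then A m a * x * B a' l else 0)"
      unfolding fmult_def[of k A] by (rule sum.cong) (auto simp: 1)
    then show ?thesis using that by simp
  qed
  have E: "herm_block (unit_at (i, j, b)) = scale (1 / 2) (unit_at (i, j, b)) + scale (1 / 2) (unit_at (j, i, conjugate b))"
    using assms rsym[of i j] by (auto simp: fun_eq_iff herm_block_def unit_at_def scale_def distrib_left simp del: of_real_divide)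
  have q: "Q i i = of_real (1 - s)" "Q j j = of_real (1 - s)"
    using assms by (simp_all add: Q_def one_fmat_def P_diag)
  have "PiV (unit_at (i, j, b)) i j = ?h * (P i i * b * Q j j) + ?h * (P i j * conjugate b * Q i j)
      + (?h * (Q i i * b * P j j) + ?h * (Q i j * conjugate b * P i j))"
    unfolding PiV_def E fmult_add_left fmult_add_right fmult_scale
    by (simp add: e assms scale_def)
  also have "\<dots> = (?h + ?h) * (of_real (s * (1 - s)) * b + P i j * Q i j * conjugate b)"
    unfolding q P_diag[OF assms(1)] P_diag[OF assms(2)] of_real_mult by (simp only: algebra_simps)
  also have "?h + ?h = 1" by simp
  finally show ?thesis by simp
qed

lemma PiV_unit_at_entry_0:
  assumes "\<not> r i j"
  shows "PiV (unit_at (i, j, b)) = 0"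
proof -
  have "herm_block (unit_at (i, j, b)) = 0"
    using assms rsym[of i j] by (auto simp: fun_eq_iff herm_block_def unit_at_def)
  then show ?thesis by (simp add: PiV_def)
qed

text \<open>If conjugation is trivial, \<open>Q\<close> is symmetric and the sum is
  \<open>DIM('e)\<close> times the trace of \<open>P \<star> Q = 0\<close>. Otherwise each inner sum
  over \<open>Basis\<close> is the real trace of a conjugate-linear map and vanishes by
  itself.\<close>

lemma trace_PQ: "(\<Sum>i<k. \<Sum>j<k. \<Sum>b\<in>Basis. inner (P i j * Q i j * conjugate b) b) = 0"
  using conjugate_cases[where ?'a = 'e]
proof
  assume id: "\<forall>x :: 'e. conjugate x = x"
  have qs: "Q i j = Q j i" for i j
    using fun_cong[OF fun_cong[OF Q_adj], of i j] id by (simp add: adj_def)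
  have "(\<Sum>i<k. \<Sum>j<k. P i j * Q i j) = (\<Sum>i<k. (P \<star> Q) i i)"
    unfolding fmult_def by (intro sum.cong HOL.refl arg_cong2[where f = "(*)"] qs)
  also have "P \<star> Q = 0" using XQ[OF P_supp] by simp
  finally have z: "(\<Sum>i<k. \<Sum>j<k. P i j * Q i j) = 0" by simp
  have "(\<Sum>i<k. \<Sum>j<k. \<Sum>b\<in>Basis. inner (P i j * Q i j * conjugate b) b)
      = DIM('e) * inner (\<Sum>i<k. \<Sum>j<k. P i j * Q i j) 1"
    by (simp add: sum_inner_mult_conjugate_Basis[OF id] inner_sum_left sum_distrib_left)
  then show ?thesis by (simp add: z)
qed simp

lemma trace_PiV: "(\<Sum>t\<in>mat_idx k. coord_of (PiV (unit_at t)) t) = DIM('e) * s * (1 - s) * (\<Sum>i<k. block_size i)"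
proof -
  have "coord_of (PiV (unit_at (i, j, b))) (i, j, b)
      = (if r i j then s * (1 - s) else 0) + inner (P i j * Q i j * conjugate b) b"
    if "i < k" "j < k" "b \<in> Basis" for i j b
  proof (cases "r i j")
    case True
    then show ?thesis
      using that by (simp add: coord_of_def PiV_unit_at_entry inner_add_left inner_of_real_mult del: of_real_mult)
  next
    case False
    then have "P i j = 0" using P_blockwise by (simp add: blockwise_def)
    then show ?thesis using False by (simp add: coord_of_def PiV_unit_at_entry_0)
  qed
  then have "(\<Sum>t\<in>mat_idx k. coord_of (PiV (unit_at t)) t)
      = (\<Sum>i<k. \<Sum>j<k. \<Sum>b\<in>(Basis :: 'e set). (if r i j then s * (1 - s) else 0)
           + inner (P i j * Q i j * conjugate b) b)"
    unfolding sum_mat_idx by (intro sum.cong HOL.refl) auto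
  also have "\<dots> = (\<Sum>i<k. \<Sum>j<k. DIM('e) * (if r i j then s * (1 - s) else 0))"
    using trace_PQ by (simp add: sum.distrib)
  also have "\<dots> = (\<Sum>i<k. DIM('e) * s * (1 - s) * block_size i)"
    unfolding block_size_def block_sum_def sum_distrib_left by (intro sum.cong HOL.refl) auto
  finally show ?thesis by (simp add: sum_distrib_left)
qed

text \<open>By cyclicity, the trace of lifting after taking the diagonal equals the trace of the
  opposite composite on the space of diagonals. That composite subtracts the class average, so its
  \<open>m\<close>-th diagonal entry is \<open>1 - 1 / block_size m\<close>.\<close>

lemma trace_diag_lift: "(\<Sum>t\<in>mat_idx k. coord_of (diag_lift (re_diag (PiV (unit_at t)))) t) = (\<Sum>i<k. 1 - 1 / block_size i)"
proof -
  define \<delta> where "\<delta> m i = (if i = m then 1 else 0 :: real)" for m i :: nat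
  have diag_lift_sum: "diag_lift (\<lambda>i. \<Sum>m\<in>A. v m * \<delta> m i) = (\<Sum>m\<in>A. scale (v m) (diag_lift (\<delta> m)))" if "finite A" for v A
    using that
  proof (induction A)
    case empty
    have "diag_lift (\<lambda>i. 0) = 0" by (simp add: diag_lift_def CC_zero)
    then show ?case by simp
  next
    case (insert a A)
    then show ?case by (simp add: diag_lift_add diag_lift_scale)
  qed
  have diag_lift_expand: "diag_lift v = (\<Sum>m<k. scale (v m) (diag_lift (\<delta> m)))" for v
    unfolding diag_lift_sum[OF finite_lessThan, symmetric]
    by (rule diag_lift_cong) (simp add: \<delta>_def if_distrib[of "\<lambda>x. _ * x"] cong: if_cong)
  have "(\<Sum>t\<in>mat_idx k. coord_of (diag_lift (re_diag (PiV (unit_at t)))) t)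
      = (\<Sum>t\<in>mat_idx k. \<Sum>m<k. re_diag (PiV (unit_at t)) m * coord_of (diag_lift (\<delta> m)) t)"
    by (rule sum.cong[OF HOL.refl], subst diag_lift_expand)
      (simp add: coord_of_def sum_apply2 inner_sum_left scale_def inner_of_real_mult)
  also have "\<dots> = (\<Sum>m<k. \<Sum>t\<in>mat_idx k. coord_of (diag_lift (\<delta> m)) t * re_diag (PiV (unit_at t)) m)"
    by (subst sum.swap) (simp add: mult.commute)
  also have "\<dots> = (\<Sum>m<k. re_diag (PiV (diag_lift (\<delta> m))) m)"
    unfolding re_diag_def real_linear_expand_inner[OF real_linear_PiV V_supp[OF V_diag_lift]] ..
  also have "\<dots> = (\<Sum>m<k. 1 - 1 / block_size m)"
  proof (rule sum.cong[OF HOL.refl])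
    fix m assume "m \<in> {..<k}"
    then have m: "m < k" by simp
    have "block_sum (\<delta> m) m = 1"
    proof -
      have "block_sum (\<delta> m) m = (\<Sum>j<k. if m = j then 1 else 0)"
        unfolding block_sum_def using reflpD[OF r_refl, of m] by (intro sum.cong) (auto simp: \<delta>_def)
      then show ?thesis using m by simp
    qed
    then show "re_diag (PiV (diag_lift (\<delta> m))) m = 1 - 1 / block_size m"
      by (simp add: PiV_id[OF V_diag_lift] re_diag_def diag_lift_diag[OF m] \<delta>_def del: of_real_diff of_real_divide)
  qed
  finally show ?thesis .
qed

lemma trace_PiK_mat:
  "(\<Sum>t\<in>mat_idx k. PiK_mat t t) = DIM('e) * s * (1 - s) * (\<Sum>i<k. block_size i) - (\<Sum>i<k. 1 - 1 / block_size i)"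
  unfolding trace_PiV[symmetric] trace_diag_lift[symmetric] sum_subtractf[symmetric]
  by (rule sum.cong) (auto simp: PiK_mat_def PiK_def coord_of_def inner_diff_left)

end

definition block_card :: "nat \<Rightarrow> (nat \<Rightarrow> nat \<Rightarrow> bool) \<Rightarrow> nat \<Rightarrow> real" where
  "block_card k r i = (\<Sum>j<k. if r i j then 1 else 0)"

text \<open>For an equivalence relation the sum of \<open>block_card\<close> is the sum of the
  squared class sizes, and the subtracted sum is \<open>k\<close> minus the number of classes. The
  value depends on \<open>k\<close>, \<open>r\<close>, \<open>s\<close> and the scalars only, so all
  points have the same dimension.\<close>

definition good_dim :: "nat \<Rightarrow> (nat \<Rightarrow> nat \<Rightarrow> bool) \<Rightarrow> real \<Rightarrow> nat \<Rightarrow> real" where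
  "good_dim k r s D = real D * s * (1 - s) * (\<Sum>i<k. block_card k r i) - (\<Sum>i<k. 1 - 1 / block_card k r i)"

lemma (in frame_proj) trace_pm': "(\<Sum>t\<in>mat_idx k. PiK_mat t t) = good_dim k r s DIM('e)"
  unfolding trace_PiK_mat good_dim_def block_size_def block_sum_def block_card_def ..

text \<open>A point \<open>P\<close> is needed: at \<open>P\<close> the number is the trace of a
  real idempotent and thus the cardinality of an echelon basis.\<close>

lemma good_dim_nat:
  fixes P :: "'e::real_or_complex fmat"
  assumes "reflp r" "symp r" "transp r" "good k r s P"
  obtains d :: nat where "real d = good_dim k r s DIM('e)"
proof -
  interpret frame_proj k r s P by standard (fact assms)+
  have "\<exists>d :: nat. real d = good_dim k r s DIM('e)"
  proof (rule echelon_basis[of "mat_idx k :: (nat \<times> nat \<times> 'e) set" PiK_mat], goal_cases)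
    case (3 J u)
    then show ?case unfolding trace_pm' by blast
  qed (simp_all add: PiK_mat_idem)
  then show ?thesis using that by blast
qed

theorem good_submanifold:
  assumes r: "reflp r" "symp r" "transp r" and s: "s \<noteq> 0"
    and d: "real d = good_dim k r s DIM('e)"
  shows "real_analytic_submanifold (mat_idx k) d
    {x \<in> Rpow (mat_idx k). good k r s (scale s (of_coords k x :: 'e::real_or_complex fmat))}"
proof (rule real_analytic_submanifoldI)
  fix p :: "nat \<times> nat \<times> 'e \<Rightarrow> real"
  assume "p \<in> {x \<in> Rpow (mat_idx k). good k r s (scale s (of_coords k x))}"
  then have p: "p \<in> Rpow (mat_idx k)" "good k r s (scale s (of_coords k p))" by auto
  interpret frame_proj k r s "scale s (of_coords k p)" by standard (fact r p)+
  let ?I = "mat_idx k :: (nat \<times> nat \<times> 'e) set"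
  obtain \<epsilon> where \<epsilon>: "\<epsilon> > 0" and iff: "\<And>Y. supp k Y \<Longrightarrow> (\<And>i j. i < k \<Longrightarrow> j < k \<Longrightarrow> norm (Y i j) < \<epsilon>) \<Longrightarrow>
      good k r s (scale s (of_coords k p) + Y) \<longleftrightarrow> K (phi Y)"
  proof (rule good_iff_K_phi, goal_cases)
    case (1 \<epsilon>)
    show thesis by (rule 1(1), fact 1(2), fact 1(3))
  qed
  define b where "b t t1 t2 = s * coord_of (BB (unit_at t1) (unit_at t2)) t" for t t1 t2
  \<comment> \<open>The added 1 makes \<open>DIM('e) * e < D * e\<close> strict, so a bound on the
    coordinates bounds the entries of \<open>scale s Z\<close> strictly by
    \<open>\<epsilon>\<close>.\<close>
  define D where "D = real DIM('e) + 1"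
  have D0: "D > 0" by (simp add: D_def add_nonneg_pos)
  define e where "e = \<epsilon> / \<bar>s\<bar> / D"
  have e0: "e > 0" using \<epsilon> s D0 by (simp add: e_def)
  have main: "(\<lambda>i\<in>?I. p i + z i) \<in> {x \<in> Rpow ?I. good k r s (scale s (of_coords k x))} \<longleftrightarrow>
       (\<forall>i\<in>?I. (\<Sum>l\<in>?I. PiK_mat i l * (z l + qform ?I b z l)) = z i + qform ?I b z i)"
    if z: "z \<in> Rpow ?I" "\<forall>i\<in>?I. \<bar>z i\<bar> < e" for z
  proof -
    define Z where "Z = of_coords k z"
    have Zs: "supp k Z" unfolding Z_def by (rule supp_of_coords)
    have "of_coords k (\<lambda>i\<in>?I. p i + z i) = of_coords k p + Z"
      unfolding Z_def of_coords_add[symmetric] by (rule of_coords_cong) simp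
    then have "(\<lambda>i\<in>?I. p i + z i) \<in> {x \<in> Rpow ?I. good k r s (scale s (of_coords k x))} \<longleftrightarrow>
        good k r s (scale s (of_coords k p) + scale s Z)" by (simp add: scale_add)
    also have "\<dots> \<longleftrightarrow> K (phi (scale s Z))"
    proof (rule iff)
      show "supp k (scale s Z)" by (rule supp_scale[OF Zs])
      fix i j
      have "norm (Z i j) \<le> DIM('e) * e"
        unfolding Z_def using z(2) e0 by (intro norm_of_coords_le) (auto simp: less_imp_le)
      also have "\<dots> < D * e" using e0 by (simp add: D_def)
      finally have "\<bar>s\<bar> * norm (Z i j) < \<bar>s\<bar> * (D * e)" using s by simp
      also have "\<dots> = \<epsilon>" using s D0 by (simp add: e_def)
      finally show "norm (scale s Z i j) < \<epsilon>" by (simp add: scale_def norm_mult)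
    qed
    also have "\<dots> \<longleftrightarrow> K (Z + scale s (BB Z Z))" unfolding phi_scale by (rule K_scale[OF s])
    also have "\<dots> \<longleftrightarrow> (\<forall>i\<in>?I. (\<Sum>l\<in>?I. PiK_mat i l * (z l + qform ?I b z l)) = z i + qform ?I b z i)"
    proof -
      have "coord_of (Z + scale s (BB Z Z)) t = z t + qform ?I b z t" if "t \<in> ?I" for t
      proof -
        have "qform ?I b z t = qform ?I b (coord_of Z) t"
          by (rule qform_cong) (simp add: Z_def coord_of_of_coords)
        also have "\<dots> = s * coord_of (BB Z Z) t" unfolding b_def by (rule qform_BB[OF Zs])
        finally show ?thesis using that coord_of_of_coords[OF that, of z]
          by (simp add: Z_def coord_of_def inner_add_left scale_def inner_of_real_mult)
      qed
      then show ?thesis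
        unfolding PiK_fix_iff[OF supp_add[OF Zs supp_scale[OF BB_supp]]] by simp
    qed
    finally show ?thesis .
  qed
  show "\<exists>P b \<epsilon>. \<epsilon> > 0 \<and> (\<forall>i\<in>?I. \<forall>j\<in>?I. (\<Sum>l\<in>?I. P i l * P l j) = P i j) \<and> (\<Sum>i\<in>?I. P i i) = real d \<and>
      (\<forall>z\<in>Rpow ?I. (\<forall>i\<in>?I. \<bar>z i\<bar> < \<epsilon>) \<longrightarrow>
         ((\<lambda>i\<in>?I. p i + z i) \<in> {x \<in> Rpow ?I. good k r s (scale s (of_coords k x))} \<longleftrightarrow>
          (\<forall>i\<in>?I. (\<Sum>l\<in>?I. P i l * (z l + qform ?I b z l)) = z i + qform ?I b z i)))"
    by (rule exI[of _ PiK_mat], rule exI[of _ b], rule exI[of _ e])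
      (intro conjI ballI impI e0 PiK_mat_idem, simp only: trace_pm' d, rule main)
qed auto

section \<open>Partitions associated with a matrix\<close>

text \<open>
  Equality is included so that this is an equivalence relation on all natural numbers.
\<close>

definition same_part :: "nat set set \<Rightarrow> nat \<Rightarrow> nat \<Rightarrow> bool" where
  "same_part \<sigma> i j \<longleftrightarrow> i = j \<or> (\<exists>A\<in>\<sigma>. i \<in> A \<and> j \<in> A)"

lemma same_part_equiv:
  assumes "partition_on X \<sigma>"
  shows "reflp (same_part \<sigma>)" "symp (same_part \<sigma>)" "transp (same_part \<sigma>)"
proof -
  show "reflp (same_part \<sigma>)" by (simp add: reflp_def same_part_def)
  show "symp (same_part \<sigma>)" by (auto simp: symp_def same_part_def)
  have "A = B" if "A \<in> \<sigma>" "B \<in> \<sigma>" "j \<in> A" "j \<in> B" for A B j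
    using partition_onD2[OF assms] that by (auto simp: disjoint_def)
  then show "transp (same_part \<sigma>)" unfolding transp_def same_part_def by blast
qed

lemma same_part_block:
  assumes "partition_on X \<sigma>" "A \<in> \<sigma>" "i \<in> A"
  shows "same_part \<sigma> i j \<longleftrightarrow> j \<in> A"
proof -
  have "A = B" if "B \<in> \<sigma>" "i \<in> B" for B
    using partition_onD2[OF assms(1)] that assms(2,3) by (auto simp: disjoint_def)
  then show ?thesis using assms unfolding same_part_def by blast
qed

text \<open>Multiplication by the coordinate projection of \<open>A\<close> keeps the rows with
  index in \<open>A\<close> from the left and the columns with index in \<open>A\<close> from the
  right; this is the resulting condition on entries.\<close>

definition commuting :: "nat \<Rightarrow> 'e::real_or_complex fmat \<Rightarrow> nat set \<Rightarrow> bool" where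
  "commuting k X A \<longleftrightarrow> (\<forall>i<k. \<forall>j<k. X i j \<noteq> 0 \<longrightarrow> (i \<in> A \<longleftrightarrow> j \<in> A))"

definition finest :: "nat \<Rightarrow> 'e::real_or_complex fmat \<Rightarrow> nat set set" where
  "finest k X = {A. A \<noteq> {} \<and> A \<subseteq> {..<k} \<and> commuting k X A \<and> (\<forall>B. B \<noteq> {} \<and> B \<subset> A \<longrightarrow> \<not> commuting k X B)}"

lemma commuting_Diff: "commuting k X A \<Longrightarrow> commuting k X B \<Longrightarrow> commuting k X (A - B)"
  and commuting_Int: "commuting k X A \<Longrightarrow> commuting k X B \<Longrightarrow> commuting k X (A \<inter> B)"
  unfolding commuting_def by blast+

text \<open>Commuting sets are closed under intersection and difference. The intersection of those
  containing \<open>i\<close> is minimal: for a proper commuting subset \<open>B\<close>, either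
  \<open>B\<close> or its complement in the intersection would be a smaller one containing
  \<open>i\<close>.\<close>

lemma finest_partition: "partition_on {..<k} (finest k X)"
proof (rule partition_onI)
  show "\<Union> (finest k X) = {..<k}"
  proof (intro equalityI subsetI)
    fix i assume i: "i \<in> {..<k}"
    define A where "A = \<Inter> {A. i \<in> A \<and> A \<subseteq> {..<k} \<and> commuting k X A}"
    have iA: "i \<in> A" by (auto simp: A_def)
    have "commuting k X {..<k}" by (simp add: commuting_def)
    then have Ak: "A \<subseteq> {..<k}" using i by (auto simp: A_def)
    have cA: "commuting k X A" unfolding commuting_def A_def by blast
    have "\<not> commuting k X B" if "B \<noteq> {}" "B \<subset> A" for B
    proof
      assume cB: "commuting k X B"
      show False
      proof (cases "i \<in> B")
        case True
        then have "B \<in> {A. i \<in> A \<and> A \<subseteq> {..<k} \<and> commuting k X A}" using cB that(2) Ak by blast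
        then have "A \<subseteq> B" unfolding A_def by (rule Inter_lower)
        then show False using that by blast
      next
        case False
        have "commuting k X (A - B)" by (rule commuting_Diff[OF cA cB])
        moreover have "A - B \<subseteq> {..<k}" "i \<in> A - B" using Ak iA False by auto
        ultimately have "A - B \<in> {A. i \<in> A \<and> A \<subseteq> {..<k} \<and> commuting k X A}" by blast
        then have "\<Inter> {A. i \<in> A \<and> A \<subseteq> {..<k} \<and> commuting k X A} \<subseteq> A - B" by (rule Inter_lower)
        then have "A \<subseteq> A - B" by (simp only: A_def[symmetric])
        then show False using that by blast
      qed
    qed
    then have "A \<in> finest k X" using iA Ak cA by (auto simp: finest_def)
    then show "i \<in> \<Union> (finest k X)" using iA by blast
  qed (auto simp: finest_def)
  show "disjnt A B" if AB: "A \<in> finest k X" "B \<in> finest k X" "A \<noteq> B" for A B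
  proof (rule ccontr)
    assume "\<not> disjnt A B"
    then have ne: "A \<inter> B \<noteq> {}" by (simp add: disjnt_def)
    have cAB: "commuting k X (A \<inter> B)" using AB by (intro commuting_Int) (auto simp: finest_def)
    have mA: "\<not> commuting k X C" if "C \<noteq> {}" "C \<subset> A" for C
      using AB(1) that by (simp add: finest_def)
    have mB: "\<not> commuting k X C" if "C \<noteq> {}" "C \<subset> B" for C
      using AB(2) that by (simp add: finest_def)
    have "\<not> A \<inter> B \<subset> A" using mA[OF ne] cAB by blast
    moreover have "\<not> A \<inter> B \<subset> B" using mB[OF ne] cAB by blast
    ultimately show False using AB(3) by blast
  qed
qed (auto simp: finest_def)

text \<open>Real functions that are constant along nonzero entries correspond to commuting sets
  through level sets and indicators. This turns minimality of the parts into the connectivity clause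
  of \<open>good\<close>, which a Laplacian can exploit.\<close>

lemma finest_eq_iff:
  assumes \<sigma>: "partition_on {..<k} \<sigma>"
  shows "finest k X = \<sigma> \<longleftrightarrow> (\<forall>i<k. \<forall>j<k. X i j \<noteq> 0 \<longrightarrow> same_part \<sigma> i j) \<and>
    (\<forall>w :: nat \<Rightarrow> real. (\<forall>i<k. \<forall>j<k. X i j \<noteq> 0 \<longrightarrow> w i = w j) \<longrightarrow>
        (\<forall>i<k. \<forall>j<k. same_part \<sigma> i j \<longrightarrow> w i = w j))" (is "_ \<longleftrightarrow> ?E \<and> ?C")
proof
  assume finest: "finest k X = \<sigma>"
  have ?E
  proof (intro allI impI)
    fix i j assume ij: "i < k" "j < k" "X i j \<noteq> 0"
    then obtain A where A: "A \<in> \<sigma>" "i \<in> A" using partition_onD1[OF \<sigma>] by blast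
    then have "j \<in> A" using finest ij unfolding finest_def commuting_def by blast
    then show "same_part \<sigma> i j" using A by (auto simp: same_part_def)
  qed
  moreover have ?C
  proof (intro allI impI)
    fix w :: "nat \<Rightarrow> real" and i j
    assume w: "\<forall>i<k. \<forall>j<k. X i j \<noteq> 0 \<longrightarrow> w i = w j" and ij: "i < k" "j < k" "same_part \<sigma> i j"
    show "w i = w j"
    proof (cases "i = j")
      case False
      then obtain A where A: "A \<in> \<sigma>" "i \<in> A" "j \<in> A" using ij by (auto simp: same_part_def)
      \<comment> \<open>A level set of \<open>w\<close> inside the part is again commuting, so by
        minimality it is the whole part.\<close>
      define B where "B = {l\<in>A. w l = w i}"
      have "commuting k X A" using A finest by (auto simp: finest_def)
      then have "commuting k X B" using w unfolding commuting_def B_def by auto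
      moreover have "B \<noteq> {}" "B \<subseteq> A" using A by (auto simp: B_def)
      ultimately have "B = A" using A(1) finest unfolding finest_def by blast
      then have "j \<in> B" using A by blast
      then show ?thesis by (simp add: B_def)
    qed simp
  qed
  ultimately show "?E \<and> ?C" ..
next
  assume "?E \<and> ?C"
  then have E: ?E and C: ?C by blast+
  have sub: "\<sigma> \<subseteq> finest k X"
  proof
    fix A assume A: "A \<in> \<sigma>"
    have A1: "A \<noteq> {}" "A \<subseteq> {..<k}"
      using A partition_onD1[OF \<sigma>] partition_onD3[OF \<sigma>] by auto
    have "commuting k X A"
      unfolding commuting_def
    proof (intro allI impI)
      fix i j assume "i < k" "j < k" "X i j \<noteq> 0"
      then have "same_part \<sigma> i j" "same_part \<sigma> j i" using E same_part_equiv[OF \<sigma>] by (auto dest: sympD)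
      then show "i \<in> A \<longleftrightarrow> j \<in> A" using same_part_block[OF \<sigma> A] by blast
    qed
    moreover have "\<not> commuting k X B" if B: "B \<noteq> {}" "B \<subset> A" for B
    proof
      assume cB: "commuting k X B"
      \<comment> \<open>The indicator of a smaller commuting set would be constant along nonzero
        entries without being constant on the part.\<close>
      define w where "w i = (if i \<in> B then 1 else 0 :: real)" for i
      have "\<forall>i<k. \<forall>j<k. X i j \<noteq> 0 \<longrightarrow> w i = w j" using cB by (auto simp: commuting_def w_def)
      then have c: "\<forall>i<k. \<forall>j<k. same_part \<sigma> i j \<longrightarrow> w i = w j" using C by blast
      obtain i j where "i \<in> B" "j \<in> A - B" using B by blast
      moreover from this have "same_part \<sigma> i j" "i < k" "j < k"
        using A A1 B by (auto simp: same_part_def)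
      ultimately have "w i = w j" "i \<in> B" "j \<notin> B" using c by blast+
      then show False by (simp add: w_def)
    qed
    ultimately show "A \<in> finest k X" using A1 by (auto simp: finest_def)
  qed
  show "finest k X = \<sigma>"
  proof (intro equalityI sub subsetI)
    fix A assume A: "A \<in> finest k X"
    then obtain i where i: "i \<in> A" "i < k" by (auto simp: finest_def)
    then obtain B where B: "B \<in> \<sigma>" "i \<in> B" using partition_onD1[OF \<sigma>] by blast
    then have "B \<in> finest k X" using sub by blast
    then have "A = B" using partition_onD2[OF finest_partition[of k X]] A i B by (auto simp: disjoint_def)
    then show "A \<in> \<sigma>" using B by simp
  qed
qed

section \<open>Translation between matrices and their entry functions\<close>

definition fun_of_mat :: "nat \<Rightarrow> 'e::real_or_complex mat \<Rightarrow> 'e fmat" where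
  "fun_of_mat k M = (\<lambda>i j. if i < k \<and> j < k then M $$ (i, j) else 0)"

lemma supp_fun_of_mat: "supp k (fun_of_mat k M)"
  by (auto simp: supp_def fun_of_mat_def)

lemma fmult_fun_of_mat:
  assumes "A \<in> carrier_mat k k" "B \<in> carrier_mat k k"
  shows "fmult k (fun_of_mat k A) (fun_of_mat k B) = fun_of_mat k (A * B)"
proof (intro ext)
  fix i j
  show "fmult k (fun_of_mat k A) (fun_of_mat k B) i j = fun_of_mat k (A * B) i j"
    using assms by (auto simp: fmult_def fun_of_mat_def scalar_prod_def atLeast0LessThan intro!: sum.neutral)
qed

lemma fun_of_mat_eq_iff:
  assumes "A \<in> carrier_mat k k" "B \<in> carrier_mat k k"
  shows "fun_of_mat k A = fun_of_mat k B \<longleftrightarrow> A = B"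
proof
  assume eq: "fun_of_mat k A = fun_of_mat k B"
  have "A $$ (i, j) = B $$ (i, j)" if "i < k" "j < k" for i j
    using fun_cong[OF fun_cong[OF eq], of i j] that by (simp add: fun_of_mat_def)
  then show "A = B" using assms by (intro eq_matI) auto
qed simp

lemma mat_adjoint_carrier:
  assumes "A \<in> carrier_mat k k"
  shows "mat_adjoint A \<in> carrier_mat k k"
  using assms by (auto simp: mat_adjoint_def mat_of_rows_def)

lemma adj_fun_of_mat:
  assumes "A \<in> carrier_mat k k"
  shows "adj (fun_of_mat k A) = fun_of_mat k (mat_adjoint A)"
  using assms by (auto simp: fun_eq_iff adj_def fun_of_mat_def mat_adjoint_def mat_of_rows_def)

lemma projection_iff_fun_of_mat:
  assumes "P \<in> carrier_mat k k"
  shows "projection k P \<longleftrightarrow> adj (fun_of_mat k P) = fun_of_mat k P \<and> fmult k (fun_of_mat k P) (fun_of_mat k P) = fun_of_mat k P"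
  unfolding projection_def adj_fun_of_mat[OF assms] fmult_fun_of_mat[OF assms assms]
  using assms by (simp add: fun_of_mat_eq_iff mat_adjoint_carrier)

lemma fun_of_mat_smult: "M \<in> carrier_mat k k \<Longrightarrow> fun_of_mat k (of_real c \<cdot>\<^sub>m M) = scale c (fun_of_mat k M)"
  by (auto simp: fun_eq_iff fun_of_mat_def scale_def)

lemma mat_eq_iff_entries:
  assumes "A \<in> carrier_mat k k" "B \<in> carrier_mat k k"
  shows "A = B \<longleftrightarrow> (\<forall>i<k. \<forall>j<k. A $$ (i, j) = B $$ (i, j))"
  using assms by (auto intro!: eq_matI)

lemma coord_proj_commute_iff:
  fixes T :: "'e::real_or_complex mat"
  assumes "T \<in> carrier_mat k k"
  shows "coord_proj k A * T = T * coord_proj k A \<longleftrightarrow> commuting k (fun_of_mat k T) A"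
proof -
  have cA: "(coord_proj k A :: 'e mat) \<in> carrier_mat k k" by (simp add: coord_proj_def)
  have 1: "(coord_proj k A * T) $$ (i, j) = (if i \<in> A then T $$ (i, j) else 0)" if "i < k" "j < k" for i j
  proof -
    have "(coord_proj k A * T) $$ (i, j) = (\<Sum>l<k. coord_proj k A $$ (i, l) * T $$ (l, j))"
      using assms that cA by (auto simp: scalar_prod_def atLeast0LessThan)
    also have "\<dots> = (\<Sum>l<k. (if i = l then if i \<in> A then T $$ (i, j) else 0 else 0))"
      by (rule sum.cong) (use that in \<open>auto simp: coord_proj_def\<close>)
    finally have "(coord_proj k A * T) $$ (i, j) = \<dots>" .
    then show ?thesis using that by simp
  qed
  have 2: "(T * coord_proj k A) $$ (i, j) = (if j \<in> A then T $$ (i, j) else 0)" if "i < k" "j < k" for i j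
  proof -
    have "(T * coord_proj k A) $$ (i, j) = (\<Sum>l<k. T $$ (i, l) * coord_proj k A $$ (l, j))"
      using assms that cA by (auto simp: scalar_prod_def atLeast0LessThan)
    also have "\<dots> = (\<Sum>l<k. (if j = l then if j \<in> A then T $$ (i, j) else 0 else 0))"
      by (rule sum.cong) (use that in \<open>auto simp: coord_proj_def\<close>)
    finally have "(T * coord_proj k A) $$ (i, j) = \<dots>" .
    then show ?thesis using that by simp
  qed
  have "coord_proj k A * T = T * coord_proj k A \<longleftrightarrow>
      (\<forall>i<k. \<forall>j<k. (coord_proj k A * T) $$ (i, j) = (T * coord_proj k A) $$ (i, j))"
    by (rule mat_eq_iff_entries) (use assms cA in auto)
  also have "\<dots> \<longleftrightarrow> commuting k (fun_of_mat k T) A"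
    unfolding commuting_def by (auto simp: 1 2 fun_of_mat_def)
  finally show ?thesis .
qed

lemma sigma_eq_finest: "T \<in> carrier_mat k k \<Longrightarrow> sigma k T = finest k (fun_of_mat k T)"
  by (simp add: sigma_def finest_def coord_proj_commute_iff)

lemma finest_scale: "c \<noteq> 0 \<Longrightarrow> finest k (scale c X) = finest k X"
  by (simp add: finest_def commuting_def scale_def)

definition proj_diag :: "nat \<Rightarrow> real \<Rightarrow> 'e::real_or_complex fmat \<Rightarrow> bool" where
  "proj_diag k s X \<longleftrightarrow> adj X = X \<and> fmult k X X = X \<and> (\<forall>i<k. X i i = of_real s)"

lemma good_iff_finest:
  assumes "partition_on {..<k} \<sigma>" "supp k X"
  shows "good k (same_part \<sigma>) s X \<longleftrightarrow> proj_diag k s X \<and> finest k X = \<sigma>"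
proof -
  have "blockwise k (same_part \<sigma>) X \<longleftrightarrow> (\<forall>i<k. \<forall>j<k. X i j \<noteq> 0 \<longrightarrow> same_part \<sigma> i j)"
    using assms(2) unfolding blockwise_def supp_def by blast
  then show ?thesis
    unfolding good_def finest_eq_iff[OF assms(1)] proj_diag_def by blast
qed

text \<open>In the converse direction the rank is recovered from the diagonal, because the rank of a
  projection is its trace \<open>k * (n / k) = n\<close>.\<close>

lemma GG_iff:
  fixes M :: "'e::real_or_complex mat"
  assumes "n > 0" "k > 0"
  shows "M \<in> GG k n \<longleftrightarrow> M \<in> carrier_mat k k \<and> proj_diag k (real n / real k) (scale (real n / real k) (fun_of_mat k M))"
proof -
  define s where "s = real n / real k"
  have s0: "s \<noteq> 0" using assms by (simp add: s_def)
  have kn: "of_nat k / of_nat n = (of_real (1 / s) :: 'e)" by (simp add: s_def)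
  have nk: "of_nat n / of_nat k = (of_real s :: 'e)" by (simp add: s_def)
  show ?thesis unfolding s_def[symmetric]
  proof
    assume "M \<in> GG k n"
    then obtain P where P: "M = of_real (1 / s) \<cdot>\<^sub>m P" "projection k P" "\<forall>i<k. P $$ (i, i) = of_real s"
      unfolding GG_def kn nk by blast
    have Pc: "P \<in> carrier_mat k k" using P(2) by (simp add: projection_def)
    have "scale s (fun_of_mat k M) = fun_of_mat k P"
      unfolding P(1) fun_of_mat_smult[OF Pc] using s0 by (simp add: scale_scale)
    then show "M \<in> carrier_mat k k \<and> proj_diag k s (scale s (fun_of_mat k M))"
      using P Pc unfolding projection_iff_fun_of_mat[OF Pc] by (auto simp: proj_diag_def fun_of_mat_def)
  next
    assume M: "M \<in> carrier_mat k k \<and> proj_diag k s (scale s (fun_of_mat k M))"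
    define P where "P = of_real s \<cdot>\<^sub>m M"
    have Pc: "P \<in> carrier_mat k k" using M by (simp add: P_def)
    have tP: "fun_of_mat k P = scale s (fun_of_mat k M)" unfolding P_def using M by (intro fun_of_mat_smult) simp
    have pd: "proj_diag k s (fun_of_mat k P)" using M tP by simp
    have pr: "projection k P" using pd unfolding projection_iff_fun_of_mat[OF Pc] by (simp add: proj_diag_def)
    have dP: "P $$ (i, i) = of_real s" if "i < k" for i
      using pd that by (auto simp: proj_diag_def fun_of_mat_def)
    have "of_nat (vec_space.rank k P) = (\<Sum>i<k. P $$ (i, i))"
      using idempotent_trace_eq_rank[OF Pc] pr by (simp add: projection_def)
    also have "\<dots> = of_nat k * of_real s" by (simp add: dP)
    also have "\<dots> = (of_nat n :: 'e)" using assms by (simp add: s_def)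
    finally have "vec_space.rank k P = n" by (simp only: of_nat_eq_iff)
    moreover have "M = of_real (1 / s) \<cdot>\<^sub>m P"
      unfolding P_def using s0 by (intro eq_matI) auto
    ultimately show "M \<in> GG k n"
      unfolding GG_def kn nk using pr dP by blast
  qed
qed

lemma finest_fun_of_mat_scale:
  assumes "n > 0" "k > 0" "M \<in> carrier_mat k k"
  shows "finest k (scale (real n / real k) (fun_of_mat k M)) = sigma k M"
  using assms by (simp add: finest_scale sigma_eq_finest)

lemma Npart_iff_good:
  fixes M :: "'e::real_or_complex mat"
  assumes "n > 0" "k > 0" "partition_on {..<k} \<sigma>"
  shows "M \<in> Npart k n \<sigma> \<longleftrightarrow>
    M \<in> carrier_mat k k \<and> good k (same_part \<sigma>) (real n / real k) (scale (real n / real k) (fun_of_mat k M))"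
  unfolding Npart_def mem_Collect_eq GG_iff[OF assms(1,2)]
    good_iff_finest[OF assms(3) supp_scale[OF supp_fun_of_mat]]
  using finest_fun_of_mat_scale[OF assms(1,2)] by auto

lemma of_coords_mat_coords: "of_coords k (mat_coords k M) = fun_of_mat k M"
  by (auto simp: fun_eq_iff of_coords_def fun_of_mat_def mat_coords_def mat_idx_def euclidean_representation)

lemma mat_coords_Npart:
  fixes k n :: nat
  assumes "n > 0" "k > 0" "partition_on {..<k} \<sigma>"
  shows "mat_coords k ` (Npart k n \<sigma> :: 'e::real_or_complex mat set)
    = {x \<in> Rpow (mat_idx k). good k (same_part \<sigma>) (real n / real k) (scale (real n / real k) (of_coords k x :: 'e fmat))}"
proof (intro equalityI subsetI)
  fix x assume "x \<in> mat_coords k ` (Npart k n \<sigma> :: 'e mat set)"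
  then obtain M :: "'e mat" where "x = mat_coords k M" "M \<in> Npart k n \<sigma>" by blast
  then show "x \<in> {x \<in> Rpow (mat_idx k). good k (same_part \<sigma>) (real n / real k) (scale (real n / real k) (of_coords k x :: 'e fmat))}"
    unfolding Npart_iff_good[OF assms] by (simp add: of_coords_mat_coords) (simp add: mat_coords_def)
next
  fix x assume x: "x \<in> {x \<in> Rpow (mat_idx k). good k (same_part \<sigma>) (real n / real k) (scale (real n / real k) (of_coords k x :: 'e fmat))}"
  then have "x \<in> mat_coords k ` (carrier_mat k k :: 'e mat set)"
    by (simp add: bij_betw_imp_surj_on[OF bij_betw_mat_coords])
  then obtain M :: "'e mat" where "M \<in> carrier_mat k k" "x = mat_coords k M" by blast
  then show "x \<in> mat_coords k ` (Npart k n \<sigma> :: 'e mat set)"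
    using x Npart_iff_good[OF assms, of M] by (auto simp: of_coords_mat_coords)
qed

lemma mat_submanifold_Npart:
  fixes k n :: nat
  assumes "n > 0" "k > 0" "partition_on {..<k} \<sigma>"
    and d: "real d = good_dim k (same_part \<sigma>) (real n / real k) DIM('e)"
  shows "mat_submanifold k d (Npart k n \<sigma> :: 'e::real_or_complex mat set)"
  unfolding mat_submanifold_def
proof
  show "(Npart k n \<sigma> :: 'e mat set) \<subseteq> carrier_mat k k"
    using Npart_iff_good[OF assms(1-3)] by blast
  show "real_analytic_submanifold (mat_idx k) d (mat_coords k ` (Npart k n \<sigma> :: 'e mat set))"
    unfolding mat_coords_Npart[OF assms(1-3)]
    using same_part_equiv[OF assms(3)] assms(1,2) d by (intro good_submanifold) auto
qed

lemma ex_mat_submanifold_Npart: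
  fixes k n :: nat
  assumes "n > 0" "k > 0" "partition_on {..<k} \<sigma>" "(Npart k n \<sigma> :: 'e::real_or_complex mat set) \<noteq> {}"
  shows "\<exists>d. mat_submanifold k d (Npart k n \<sigma> :: 'e mat set)"
proof -
  from assms(4) obtain M :: "'e mat" where "M \<in> Npart k n \<sigma>" by blast
  then have "good k (same_part \<sigma>) (real n / real k) (scale (real n / real k) (fun_of_mat k M))"
    using Npart_iff_good[OF assms(1-3)] by blast
  from good_dim_nat[OF same_part_equiv[OF assms(3)] this]
  obtain d where "real d = good_dim k (same_part \<sigma>) (real n / real k) DIM('e)" .
  from mat_submanifold_Npart[OF assms(1-3) this] show ?thesis ..
qed

text \<open>The trace of the projection over a part \<open>A\<close> is
  \<open>card A * n / k\<close>. Its integrality says that \<open>k\<close> divides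
  \<open>card A * n\<close>; cancelling \<open>d\<close> and using that \<open>k'\<close> and
  \<open>n div d\<close> are coprime gives the divisibility.\<close>

lemma GG_eq_Union_Npart:
  fixes k n d k' :: nat
  assumes "n > 0" "k > 0" "d = gcd k n" "k' = k div d"
  shows "(GG k n :: 'e::real_or_complex mat set) = (\<Union>\<sigma>\<in>partitions_mult k k'. Npart k n \<sigma>)"
proof (intro equalityI subsetI)
  fix M :: "'e mat" assume M: "M \<in> GG k n"
  define X where "X = scale (real n / real k) (fun_of_mat k M)"
  have Mc: "M \<in> carrier_mat k k" and X: "proj_diag k (real n / real k) X"
    using M unfolding GG_iff[OF assms(1,2)] X_def by auto
  have sX: "sigma k M = finest k X" unfolding X_def using finest_fun_of_mat_scale[OF assms(1,2) Mc] by simp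
  have "k' dvd card A" if "A \<in> finest k X" for A
  proof -
    have A: "commuting k X A" "A \<subseteq> {..<k}" using that by (auto simp: finest_def)
    have "fmult k X X = X" using X by (simp add: proj_diag_def)
    from commuting_trace_nat[OF this, of A] A obtain m :: nat
      where m: "(\<Sum>j<k. if j \<in> A then X j j else 0) = of_nat m"
      unfolding commuting_def by blast
    have "(\<Sum>j<k. if j \<in> A then X j j else 0) = (\<Sum>j\<in>{..<k} \<inter> A. X j j)"
      by (simp add: sum.inter_restrict)
    also have "\<dots> = (\<Sum>j\<in>A. of_real (real n / real k))"
      using A(2) X by (intro sum.cong) (auto simp: proj_diag_def)
    also have "\<dots> = of_real (real (card A) * (real n / real k))" by simp
    finally have "of_real (real (card A) * (real n / real k)) = (of_real (real m) :: 'e)" using m by simp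
    then have "real (card A) * (real n / real k) = real m" by (simp only: of_real_eq_iff)
    then have "real (card A * n) = real (m * k)" using assms(2) by (simp add: field_simps)
    then have "card A * n = m * k" by (simp only: of_nat_eq_iff)
    then have "k dvd card A * n" by simp
    moreover have d0: "d > 0" using assms by simp
    moreover have "k = k' * d" "n = (n div d) * d" using assms by auto
    ultimately have "k' * d dvd card A * (n div d) * d" by (metis mult.assoc)
    then have "k' dvd card A * (n div d)" using d0 by simp
    moreover have "coprime k' (n div d)" using assms div_gcd_coprime[of k n] by auto
    ultimately show ?thesis by (simp add: coprime_dvd_mult_left_iff)
  qed
  then have "sigma k M \<in> partitions_mult k k'"
    using finest_partition[of k X] by (simp add: partitions_mult_def sX)
  then show "M \<in> (\<Union>\<sigma>\<in>partitions_mult k k'. Npart k n \<sigma>)" using M by (auto simp: Npart_def)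
qed (auto simp: Npart_def)

lemma disjoint_family_Npart: "disjoint_family_on (\<lambda>\<sigma>. Npart k n \<sigma>) S"
  by (auto simp: disjoint_family_on_def Npart_def)

section \<open>Harmonic projections\<close>

lemma cis_eq_1_imp:
  assumes "cis (2 * pi * real_of_int m / real k) = 1" "\<bar>m\<bar> < int k"
  shows "m = 0"
proof -
  have k: "k > 0" using assms(2) by auto
  have "cos (2 * pi * real_of_int m / real k) = 1"
    using assms(1) by (metis cis.sel(1) one_complex.sel(1))
  then obtain q :: int where "2 * pi * real_of_int m / real k = real_of_int q * 2 * pi"
    using cos_one_2pi_int by blast
  then have "real_of_int m = real_of_int q * real k" using k by (simp add: field_simps)
  then have "real_of_int m = real_of_int (q * int k)" by simp
  then have m: "m = q * int k" by (simp only: of_int_eq_iff)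
  then have "\<bar>q\<bar> * int k < 1 * int k" using assms(2) by (simp add: abs_mult)
  then have "q = 0" using k by (simp add: mult_less_cancel_right)
  then show ?thesis using m by simp
qed

text \<open>Orthogonality of the characters of the cyclic group of order \<open>k\<close>; the bound
  on \<open>m\<close> excludes nonzero multiples of \<open>k\<close>.\<close>

lemma sum_cis_geometric:
  assumes "\<bar>m\<bar> < int k"
  shows "(\<Sum>l<k. cis (2 * pi * real_of_int m / real k * real l)) = (if m = 0 then of_nat k else 0)"
proof (cases "m = 0")
  case False
  define z where "z = cis (2 * pi * real_of_int m / real k)"
  have k: "k > 0" using assms by auto
  have z1: "z \<noteq> 1" using cis_eq_1_imp[of m k] assms False by (auto simp: z_def)
  have "z ^ k = cis (2 * pi * real_of_int m)" using Complex.DeMoivre[of "2 * pi * real_of_int m / real k" k] k by (simp only: z_def) simp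
  also have "\<dots> = 1" by (rule cis_multiple_2pi) simp
  finally have zk: "z ^ k = 1" .
  have "(\<Sum>l<k. cis (2 * pi * real_of_int m / real k * real l)) = (\<Sum>l<k. z ^ l)"
    by (rule sum.cong) (simp_all add: z_def Complex.DeMoivre mult.commute)
  also have "\<dots> = 0" using z1 zk by (simp add: geometric_sum)
  finally show ?thesis using False by simp
qed simp

text \<open>
  The projection onto \<open>n\<close> consecutive frequencies centred at \<open>0\<close> (half-integral ones if \<open>n\<close> is even).
  Centring makes the matrix real, and its entries next to the diagonal are
  \<open>sin (\<pi> n / k) / (k sin (\<pi> / k)) \<noteq> 0\<close>.
\<close>

definition freq :: "nat \<Rightarrow> nat \<Rightarrow> nat \<Rightarrow> real" where
  "freq k n t = 2 * pi / real k * (real t - (real n - 1) / 2)"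

definition harmonic :: "nat \<Rightarrow> nat \<Rightarrow> nat \<Rightarrow> nat \<Rightarrow> real" where
  "harmonic k n i j = (\<Sum>t<n. cos (freq k n t * (real i - real j))) / real k"

text \<open>Reversing the order of the \<open>n\<close> frequencies negates them, so the sine terms
  cancel.\<close>

lemma sum_cis_freq:
  "(\<Sum>t<n. cis (freq k n t * x)) = complex_of_real (\<Sum>t<n. cos (freq k n t * x))"
proof -
  have f: "freq k n (n - Suc t) = - freq k n t" if "t < n" for t
  proof -
    have "real (n - Suc t) - (real n - 1) / 2 = - (real t - (real n - 1) / 2)"
      using that by (simp add: of_nat_diff field_simps)
    then show ?thesis by (simp only: freq_def mult_minus_right)
  qed
  have "(\<Sum>t<n. sin (freq k n t * x)) = (\<Sum>t<n. sin (freq k n (n - Suc t) * x))"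
    by (rule sum.nat_diff_reindex[symmetric])
  also have "\<dots> = - (\<Sum>t<n. sin (freq k n t * x))"
    by (simp add: f sum_negf)
  finally have "(\<Sum>t<n. sin (freq k n t * x)) = 0" by simp
  then show ?thesis by (simp add: complex_eq_iff Re_sum Im_sum)
qed

lemma harmonic_sym: "harmonic k n i j = harmonic k n j i"
  using cos_minus[of "freq k n _ * (real i - real j)"]
  by (simp add: harmonic_def right_diff_distrib)

lemma harmonic_diag: "harmonic k n i i = real n / real k"
  by (simp add: harmonic_def)

lemma harmonic_idem:
  assumes "n \<le> k" "k > 0"
  shows "(\<Sum>l<k. harmonic k n i l * harmonic k n l j) = harmonic k n i j"
proof -
  define D where "D x = (\<Sum>t<n. cis (freq k n t * x))" for x :: real
  have h: "complex_of_real (harmonic k n a b) = D (real a - real b) / of_nat k" for a b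
    by (simp add: harmonic_def D_def sum_cis_freq)
  have "(\<Sum>l<k. D (real i - real l) * D (real l - real j))
      = (\<Sum>l<k. \<Sum>t<n. \<Sum>u<n. cis (freq k n t * (real i - real l)) * cis (freq k n u * (real l - real j)))"
    by (simp add: D_def sum_product)
  also have "\<dots> = (\<Sum>t<n. \<Sum>u<n. \<Sum>l<k. cis (freq k n t * (real i - real l)) * cis (freq k n u * (real l - real j)))"
    by (subst sum.swap, rule sum.cong[OF refl], rule sum.swap)
  also have "\<dots> = (\<Sum>t<n. \<Sum>u<n. if t = u then of_nat k * cis (freq k n t * (real i - real j)) else 0)"
  proof (rule sum.cong[OF refl], rule sum.cong[OF refl])
    fix t u assume tu: "t \<in> {..<n}" "u \<in> {..<n}"
    \<comment> \<open>Only the difference of the two frequencies multiplies \<open>l\<close>; the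
      centring shift drops out, which leaves an integral frequency also for even
      \<open>n\<close>.\<close>
    have "cis (freq k n t * (real i - real l)) * cis (freq k n u * (real l - real j))
       = cis (freq k n t * real i - freq k n u * real j) * cis (2 * pi * real_of_int (int u - int t) / real k * real l)" for l
      unfolding cis_mult freq_def using assms(2) by (intro arg_cong[where f = cis]) (simp add: field_simps)
    then have "(\<Sum>l<k. cis (freq k n t * (real i - real l)) * cis (freq k n u * (real l - real j)))
       = cis (freq k n t * real i - freq k n u * real j) * (if int u - int t = 0 then of_nat k else 0)"
      using tu assms sum_cis_geometric[of "int u - int t" k] by (simp add: sum_distrib_left[symmetric])
    then show "(\<Sum>l<k. cis (freq k n t * (real i - real l)) * cis (freq k n u * (real l - real j)))
       = (if t = u then of_nat k * cis (freq k n t * (real i - real j)) else 0)"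
      by (auto simp: right_diff_distrib)
  qed
  also have "\<dots> = of_nat k * D (real i - real j)"
    by (simp add: D_def sum_distrib_left)
  finally have *: "(\<Sum>l<k. D (real i - real l) * D (real l - real j)) = of_nat k * D (real i - real j)" .
  have "complex_of_real (\<Sum>l<k. harmonic k n i l * harmonic k n l j)
      = (\<Sum>l<k. D (real i - real l) * D (real l - real j)) / (of_nat k * of_nat k)"
    by (simp add: h sum_divide_distrib)
  also have "\<dots> = complex_of_real (harmonic k n i j)" unfolding * h using assms(2) by simp
  finally show ?thesis by (simp only: of_real_eq_iff)
qed

text \<open>Up to a phase the entry is a geometric series in
  \<open>w = cis (2 * pi / real k)\<close>; its numerator vanishes only for
  \<open>w ^ n = 1\<close>, which \<open>0 < n < k\<close> excludes.\<close>

lemma harmonic_adjacent: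
  assumes "0 < n" "n < k"
  shows "harmonic k n (Suc i) i \<noteq> 0"
proof -
  define w where "w = cis (2 * pi / real k)"
  have w1: "w \<noteq> 1" using cis_eq_1_imp[of 1 k] assms by (auto simp: w_def)
  have "w ^ n = cis (2 * pi * real_of_int (int n) / real k)"
    using Complex.DeMoivre[of "2 * pi / real k" n] by (simp add: w_def mult_ac)
  then have wn: "w ^ n \<noteq> 1"
    using cis_eq_1_imp[of "int n" k] assms by auto
  have "(\<Sum>t<n. cis (freq k n t * (real (Suc i) - real i)))
      = (\<Sum>t<n. cis (- (2 * pi / real k * ((real n - 1) / 2))) * w ^ t)"
    unfolding w_def Complex.DeMoivre cis_mult freq_def
    by (intro sum.cong refl arg_cong[where f = cis]) (simp add: right_diff_distrib mult.commute)
  also have "\<dots> = cis (- (2 * pi / real k * ((real n - 1) / 2))) * ((w ^ n - 1) / (w - 1))"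
    using w1 by (simp add: sum_distrib_left[symmetric] geometric_sum)
  also have "\<dots> \<noteq> 0" using w1 wn by simp
  finally have "complex_of_real (\<Sum>t<n. cos (freq k n t * (real (Suc i) - real i))) \<noteq> 0"
    unfolding sum_cis_freq .
  then show ?thesis using assms unfolding harmonic_def of_real_eq_0_iff by simp
qed

lemma partition_on_trivial: "k > 0 \<Longrightarrow> partition_on {..<k} {{..<k}}"
  by (auto simp: partition_on_def disjoint_def)

lemma ex_mat_fun_of_mat:
  fixes X :: "'e::real_or_complex fmat"
  assumes "supp k X" "s \<noteq> 0"
  shows "\<exists>M\<in>carrier_mat k k. scale s (fun_of_mat k M) = X"
proof (rule bexI)
  show "mat k k (\<lambda>(i, j). of_real (1 / s) * X i j) \<in> carrier_mat k k" by simp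
  show "scale s (fun_of_mat k (mat k k (\<lambda>(i, j). of_real (1 / s) * X i j))) = X"
    using assms by (auto simp: fun_eq_iff scale_def fun_of_mat_def supp_def)
qed

lemma NN_nonempty:
  assumes "0 < n" "n < k"
  shows "(NN k n :: 'e::real_or_complex mat set) \<noteq> {}"
proof -
  define X :: "'e fmat" where "X = (\<lambda>i j. if i < k \<and> j < k then of_real (harmonic k n i j) else 0)"
  have X: "supp k X" by (auto simp: supp_def X_def)
  have "good k (same_part {{..<k}}) (real n / real k) X"
    unfolding good_def
  proof (intro conjI allI impI)
    show "blockwise k (same_part {{..<k}}) X" by (auto simp: blockwise_def X_def same_part_def)
    show "adj X = X" by (auto simp: fun_eq_iff adj_def X_def conjugate_of_real harmonic_sym[of k n])
    show "fmult k X X = X"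
    proof (intro ext)
      fix i j
      show "fmult k X X i j = X i j"
      proof (cases "i < k \<and> j < k")
        case True
        then have "fmult k X X i j = of_real (\<Sum>l<k. harmonic k n i l * harmonic k n l j)"
          by (simp add: fmult_def X_def)
        also have "\<dots> = of_real (harmonic k n i j)" using assms by (subst harmonic_idem) auto
        finally show ?thesis using True by (simp add: X_def)
      qed (auto simp: fmult_def X_def intro!: sum.neutral)
    qed
    show "X i i = of_real (real n / real k)" if "i < k" for i
      using that by (simp add: X_def harmonic_diag)
    fix w :: "nat \<Rightarrow> real" and i j
    assume w: "\<forall>i<k. \<forall>j<k. X i j \<noteq> 0 \<longrightarrow> w i = w j" and ij: "i < k" "j < k"
    \<comment> \<open>The nonzero subdiagonal entries form a path through all indices.\<close>
    have "w i = w 0" if "i < k" for i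
      using that
    proof (induction i)
      case (Suc i)
      have ik: "i < k" using Suc.prems by simp
      have "X (Suc i) i \<noteq> 0"
        using harmonic_adjacent[OF assms, of i] Suc.prems ik by (simp add: X_def)
      with w Suc.prems ik have "w (Suc i) = w i" by blast
      from HOL.trans[OF this Suc.IH[OF ik]] show ?case .
    qed simp
    from this[OF ij(1)] this[OF ij(2)] show "w i = w j" by simp
  qed
  note g = this
  have k0: "k > 0" using assms by simp
  have "real n / real k \<noteq> 0" using assms by simp
  from ex_mat_fun_of_mat[OF X this] obtain M
    where M: "M \<in> carrier_mat k k" "scale (real n / real k) (fun_of_mat k M) = X" by blast
  have "M \<in> NN k n"
    unfolding NN_def Npart_iff_good[OF assms(1) k0 partition_on_trivial[OF k0]] M(2) using M(1) g by blast
  then show ?thesis by blast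
qed

lemma good_dim_trivial:
  assumes "0 < n" "n < k"
  shows "good_dim k (same_part {{..<k}}) (real n / real k) D = real D * real n * (real k - real n) - real k + 1"
proof -
  have "block_card k (same_part {{..<k}}) i = real k" if "i < k" for i
  proof -
    have "block_card k (same_part {{..<k}}) i = (\<Sum>j<k. 1)"
      unfolding block_card_def using that by (intro sum.cong) (auto simp: same_part_def)
    then show ?thesis by simp
  qed
  then have "good_dim k (same_part {{..<k}}) (real n / real k) D
    = real D * (real n / real k) * (1 - real n / real k) * (real k * real k) - real k * (1 - 1 / real k)"
    by (simp add: good_dim_def)
  also have "\<dots> = real D * ((real n / real k) * (1 - real n / real k) * (real k * real k)) - (real k - 1)"
    using assms by (simp add: right_diff_distrib)
  also have "(real n / real k) * (1 - real n / real k) * (real k * real k) = real n * (real k - real n)"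
    using assms by (simp add: field_simps)
  finally show ?thesis by simp
qed

section \<open>Decomposition into blocks\<close>

text \<open>\<open>e i\<close> enumerates the \<open>i\<close>-th part, while
  \<open>block_of\<close> and \<open>pos\<close> invert this enumeration. Cutting a matrix into
  blocks and reassembling it become mere substitutions of indices.\<close>

locale block_enum =
  fixes k l :: nat and c :: "nat \<Rightarrow> nat" and e :: "nat \<Rightarrow> nat \<Rightarrow> nat" and block_of pos :: "nat \<Rightarrow> nat"
    and \<sigma> :: "nat set set"
  assumes \<sigma>: "partition_on {..<k} \<sigma>"
    and e_less: "\<And>i p. i < l \<Longrightarrow> p < c i \<Longrightarrow> e i p < k"
    and block_of_e: "\<And>i p. i < l \<Longrightarrow> p < c i \<Longrightarrow> block_of (e i p) = i"
    and pos_e: "\<And>i p. i < l \<Longrightarrow> p < c i \<Longrightarrow> pos (e i p) = p"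
    and block_of_less: "\<And>a. a < k \<Longrightarrow> block_of a < l"
    and pos_less: "\<And>a. a < k \<Longrightarrow> pos a < c (block_of a)"
    and e_pos: "\<And>a. a < k \<Longrightarrow> e (block_of a) (pos a) = a"
    and same_part_iff: "\<And>a b. a < k \<Longrightarrow> b < k \<Longrightarrow> same_part \<sigma> a b \<longleftrightarrow> block_of a = block_of b"

lemma ex_block_enum:
  assumes \<sigma>: "partition_on {..<k} \<sigma>" and A: "bij_betw A {..<l} \<sigma>"
    and c: "\<And>i. i < l \<Longrightarrow> card (A i) = c i"
  obtains e block_of pos where "block_enum k l c e block_of pos \<sigma>"
proof -
  have As: "A i \<in> \<sigma>" "A i \<subseteq> {..<k}" if "i < l" for i
    using bij_betwE[OF A] that partition_onD1[OF \<sigma>] by auto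
  have "\<exists>h. bij_betw h {..<c i} (A i)" if "i < l" for i
    using ex_bij_betw_nat_finite[of "A i"] As[OF that] c[OF that] finite_subset[of "A i" "{..<k}"]
    by (auto simp: atLeast0LessThan)
  then obtain e where e: "\<And>i. i < l \<Longrightarrow> bij_betw (e i) {..<c i} (A i)" by metis
  have "\<exists>i<l. a \<in> A i" if "a < k" for a
    using that partition_onD1[OF \<sigma>] bij_betw_imp_surj_on[OF A] by blast
  then obtain block_of where block_of: "\<And>a. a < k \<Longrightarrow> block_of a < l" "\<And>a. a < k \<Longrightarrow> a \<in> A (block_of a)" by metis
  have uniq: "i = j" if "i < l" "j < l" "a \<in> A i" "a \<in> A j" for i j a
  proof -
    have "A i = A j"
      using As(1)[OF that(1)] As(1)[OF that(2)] partition_onD2[OF \<sigma>] that(3,4) by (auto simp: disjoint_def)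
    then show ?thesis using bij_betw_imp_inj_on[OF A] that by (auto dest: inj_onD)
  qed
  define pos where "pos a = inv_into {..<c (block_of a)} (e (block_of a)) a" for a
  have eA: "e i p \<in> A i" if "i < l" "p < c i" for i p
    using bij_betwE[OF e[OF that(1)]] that(2) by simp
  have ek: "e i p < k" if "i < l" "p < c i" for i p
    using eA[OF that] As(2)[OF that(1)] by auto
  have bke: "block_of (e i p) = i" if "i < l" "p < c i" for i p
    using uniq[OF block_of(1)[OF ek[OF that]] that(1) block_of(2)[OF ek[OF that]] eA[OF that]] .
  have "block_enum k l c e block_of pos \<sigma>"
  proof
    fix a b assume ab: "a < k" "b < k"
    show "pos a < c (block_of a)" "e (block_of a) (pos a) = a"
      using bij_betw_inv_into_right[OF e[OF block_of(1)[OF ab(1)]] block_of(2)[OF ab(1)]]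
        bij_betwE[OF bij_betw_inv_into[OF e[OF block_of(1)[OF ab(1)]]]] block_of(2)[OF ab(1)]
      by (auto simp: pos_def)
    have "same_part \<sigma> a b \<longleftrightarrow> b \<in> A (block_of a)"
      by (rule same_part_block[OF \<sigma> As(1)[OF block_of(1)[OF ab(1)]] block_of(2)[OF ab(1)]])
    also have "\<dots> \<longleftrightarrow> block_of a = block_of b"
      using uniq[OF block_of(1)[OF ab(1)] block_of(1)[OF ab(2)] _ block_of(2)[OF ab(2)]] block_of(2)[OF ab(2)] by auto
    finally show "same_part \<sigma> a b \<longleftrightarrow> block_of a = block_of b" .
  next
    fix i p assume "i < l" "p < c i"
    then show "pos (e i p) = p"
      using bij_betw_inv_into_left[OF e, of i p] by (simp add: pos_def bke)
  qed (use \<sigma> ek bke block_of in auto)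
  then show ?thesis by (rule that)
qed

context block_enum begin

definition block :: "nat \<Rightarrow> 'e::real_or_complex fmat \<Rightarrow> 'e fmat" where
  "block i X = (\<lambda>p q. if p < c i \<and> q < c i then X (e i p) (e i q) else 0)"

definition assemble :: "(nat \<Rightarrow> 'e::real_or_complex fmat) \<Rightarrow> 'e fmat" where
  "assemble M = (\<lambda>a b. if a < k \<and> b < k \<and> block_of a = block_of b then M (block_of a) (pos a) (pos b) else 0)"

lemma assemble_block: assumes "blockwise k (same_part \<sigma>) X" shows "assemble (\<lambda>i. block i X) = X"
proof (intro HOL.ext)
  fix a b
  show "assemble (\<lambda>i. block i X) a b = X a b"
  proof (cases "a < k \<and> b < k \<and> block_of a = block_of b")
    case True
    then have "block (block_of a) X (pos a) (pos b) = X a b"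
      using pos_less[of a] pos_less[of b] e_pos[of a] e_pos[of b] by (simp add: block_def)
    then show ?thesis using True by (simp add: assemble_def)
  next
    case False
    then have "X a b = 0" using assms same_part_iff[of a b] unfolding blockwise_def by blast
    moreover have "assemble (\<lambda>i. block i X) a b = 0" unfolding assemble_def by (rule if_not_P[OF False])
    ultimately show ?thesis by simp
  qed
qed

lemma block_assemble: assumes "i < l" "supp (c i) (M i)" shows "block i (assemble M) = M i"
  using assms by (auto simp: fun_eq_iff block_def assemble_def supp_def e_less block_of_e pos_e)

lemma blockwise_assemble: "blockwise k (same_part \<sigma>) (assemble M)"
  using same_part_iff by (auto simp: blockwise_def assemble_def)

lemma blockwise_eqI:
  assumes "blockwise k (same_part \<sigma>) X" "blockwise k (same_part \<sigma>) Y" "\<And>i. i < l \<Longrightarrow> block i X = block i Y"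
  shows "X = Y"
proof -
  have "assemble (\<lambda>i. block i X) = assemble (\<lambda>i. block i Y)"
    using assms(3) block_of_less by (auto simp: assemble_def fun_eq_iff)
  then show ?thesis by (simp only: assemble_block assms(1,2))
qed

lemma block_adj: "block i (adj X) = adj (block i X)"
  by (auto simp: fun_eq_iff block_def adj_def)

lemma block_scale: "block i (scale t X) = scale t (block i X)"
  by (auto simp: fun_eq_iff block_def scale_def)

text \<open>For row and column in block \<open>i\<close>, the summation index may be restricted to
  that block, because a blockwise matrix has no entries leaving it.\<close>

lemma block_fmult:
  assumes X: "blockwise k (same_part \<sigma>) X" and i: "i < l"
  shows "block i (fmult k X X) = fmult (c i) (block i X) (block i X)"
proof (intro HOL.ext)
  fix p q
  show "block i (fmult k X X) p q = fmult (c i) (block i X) (block i X) p q"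
  proof (cases "p < c i \<and> q < c i")
    case True
    have z: "X (e i p) b = 0" if "b < k" "block_of b \<noteq> i" for b
    proof -
      have "\<not> same_part \<sigma> (e i p) b" using same_part_iff[of "e i p" b] that True i by (simp add: e_less block_of_e)
      then show ?thesis using X by (simp add: blockwise_def)
    qed
    have bij: "bij_betw (e i) {..<c i} {b. b < k \<and> block_of b = i}"
      by (rule bij_betwI[where g = pos]) (use i e_less block_of_e pos_e pos_less e_pos in auto)
    have "(\<Sum>b<k. X (e i p) b * X b (e i q)) = (\<Sum>b\<in>{b. b < k \<and> block_of b = i}. X (e i p) b * X b (e i q))"
      by (rule sum.mono_neutral_right) (auto simp: z)
    also have "\<dots> = (\<Sum>t<c i. X (e i p) (e i t) * X (e i t) (e i q))"
      by (rule sum.reindex_bij_betw[OF bij, symmetric])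
    finally show ?thesis using True by (simp add: block_def fmult_def)
  qed (auto simp: block_def fmult_def intro!: sum.neutral)
qed

text \<open>The algebraic conditions hold blockwise because a blockwise matrix is determined by its
  blocks. Connectivity passes to a block by extending functions by zero, and back by restricting
  them.\<close>

lemma good_iff_block:
  "good k (same_part \<sigma>) s X \<longleftrightarrow> blockwise k (same_part \<sigma>) X \<and> (\<forall>i<l. good (c i) (same_part {{..<c i}}) s (block i X))"
proof
  assume g: "good k (same_part \<sigma>) s X"
  then have X: "blockwise k (same_part \<sigma>) X" "adj X = X" "fmult k X X = X" "\<And>a. a < k \<Longrightarrow> X a a = of_real s"
    by (auto simp: good_def)
  have cn: "\<forall>w :: nat \<Rightarrow> real. (\<forall>i<k. \<forall>j<k. X i j \<noteq> 0 \<longrightarrow> w i = w j) \<longrightarrow>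
        (\<forall>i<k. \<forall>j<k. same_part \<sigma> i j \<longrightarrow> w i = w j)" using g by (simp add: good_def)
  have "good (c i) (same_part {{..<c i}}) s (block i X)" if i: "i < l" for i
    unfolding good_def
  proof (intro conjI allI impI)
    show "blockwise (c i) (same_part {{..<c i}}) (block i X)" by (auto simp: blockwise_def block_def same_part_def)
    show "adj (block i X) = block i X" using block_adj[of i X] X(2) by simp
    show "fmult (c i) (block i X) (block i X) = block i X" using block_fmult[OF X(1) i] X(3) by simp
    show "block i X p p = of_real s" if "p < c i" for p
      using that i X(4) e_less by (simp add: block_def)
    fix w :: "nat \<Rightarrow> real" and p q
    assume w: "\<forall>p<c i. \<forall>q<c i. block i X p q \<noteq> 0 \<longrightarrow> w p = w q" and pq: "p < c i" "q < c i"
    \<comment> \<open>The extension by zero is still constant along nonzero entries of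
      \<open>X\<close>, since these stay within one block.\<close>
    define v where "v b = (if block_of b = i then w (pos b) else 0)" for b
    have "\<forall>a<k. \<forall>b<k. X a b \<noteq> 0 \<longrightarrow> v a = v b"
    proof (intro allI impI)
      fix a b assume ab: "a < k" "b < k" "X a b \<noteq> 0"
      then have "same_part \<sigma> a b" using X(1) unfolding blockwise_def by blast
      then have bb: "block_of a = block_of b" using same_part_iff ab by simp
      show "v a = v b"
      proof (cases "block_of a = i")
        case True
        then have pl: "pos a < c i" "pos b < c i" "e i (pos a) = a" "e i (pos b) = b"
          using pos_less[OF ab(1)] pos_less[OF ab(2)] e_pos[OF ab(1)] e_pos[OF ab(2)] bb by auto
        then have "block i X (pos a) (pos b) \<noteq> 0" using ab by (simp add: block_def)
        then have "w (pos a) = w (pos b)" using w pl by blast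
        then show ?thesis using True bb by (simp add: v_def)
      qed (use bb in \<open>simp add: v_def\<close>)
    qed
    then have "\<forall>a<k. \<forall>b<k. same_part \<sigma> a b \<longrightarrow> v a = v b" using cn by blast
    moreover have "same_part \<sigma> (e i p) (e i q)" "e i p < k" "e i q < k"
      using pq i e_less block_of_e by (auto simp: same_part_iff)
    ultimately have "v (e i p) = v (e i q)" by blast
    then show "w p = w q" using pq i by (simp add: v_def block_of_e pos_e)
  qed
  then show "blockwise k (same_part \<sigma>) X \<and> (\<forall>i<l. good (c i) (same_part {{..<c i}}) s (block i X))" using X(1) by blast
next
  assume a: "blockwise k (same_part \<sigma>) X \<and> (\<forall>i<l. good (c i) (same_part {{..<c i}}) s (block i X))"
  then have X: "blockwise k (same_part \<sigma>) X" and g: "\<And>i. i < l \<Longrightarrow> good (c i) (same_part {{..<c i}}) s (block i X)"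
    by auto
  note eq = same_part_equiv[OF \<sigma>]
  show "good k (same_part \<sigma>) s X"
    unfolding good_def
  proof (intro conjI allI impI X)
    show "adj X = X"
      by (rule blockwise_eqI[OF blockwise_adj[OF eq(2) X] X]) (use g in \<open>simp add: block_adj good_def\<close>)
    show "fmult k X X = X"
      by (rule blockwise_eqI[OF blockwise_fmult[OF eq(3) X X] X]) (use g in \<open>simp add: block_fmult[OF X] good_def\<close>)
    show "X a a = of_real s" if a: "a < k" for a
    proof -
      have "block (block_of a) X (pos a) (pos a) = of_real s"
        using g[OF block_of_less[OF a]] pos_less[OF a] by (simp add: good_def)
      then show ?thesis using pos_less[OF a] e_pos[OF a] by (simp add: block_def)
    qed
    fix w :: "nat \<Rightarrow> real" and a b
    assume w: "\<forall>i<k. \<forall>j<k. X i j \<noteq> 0 \<longrightarrow> w i = w j" and ab: "a < k" "b < k" "same_part \<sigma> a b"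
    define i where "i = block_of a"
    have i: "i < l" "block_of b = i" using ab block_of_less same_part_iff by (auto simp: i_def)
    have cn: "\<forall>v :: nat \<Rightarrow> real. (\<forall>p<c i. \<forall>q<c i. block i X p q \<noteq> 0 \<longrightarrow> v p = v q) \<longrightarrow>
        (\<forall>p<c i. \<forall>q<c i. same_part {{..<c i}} p q \<longrightarrow> v p = v q)"
      using g[OF i(1)] by (simp add: good_def)
    have "\<forall>p<c i. \<forall>q<c i. block i X p q \<noteq> 0 \<longrightarrow> w (e i p) = w (e i q)"
      using w e_less[OF i(1)] by (simp add: block_def)
    then have "\<forall>p<c i. \<forall>q<c i. same_part {{..<c i}} p q \<longrightarrow> w (e i p) = w (e i q)"
      using cn[rule_format, of "\<lambda>p. w (e i p)"] by blast
    moreover have "pos a < c i" "pos b < c i"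
      using pos_less[OF ab(1)] pos_less[OF ab(2)] i(2) by (simp_all add: i_def)
    moreover from this have "same_part {{..<c i}} (pos a) (pos b)" by (auto simp: same_part_def)
    ultimately have "w (e i (pos a)) = w (e i (pos b))" by blast
    then show "w a = w b" using e_pos ab i by (metis i_def)
  qed
qed

text \<open>Extensional outside \<open>{..<l}\<close>, so that the value can be an element of the
  product of the factors.\<close>

definition split_mat :: "'e::real_or_complex mat \<Rightarrow> nat \<Rightarrow> 'e mat" where
  "split_mat R = (\<lambda>i\<in>{..<l}. mat (c i) (c i) (\<lambda>(p, q). R $$ (e i p, e i q)))"

definition assemble_mat :: "(nat \<Rightarrow> 'e::real_or_complex mat) \<Rightarrow> 'e mat" where
  "assemble_mat M = mat k k (\<lambda>(a, b). if block_of a = block_of b then M (block_of a) $$ (pos a, pos b) else 0)"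

lemma fun_of_mat_split_mat: "i < l \<Longrightarrow> fun_of_mat (c i) (split_mat R i) = block i (fun_of_mat k R)"
  by (auto simp: fun_eq_iff fun_of_mat_def split_mat_def block_def e_less)

lemma fun_of_mat_assemble_mat: "fun_of_mat k (assemble_mat M) = assemble (\<lambda>i. fun_of_mat (c i) (M i))"
proof (intro HOL.ext)
  fix a b
  show "fun_of_mat k (assemble_mat M) a b = assemble (\<lambda>i. fun_of_mat (c i) (M i)) a b"
    using pos_less[of a] pos_less[of b] by (auto simp: fun_of_mat_def assemble_mat_def assemble_def)
qed

lemma split_mat_carrier: "i < l \<Longrightarrow> split_mat R i \<in> carrier_mat (c i) (c i)"
  by (simp add: split_mat_def)

lemma assemble_mat_carrier: "assemble_mat M \<in> carrier_mat k k"
  by (simp add: assemble_mat_def)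

text \<open>The whole matrix and all its blocks share the diagonal value \<open>s\<close>. This
  common ratio is why the blocks are again of the considered kind, with parameters
  \<open>c i\<close> and \<open>N i\<close>.\<close>

context
  fixes n :: nat and N :: "nat \<Rightarrow> nat" and s :: real
  assumes n0: "n > 0" and k0: "k > 0" and N0: "\<And>i. i < l \<Longrightarrow> N i > 0" and c0: "\<And>i. i < l \<Longrightarrow> c i > 0"
    and s: "s = real n / real k" and sN: "\<And>i. i < l \<Longrightarrow> s = real (N i) / real (c i)"
begin

lemma Npart_iff: "R \<in> Npart k n \<sigma> \<longleftrightarrow> R \<in> carrier_mat k k \<and> good k (same_part \<sigma>) s (scale s (fun_of_mat k R))"
  unfolding s by (rule Npart_iff_good[OF n0 k0 \<sigma>])

lemma NN_iff:
  assumes "i < l"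
  shows "R \<in> NN (c i) (N i) \<longleftrightarrow>
    R \<in> carrier_mat (c i) (c i) \<and> good (c i) (same_part {{..<c i}}) s (scale s (fun_of_mat (c i) R))"
  unfolding NN_def sN[OF assms]
  by (rule Npart_iff_good[OF N0[OF assms] c0[OF assms] partition_on_trivial[OF c0[OF assms]]])

lemma s_nonzero: "s \<noteq> 0" using n0 k0 by (simp add: s)

lemma split_mat_in_NN:
  assumes "R \<in> Npart k n \<sigma>"
  shows "split_mat R \<in> (\<Pi>\<^sub>E i\<in>{..<l}. NN (c i) (N i))" "assemble_mat (split_mat R) = R"
proof -
  have R: "R \<in> carrier_mat k k" and g: "good k (same_part \<sigma>) s (scale s (fun_of_mat k R))"
    using assms by (auto simp: Npart_iff)
  show "split_mat R \<in> (\<Pi>\<^sub>E i\<in>{..<l}. NN (c i) (N i))"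
  proof (rule PiE_I)
    fix i assume "i \<in> {..<l}"
    then have i: "i < l" by simp
    then show "split_mat R i \<in> NN (c i) (N i)"
      using g split_mat_carrier[OF i, of R] unfolding NN_iff[OF i] fun_of_mat_split_mat[OF i] block_scale[symmetric]
      by (simp add: good_iff_block)
  qed (simp add: split_mat_def)
  have "blockwise k (same_part \<sigma>) (scale s (fun_of_mat k R))" using g by (simp add: good_def)
  then have b: "blockwise k (same_part \<sigma>) (fun_of_mat k R)" using s_nonzero by (simp add: blockwise_def scale_def)
  have "fun_of_mat k (assemble_mat (split_mat R)) = assemble (\<lambda>i. fun_of_mat (c i) (split_mat R i))" by (rule fun_of_mat_assemble_mat)
  also have "\<dots> = assemble (\<lambda>i. block i (fun_of_mat k R))"
    using block_of_less by (auto simp: assemble_def fun_eq_iff fun_of_mat_split_mat)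
  also have "\<dots> = fun_of_mat k R" by (rule assemble_block[OF b])
  finally show "assemble_mat (split_mat R) = R" by (simp add: fun_of_mat_eq_iff[OF assemble_mat_carrier R])
qed

lemma assemble_mat_in_Npart:
  assumes M: "M \<in> (\<Pi>\<^sub>E i\<in>{..<l}. NN (c i) (N i))"
  shows "assemble_mat M \<in> Npart k n \<sigma>" "split_mat (assemble_mat M) = M"
proof -
  have Mi: "M i \<in> carrier_mat (c i) (c i)" "good (c i) (same_part {{..<c i}}) s (scale s (fun_of_mat (c i) (M i)))"
    if "i < l" for i
    using M that NN_iff[OF that, of "M i"] by (auto simp: PiE_iff)
  have sa: "block i (fun_of_mat k (assemble_mat M)) = fun_of_mat (c i) (M i)" if "i < l" for i
    unfolding fun_of_mat_assemble_mat by (rule block_assemble[where M = "\<lambda>i. fun_of_mat (c i) (M i)", OF that supp_fun_of_mat])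
  have "blockwise k (same_part \<sigma>) (scale s (fun_of_mat k (assemble_mat M)))"
    unfolding fun_of_mat_assemble_mat by (rule blockwise_scale[OF blockwise_assemble])
  then show "assemble_mat M \<in> Npart k n \<sigma>"
    unfolding Npart_iff good_iff_block block_scale using sa Mi(2) assemble_mat_carrier[of M] by simp
  show "split_mat (assemble_mat M) = M"
  proof (rule HOL.ext)
    fix i
    show "split_mat (assemble_mat M) i = M i"
    proof (cases "i < l")
      case True
      have "fun_of_mat (c i) (split_mat (assemble_mat M) i) = fun_of_mat (c i) (M i)"
        unfolding fun_of_mat_split_mat[OF True] by (rule sa[OF True])
      then show ?thesis using fun_of_mat_eq_iff[OF split_mat_carrier[OF True] Mi(1)[OF True]] by blast
    next
      case False
      then show ?thesis using PiE_arb[OF M, of i] by (simp add: split_mat_def)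
    qed
  qed
qed

end

end

text \<open>Splitting and assembling only copy coordinates or insert zeros, so they are restrictions
  of maps analytic on the whole space.\<close>

lemma real_analytic_map_on_coordinates:
  assumes I: "finite I" and S: "S \<subseteq> Rpow I" and f: "\<And>x. f x \<in> Rpow J"
    and coord: "\<And>j. j \<in> J \<Longrightarrow> (\<exists>i\<in>I. \<forall>x. f x j = x i) \<or> (\<forall>x. f x j = 0)"
  shows "real_analytic_map_on I J S f"
  unfolding real_analytic_map_on_def
proof (intro ballI exI conjI)
  fix p assume "p \<in> S"
  then show "p \<in> Rpow I" using S by blast
  show "real_analytic_map I J (Rpow I) f"
    unfolding real_analytic_map_def
  proof (intro conjI ballI)
    show "openin (powertop_real I) (Rpow I)"
      by (rule openin_powertop_realI[OF I]) (auto intro: exI[of _ 1])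
    show "f \<in> Rpow I \<rightarrow> Rpow J" using f by blast
    fix x j assume "j \<in> J"
    from coord[OF this] show "real_analytic_at I (\<lambda>y. f y j) x"
    proof
      assume "\<exists>i\<in>I. \<forall>x. f x j = x i"
      then obtain i where i: "i \<in> I" "\<And>x. f x j = x i" by blast
      show ?thesis unfolding i(2) by (rule real_analytic_at_coord[OF I i(1)])
    next
      assume "\<forall>x. f x j = 0"
      then show ?thesis using real_analytic_at_const[of I 0 x] by simp
    qed
  qed
qed auto

lemma (in block_enum) diffeomorphic:
  fixes n :: nat and N :: "nat \<Rightarrow> nat"
  assumes "n > 0" "k > 0" "\<And>i. i < l \<Longrightarrow> N i > 0" "\<And>i. i < l \<Longrightarrow> c i > 0"
    and "\<And>i. i < l \<Longrightarrow> real n / real k = real (N i) / real (c i)"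
  shows "real_analytic_diffeomorphic
          (mat_idx k) (mat_coords k ` (Npart k n \<sigma> :: 'e::real_or_complex mat set))
          (prod_idx l c) (prod_coords l c ` (\<Pi>\<^sub>E i\<in>{..<l}. (NN (c i) (N i) :: 'e mat set)))"
proof -
  have split_mat_NN: "split_mat R \<in> (\<Pi>\<^sub>E i\<in>{..<l}. NN (c i) (N i))"
    if "R \<in> Npart k n \<sigma>" for R :: "'e mat"
    by (rule split_mat_in_NN(1)[OF assms(1-4) HOL.refl assms(5) that])
  have assemble_split_mat: "assemble_mat (split_mat R) = R" if "R \<in> Npart k n \<sigma>" for R :: "'e mat"
    by (rule split_mat_in_NN(2)[OF assms(1-4) HOL.refl assms(5) that])
  have assemble_in: "assemble_mat M \<in> Npart k n \<sigma>"
    if "M \<in> (\<Pi>\<^sub>E i\<in>{..<l}. NN (c i) (N i))" for M :: "nat \<Rightarrow> 'e mat"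
    by (rule assemble_mat_in_Npart(1)[OF assms(1-4) HOL.refl assms(5) that])
  have split_assemble_mat: "split_mat (assemble_mat M) = M"
    if "M \<in> (\<Pi>\<^sub>E i\<in>{..<l}. NN (c i) (N i))" for M :: "nat \<Rightarrow> 'e mat"
    by (rule assemble_mat_in_Npart(2)[OF assms(1-4) HOL.refl assms(5) that])
  define f :: "(nat \<times> nat \<times> 'e \<Rightarrow> real) \<Rightarrow> nat \<times> nat \<times> nat \<times> 'e \<Rightarrow> real" where
    "f x = (\<lambda>(i, p, q, b)\<in>prod_idx l c. x (e i p, e i q, b))" for x
  \<comment> \<open>Entries between different parts are filled with zero.\<close>
  define g :: "(nat \<times> nat \<times> nat \<times> 'e \<Rightarrow> real) \<Rightarrow> nat \<times> nat \<times> 'e \<Rightarrow> real" where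
    "g y = (\<lambda>(a, a', b)\<in>mat_idx k. if block_of a = block_of a' then y (block_of a, pos a, pos a', b) else 0)" for y
  let ?S = "Npart k n \<sigma> :: 'e mat set"
  let ?T = "\<Pi>\<^sub>E i\<in>{..<l}. (NN (c i) (N i) :: 'e mat set)"
  have f: "f (mat_coords k R) = prod_coords l c (split_mat R)" for R
    by (rule HOL.ext) (auto simp: f_def prod_coords_def prod_idx_def mat_coords_def mat_idx_def split_mat_def e_less)
  have g: "g (prod_coords l c M) = mat_coords k (assemble_mat M)" for M
  proof (rule HOL.ext)
    fix t :: "nat \<times> nat \<times> 'e"
    obtain a a' b where t: "t = (a, a', b)" by (cases t)
    show "g (prod_coords l c M) t = mat_coords k (assemble_mat M) t"
      using block_of_less[of a] pos_less[of a] pos_less[of a']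
      by (cases "block_of a = block_of a'")
        (auto simp: t g_def prod_coords_def prod_idx_def mat_coords_def mat_idx_def assemble_mat_def)
  qed
  show ?thesis
    unfolding real_analytic_diffeomorphic_def
  proof (rule exI[of _ f], rule exI[of _ g], intro conjI ballI)
    show "real_analytic_map_on (mat_idx k) (prod_idx l c) (mat_coords k ` ?S) f"
    proof (rule real_analytic_map_on_coordinates)
      show "mat_coords k ` ?S \<subseteq> Rpow (mat_idx k)" by (auto simp: mat_coords_def)
      show "f x \<in> Rpow (prod_idx l c)" for x by (simp add: f_def)
      fix j assume j: "j \<in> (prod_idx l c :: (nat \<times> nat \<times> nat \<times> 'e) set)"
      obtain i p q b where "j = (i, p, q, b)" by (cases j)
      then show "(\<exists>i\<in>mat_idx k. \<forall>x. f x j = x i) \<or> (\<forall>x. f x j = 0)"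
        using j by (intro disjI1 bexI[of _ "(e i p, e i q, b)"])
          (auto simp: f_def prod_idx_def mat_idx_def e_less)
    qed simp
    show "real_analytic_map_on (prod_idx l c) (mat_idx k) (prod_coords l c ` ?T) g"
    proof (rule real_analytic_map_on_coordinates)
      show "finite (prod_idx l c :: (nat \<times> nat \<times> nat \<times> 'e) set)" by (simp add: prod_idx_def)
      show "prod_coords l c ` ?T \<subseteq> Rpow (prod_idx l c)" by (auto simp: prod_coords_def)
      show "g y \<in> Rpow (mat_idx k)" for y by (simp add: g_def)
      fix j assume j: "j \<in> (mat_idx k :: (nat \<times> nat \<times> 'e) set)"
      obtain a a' b where jj: "j = (a, a', b)" by (cases j)
      show "(\<exists>i\<in>prod_idx l c. \<forall>x. g x j = x i) \<or> (\<forall>x. g x j = 0)"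
      proof (cases "block_of a = block_of a'")
        case True
        have "(block_of a, pos a, pos a', b) \<in> prod_idx l c"
          using j jj True block_of_less[of a] pos_less[of a] pos_less[of a'] by (auto simp: prod_idx_def mat_idx_def)
        moreover have "\<forall>x. g x j = x (block_of a, pos a, pos a', b)" using j jj True by (simp add: g_def)
        ultimately show ?thesis by blast
      qed (use j jj in \<open>simp add: g_def\<close>)
    qed
    show "f ` mat_coords k ` ?S = prod_coords l c ` ?T"
    proof (intro equalityI subsetI)
      fix y assume "y \<in> prod_coords l c ` ?T"
      then obtain M where M: "M \<in> ?T" "y = prod_coords l c M" by blast
      then have "y = f (mat_coords k (assemble_mat M))" using split_assemble_mat[OF M(1)] by (simp add: f)
      then show "y \<in> f ` mat_coords k ` ?S" using assemble_in[OF M(1)] by blast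
    qed (use split_mat_NN f in blast)
    show "g ` prod_coords l c ` ?T = mat_coords k ` ?S"
    proof (intro equalityI subsetI)
      fix x assume "x \<in> mat_coords k ` ?S"
      then obtain R where R: "R \<in> ?S" "x = mat_coords k R" by blast
      then have "x = g (prod_coords l c (split_mat R))" using assemble_split_mat[OF R(1)] by (simp add: g)
      then show "x \<in> g ` prod_coords l c ` ?T" using split_mat_NN[OF R(1)] by blast
    qed (use assemble_in g in blast)
    show "g (f x) = x" if "x \<in> mat_coords k ` ?S" for x
      using that assemble_split_mat by (auto simp: f g)
    show "f (g y) = y" if "y \<in> prod_coords l c ` ?T" for y
      using that split_assemble_mat by (auto simp: f g)
  qed
qed

lemma (in block_enum) Npart_nonempty:
  fixes n :: nat and N :: "nat \<Rightarrow> nat"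
  assumes "n > 0" "k > 0" "\<And>i. i < l \<Longrightarrow> N i > 0" "\<And>i. i < l \<Longrightarrow> N i < c i"
    and "\<And>i. i < l \<Longrightarrow> real n / real k = real (N i) / real (c i)"
  shows "(Npart k n \<sigma> :: 'e::real_or_complex mat set) \<noteq> {}"
proof -
  have c0: "c i > 0" if "i < l" for i using assms(4)[OF that] by simp
  have "(\<Pi>\<^sub>E i\<in>{..<l}. (NN (c i) (N i) :: 'e mat set)) \<noteq> {}"
    using NN_nonempty[OF assms(3) assms(4)] by (auto simp: PiE_eq_empty_iff)
  then obtain M where "M \<in> (\<Pi>\<^sub>E i\<in>{..<l}. (NN (c i) (N i) :: 'e mat set))" by blast
  from assemble_mat_in_Npart(1)[OF assms(1-3) c0 HOL.refl assms(5) this] show ?thesis by blast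
qed

lemma Npart_structure:
  fixes k n d k' n' l :: nat
  assumes n: "n \<ge> 1" and kn: "k > n" and d: "d = gcd k n" "k' = k div d" "n' = n div d"
    and \<sigma>: "\<sigma> \<in> partitions_mult k k'" and A: "bij_betw A {..<l} \<sigma>" "\<forall>i<l. card (A i) = m i * k'"
  shows "(Npart k n \<sigma> :: 'e::real_or_complex mat set) \<noteq> {} \<and>
        (\<exists>e. mat_submanifold k e (Npart k n \<sigma> :: 'e mat set)) \<and>
        real_analytic_diffeomorphic
          (mat_idx k) (mat_coords k ` (Npart k n \<sigma> :: 'e mat set))
          (prod_idx l (\<lambda>i. m i * k'))
          (prod_coords l (\<lambda>i. m i * k') `
             (\<Pi>\<^sub>E i\<in>{..<l}. (NN (m i * k') (m i * n') :: 'e mat set)))"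
proof -
  have pa: "partition_on {..<k} \<sigma>" using \<sigma> by (simp add: partitions_mult_def)
  have d0: "d > 0" and kd: "k = k' * d" and nd: "n = n' * d" using n d by auto
  have n0: "n > 0" "k > 0" using n kn by auto
  have n'0: "n' > 0" "n' < k'" using n0 kn unfolding kd nd by auto
  have m0: "m i > 0" if "i < l" for i
  proof -
    have "A i \<in> \<sigma>" using A(1) that by (auto dest: bij_betwE)
    then have "A i \<noteq> {}" "A i \<subseteq> {..<k}" using partition_onD1[OF pa] partition_onD3[OF pa] by auto
    then have "card (A i) > 0" using finite_subset by (auto simp: card_gt_0_iff)
    then show ?thesis using A(2) that by auto
  qed
  \<comment> \<open>Both fractions reduce to \<open>n' / k'\<close>, which makes all blocks
    compatible with the diagonal of the whole matrix.\<close>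
  have rat: "real n / real k = real (m i * n') / real (m i * k')" if "i < l" for i
    using m0[OF that] n'0 d0 unfolding kd nd by simp
  obtain e block_of pos where "block_enum k l (\<lambda>i. m i * k') e block_of pos \<sigma>"
    by (rule ex_block_enum[OF pa A(1)]) (use A(2) in auto)
  then interpret block_enum k l "\<lambda>i. m i * k'" e block_of pos \<sigma> .
  have ne: "(Npart k n \<sigma> :: 'e mat set) \<noteq> {}"
    by (rule Npart_nonempty[OF n0, where N = "\<lambda>i. m i * n'"]) (use m0 n'0 rat in auto)
  moreover have "\<exists>e. mat_submanifold k e (Npart k n \<sigma> :: 'e mat set)"
    by (rule ex_mat_submanifold_Npart[OF n0 pa ne])
  moreover have "real_analytic_diffeomorphic
          (mat_idx k) (mat_coords k ` (Npart k n \<sigma> :: 'e mat set))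
          (prod_idx l (\<lambda>i. m i * k'))
          (prod_coords l (\<lambda>i. m i * k') `
             (\<Pi>\<^sub>E i\<in>{..<l}. (NN (m i * k') (m i * n') :: 'e mat set)))"
    by (rule diffeomorphic[OF n0, where N = "\<lambda>i. m i * n'"]) (use m0 n'0 rat in auto)
  ultimately show ?thesis by blast
qed

theorem theorem4p6:
  fixes k n d k' n' :: nat
  assumes "n \<ge> 1" and "k > n"
    and "d = gcd k n" and "k' = k div d" and "n' = n div d"
  shows
    "((NN k n :: real mat set) \<noteq> {} \<and>
      mat_submanifold k ((k - n - 1) * (n - 1)) (NN k n :: real mat set)) \<and>
     ((NN k n :: complex mat set) \<noteq> {} \<and>
      mat_submanifold k (2 * n * (k - n) - k + 1) (NN k n :: complex mat set)) \<and>
     ((GG k n :: real mat set) = (\<Union>\<sigma>\<in>partitions_mult k k'. Npart k n \<sigma>) \<and>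
      disjoint_family_on (\<lambda>\<sigma>. Npart k n \<sigma> :: real mat set) (partitions_mult k k')) \<and>
     ((GG k n :: complex mat set) = (\<Union>\<sigma>\<in>partitions_mult k k'. Npart k n \<sigma>) \<and>
      disjoint_family_on (\<lambda>\<sigma>. Npart k n \<sigma> :: complex mat set) (partitions_mult k k')) \<and>
     (\<forall>\<sigma>\<in>partitions_mult k k'. \<forall>l A m.
        bij_betw A {..<l} \<sigma> \<and> (\<forall>i<l. card (A i) = m i * k') \<longrightarrow>
        (Npart k n \<sigma> :: real mat set) \<noteq> {} \<and>
        (\<exists>e. mat_submanifold k e (Npart k n \<sigma> :: real mat set)) \<and>
        real_analytic_diffeomorphic
          (mat_idx k) (mat_coords k ` (Npart k n \<sigma> :: real mat set))
          (prod_idx l (\<lambda>i. m i * k'))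
          (prod_coords l (\<lambda>i. m i * k') `
             (\<Pi>\<^sub>E i\<in>{..<l}. (NN (m i * k') (m i * n') :: real mat set)))) \<and>
     (\<forall>\<sigma>\<in>partitions_mult k k'. \<forall>l A m.
        bij_betw A {..<l} \<sigma> \<and> (\<forall>i<l. card (A i) = m i * k') \<longrightarrow>
        (Npart k n \<sigma> :: complex mat set) \<noteq> {} \<and>
        (\<exists>e. mat_submanifold k e (Npart k n \<sigma> :: complex mat set)) \<and>
        real_analytic_diffeomorphic
          (mat_idx k) (mat_coords k ` (Npart k n \<sigma> :: complex mat set))
          (prod_idx l (\<lambda>i. m i * k'))
          (prod_coords l (\<lambda>i. m i * k') `
             (\<Pi>\<^sub>E i\<in>{..<l}. (NN (m i * k') (m i * n') :: complex mat set))))"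
proof (intro conjI)
  have n0: "n > 0" "k > 0" using assms(1,2) by auto
  \<comment> \<open>Writing \<open>k = n + 1 + a\<close> and \<open>n = 1 + b\<close> removes the
    truncated subtractions; the real dimension becomes \<open>a * b\<close>.\<close>
  obtain a b where ab: "k = n + 1 + a" "n = 1 + b"
    using assms(1,2) by (metis Suc_eq_plus1 add.commute less_imp_Suc_add add_Suc_right le_Suc_ex plus_1_eq_Suc)
  note triv = partition_on_trivial[OF n0(2)]
  show "(NN k n :: real mat set) \<noteq> {}" "(NN k n :: complex mat set) \<noteq> {}"
    using NN_nonempty[OF n0(1) assms(2)] by blast+
  show "mat_submanifold k ((k - n - 1) * (n - 1)) (NN k n :: real mat set)"
    unfolding NN_def
  proof (rule mat_submanifold_Npart[OF n0 triv])
    show "real ((k - n - 1) * (n - 1)) = good_dim k (same_part {{..<k}}) (real n / real k) DIM(real)"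
      unfolding good_dim_trivial[OF n0(1) assms(2)] by (simp add: ab algebra_simps)
  qed
  show "mat_submanifold k (2 * n * (k - n) - k + 1) (NN k n :: complex mat set)"
    unfolding NN_def
  proof (rule mat_submanifold_Npart[OF n0 triv])
    \<comment> \<open>Ensures that the subtraction on natural numbers agrees with that on
      reals.\<close>
    have "k \<le> 2 * n * (k - n)" by (simp add: ab algebra_simps)
    then show "real (2 * n * (k - n) - k + 1) = good_dim k (same_part {{..<k}}) (real n / real k) DIM(complex)"
      unfolding good_dim_trivial[OF n0(1) assms(2)] using assms(2) by (simp add: of_nat_diff)
  qed
  show "(GG k n :: real mat set) = (\<Union>\<sigma>\<in>partitions_mult k k'. Npart k n \<sigma>)"
    "(GG k n :: complex mat set) = (\<Union>\<sigma>\<in>partitions_mult k k'. Npart k n \<sigma>)"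
    by (rule GG_eq_Union_Npart[OF n0 assms(3,4)])+
  show "disjoint_family_on (\<lambda>\<sigma>. Npart k n \<sigma> :: real mat set) (partitions_mult k k')"
    "disjoint_family_on (\<lambda>\<sigma>. Npart k n \<sigma> :: complex mat set) (partitions_mult k k')"
    by (rule disjoint_family_Npart)+
qed (intro ballI allI impI, elim conjE, rule Npart_structure[OF assms], assumption+)+

end
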